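(* Let $m>0$ and let $\psi_\hbar\in H^2(\mathbb R^d)$ be a family of wave functions, indexed by $\hbar\in(0,1]$, such that $\|\psi_\hbar\|_{L^2(\mathbb R^d)}=1$, and let $w_\hbar:=W_\hbar[|\psi_\hbar\rangle\langle\psi_\hbar|]$ be the Wigner function of the corresponding pure state. Assume that a subsequence $\psi_{\hbar_n}$, with $\hbar_n\to0$, satisfies \[ w_{\hbar_n}\to w\ \text{ in }\mathcal S'(\mathbb R^d\times\mathbb R^d),\qquad\text{and}\qquad \hbar_n\|\nabla\rho_{\hbar_n}\|_{L^2(B(0,r))}\to0\ \text{ for all }r>0 \] as $\hbar_n\to0$. Assume that \[ \mathcal E_{\hbar_n}=\tfrac1{2m}\int_{\mathbb R^d}|\xi|^2w_{\hbar_n}\,d\xi\ \to\ \mathcal E:=\tfrac1{2m}\int_{\mathbb R^d}|\xi|^2w\,d\xi\quad\text{weakly in }L^2(\mathbb R^d) \] as $\hbar_n\to 0$, while \[ \rho_{\hbar_n}:=\int_{\mathbb R^d}w_{\hbar_n}\,d\xi\ \to\ \rho:=\int_{\mathbb R^d}w\,d\xi\quad\text{and}\quad J_{\hbar_n}:=\tfrac1m\int_{\mathbb R^d}\xi\,w_{\hbar_n}\,d\xi\ \to\ J:=\tfrac1m\int_{\mathbb R^d}\xi\,w\,d\xi \] in $L^2_{loc}(\mathbb R^d)$ as $\hbar_n\to0$. Set \[ u(x):=\frac{\mathbf 1_{\rho(x)>0}}{\rho(x)}\,m\,J(x)\in\mathbb R^d . \] Then $w$ is a monokinetic, positive Borel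 measure on the phase space $\mathbb R^d\times\mathbb R^d$, i.e. \[ w=\rho(x)\,\delta(\xi-u(x)). \]
   Context: For $\psi\in L^2(\mathbb R^d)$ with $\|\psi\|_{L^2}=1$, $|\psi\rangle\langle\psi|$ denotes the rank-one orthogonal projection with integral kernel $\psi(X)\overline{\psi(Y)}$. With $\tilde R_\hbar(x,y):=\psi_\hbar(x+\tfrac\hbar2y)\overline{\psi_\hbar(x-\tfrac\hbar2y)}$, its Wigner function is \[ w_\hbar(x,\xi)=\tfrac1{(2\pi)^d}\int_{\mathbb R^d}e^{-i\xi\cdot y}\,\tilde R_\hbar(x,y)\,dy . \] The moments in $\xi$ of $w_\hbar$ are understood as \[ \rho_\hbar(x)=\tilde R_\hbar(x,0)=|\psi_\hbar(x)|^2,\quad J_\hbar(x)=-\tfrac im\nabla_y\tilde R_\hbar(x,y)\big|_{y=0},\quad \mathcal E_\hbar(x)=-\tfrac1{2m}\Delta_y\tilde R_\hbar(x,y)\big|_{y=0}. \] The limit $w$ in $\mathcal S'$ of Wigner functions of density operators as $\hbar_n\to0$ (a Wigner measure) is known to be a bounded nonnegative Radon measure on $\mathbb R^d_x\times\mathbb R^d_\xi$; $\int w\,d\xi$, $\int\xi\,w\,d\xi$, $\int|\xi|^2w\,d\xi$ denote the $x$-marginals of $w$, $\xi w$, $|\xi|^2w$, identified with their densities with respect to Lebesgue measure. $B(0,r)$ is the ball of radius $r$ centered at $0$. The measure $\rho(x)\delta(\xi-u(x))$ is defined by $\phi\mapsto\int_{\mathbb R^d}\phi(x,u(x))\rho(x)\,dx$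 for test functions $\phi$. The expression $\mathbf 1_{\rho(x)>0}/\rho(x)$ is $0$ where $\rho(x)=0$. *)

theory Defs
  imports "HOL-Analysis.Analysis"
begin

section \<open>Test functions and Schwartz functions\<close>

definition dir_deriv :: "'a::real_normed_vector \<Rightarrow> ('a \<Rightarrow> 'b::real_normed_vector) \<Rightarrow> 'a \<Rightarrow> 'b" where
  "dir_deriv v f x = frechet_derivative f (at x) v"

text \<open>A multi-index is represented by a list of basis vectors.\<close>

definition iter_deriv :: "'a::real_normed_vector list \<Rightarrow> ('a \<Rightarrow> 'b::real_normed_vector) \<Rightarrow> 'a \<Rightarrow> 'b" where
  "iter_deriv vs f = foldr dir_deriv vs f"

definition smooth :: "('a::euclidean_space \<Rightarrow> 'b::real_normed_vector) \<Rightarrow> bool" where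
  "smooth f \<longleftrightarrow> (\<forall>vs. set vs \<subseteq> Basis \<longrightarrow> iter_deriv vs f differentiable_on UNIV)"

definition test_function :: "('a::euclidean_space \<Rightarrow> real) \<Rightarrow> bool" where
  "test_function \<phi> \<longleftrightarrow> smooth \<phi> \<and> compact (closure {x. \<phi> x \<noteq> 0})"

definition schwartz :: "('a::euclidean_space \<Rightarrow> complex) \<Rightarrow> bool" where
  "schwartz \<phi> \<longleftrightarrow> smooth \<phi> \<and>
     (\<forall>vs k. set vs \<subseteq> Basis \<longrightarrow>
        bounded (range (\<lambda>x. (1 + norm x) ^ k * norm (iter_deriv vs \<phi> x))))"

text \<open>Convergence in the space of tempered distributions of a sequence of functions to a measure.\<close>

definition tempered_conv :: "(nat \<Rightarrow> 'a::euclidean_space \<Rightarrow> complex) \<Rightarrow> 'a measure \<Rightarrow> bool" where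
  "tempered_conv f \<mu> \<longleftrightarrow>
     (\<forall>\<phi>. schwartz \<phi> \<longrightarrow>
        (\<lambda>n. LINT z|lborel. f n z * \<phi> z) \<longlonglongrightarrow> (LINT z|\<mu>. \<phi> z))"

section \<open>Lebesgue and Sobolev spaces\<close>

definition L2_norm_on :: "'a::euclidean_space set \<Rightarrow> ('a \<Rightarrow> 'b::real_normed_vector) \<Rightarrow> ennreal" where
  "L2_norm_on S f =
     (let I = (\<integral>\<^sup>+x\<in>S. ennreal ((norm (f x))\<^sup>2) \<partial>lborel)
      in if I = \<infinity> then \<infinity> else ennreal (sqrt (enn2real I)))"

definition L2_fun :: "('a::euclidean_space \<Rightarrow> 'b::euclidean_space) \<Rightarrow> bool" where
  "L2_fun f \<longleftrightarrow> f \<in> borel_measurable borel \<and> L2_norm_on UNIV f < \<infinity>"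

definition L2loc_fun :: "('a::euclidean_space \<Rightarrow> 'b::euclidean_space) \<Rightarrow> bool" where
  "L2loc_fun f \<longleftrightarrow> f \<in> borel_measurable borel \<and> (\<forall>r>0. L2_norm_on (ball 0 r) f < \<infinity>)"

definition L2loc_conv ::
    "(nat \<Rightarrow> 'a::euclidean_space \<Rightarrow> 'b::euclidean_space) \<Rightarrow> ('a \<Rightarrow> 'b) \<Rightarrow> bool" where
  "L2loc_conv f g \<longleftrightarrow> (\<forall>n. L2loc_fun (f n)) \<and> L2loc_fun g \<and>
     (\<forall>r>0. (\<lambda>n. L2_norm_on (ball 0 r) (\<lambda>x. f n x - g x)) \<longlonglongrightarrow> 0)"

definition L2_weak_conv ::
    "(nat \<Rightarrow> 'a::euclidean_space \<Rightarrow> real) \<Rightarrow> ('a \<Rightarrow> real) \<Rightarrow> bool" where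
  "L2_weak_conv f g \<longleftrightarrow> (\<forall>n. L2_fun (f n)) \<and> L2_fun g \<and>
     (\<forall>v. L2_fun v \<longrightarrow> (\<lambda>n. LINT x|lborel. f n x * v x) \<longlonglongrightarrow> (LINT x|lborel. g x * v x))"

definition L1loc_fun :: "('a::euclidean_space \<Rightarrow> 'b::euclidean_space) \<Rightarrow> bool" where
  "L1loc_fun f \<longleftrightarrow> (\<forall>r>0. set_integrable lborel (ball 0 r) f)"

definition weak_partial ::
    "'a::euclidean_space \<Rightarrow> ('a \<Rightarrow> 'b::euclidean_space) \<Rightarrow> ('a \<Rightarrow> 'b) \<Rightarrow> bool" where
  "weak_partial b f g \<longleftrightarrow> L1loc_fun f \<and> L1loc_fun g \<and>
     (\<forall>\<phi>. test_function \<phi> \<longrightarrow>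
        (LINT x|lborel. dir_deriv b \<phi> x *\<^sub>R f x) = - (LINT x|lborel. \<phi> x *\<^sub>R g x))"

definition weak_gradient :: "('a::euclidean_space \<Rightarrow> real) \<Rightarrow> ('a \<Rightarrow> 'a) \<Rightarrow> bool" where
  "weak_gradient f G \<longleftrightarrow> (\<forall>b\<in>Basis. weak_partial b f (\<lambda>x. G x \<bullet> b))"

primrec sobolev_H :: "nat \<Rightarrow> ('a::euclidean_space \<Rightarrow> 'b::euclidean_space) \<Rightarrow> bool" where
  "sobolev_H 0 f \<longleftrightarrow> L2_fun f"
| "sobolev_H (Suc k) f \<longleftrightarrow> L2_fun f \<and> (\<forall>b\<in>Basis. \<exists>g. weak_partial b f g \<and> sobolev_H k g)"

section \<open>Wigner functions of pure states and their moments\<close>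

definition rot_kernel ::
    "real \<Rightarrow> ('a::euclidean_space \<Rightarrow> complex) \<Rightarrow> 'a \<Rightarrow> 'a \<Rightarrow> complex" where
  "rot_kernel h \<psi> x y = \<psi> (x + (h / 2) *\<^sub>R y) * cnj (\<psi> (x - (h / 2) *\<^sub>R y))"

definition wigner ::
    "real \<Rightarrow> (real ^ 'd \<Rightarrow> complex) \<Rightarrow> (real ^ 'd) \<times> (real ^ 'd) \<Rightarrow> complex" where
  "wigner h \<psi> = (\<lambda>(x, \<xi>).
     1 / (2 * complex_of_real pi) ^ CARD('d) *
     (LINT y|lborel. exp (- \<i> * complex_of_real (\<xi> \<bullet> y)) * rot_kernel h \<psi> x y))"

definition wigner_density :: "real \<Rightarrow> ('a::euclidean_space \<Rightarrow> complex) \<Rightarrow> 'a \<Rightarrow> real" where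
  "wigner_density h \<psi> x = Re (rot_kernel h \<psi> x 0)"

lemma rot_kernel_0: "rot_kernel h \<psi> x 0 = complex_of_real ((cmod (\<psi> x))\<^sup>2)"
  by (simp only: rot_kernel_def scaleR_zero_right add_0_right diff_zero complex_norm_square)

lemma wigner_density_eq: "wigner_density h \<psi> x = (cmod (\<psi> x))\<^sup>2"
  by (simp only: wigner_density_def rot_kernel_0 Re_complex_of_real)

text \<open>
  A function in \<open>H\<^sup>2\<close> need not be differentiable at any given point, so the derivatives in \<open>y\<close> of
  \<open>rot_kernel h \<psi> x y\<close> do not make sense for each fixed \<open>x\<close>.  They are derivatives of the map that
  sends \<open>y\<close> to the element \<open>x \<mapsto> rot_kernel h \<psi> x y\<close> of \<open>L\<^sup>1\<close>; for \<open>\<psi>\<close> in \<open>H\<^sup>2\<close> this map is twice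
  continuously differentiable.  In \<open>L1_partial b F G\<close>, the first argument of \<open>F\<close> and \<open>G\<close> is \<open>y\<close>, and
  \<open>G y\<close> is the derivative of \<open>F\<close> at \<open>y\<close> in direction \<open>b\<close>.
\<close>

definition L1_partial ::
    "'a::euclidean_space \<Rightarrow> ('a \<Rightarrow> 'a \<Rightarrow> complex) \<Rightarrow> ('a \<Rightarrow> 'a \<Rightarrow> complex) \<Rightarrow> bool" where
  "L1_partial b F G \<longleftrightarrow>
     (\<forall>y. integrable lborel (F y) \<and> integrable lborel (G y) \<and>
        ((\<lambda>t. \<integral>\<^sup>+x. ennreal (norm ((F (y + t *\<^sub>R b) x - F y x) /\<^sub>R t - G y x)) \<partial>lborel)
           \<longlongrightarrow> 0) (at (0::real)))"

text \<open>
  \<open>J\<close> is a representative of \<open>- (\<i> / m) \<nabla>\<^sub>y R\<close> at \<open>y = 0\<close>, and \<open>E\<close> one of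
  \<open>- (1 / (2 * m)) \<Delta>\<^sub>y R\<close> at \<open>y = 0\<close>, where \<open>R\<close> is the rotated kernel.
\<close>

definition wigner_current ::
    "real \<Rightarrow> real \<Rightarrow> ('a::euclidean_space \<Rightarrow> complex) \<Rightarrow> ('a \<Rightarrow> 'a) \<Rightarrow> bool" where
  "wigner_current m h \<psi> J \<longleftrightarrow>
     (\<exists>D. \<forall>b\<in>Basis. L1_partial b (\<lambda>y x. rot_kernel h \<psi> x y) (D b) \<and>
        (AE x in lborel. complex_of_real (J x \<bullet> b) = - (\<i> / complex_of_real m) * D b 0 x))"

definition wigner_energy ::
    "real \<Rightarrow> real \<Rightarrow> ('a::euclidean_space \<Rightarrow> complex) \<Rightarrow> ('a \<Rightarrow> real) \<Rightarrow> bool" where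
  "wigner_energy m h \<psi> E \<longleftrightarrow>
     (\<exists>D D2. (\<forall>b\<in>Basis. L1_partial b (\<lambda>y x. rot_kernel h \<psi> x y) (D b) \<and>
                         L1_partial b (D b) (D2 b)) \<and>
        (AE x in lborel. complex_of_real (E x) =
           - (1 / (2 * complex_of_real m)) * (\<Sum>b\<in>Basis. D2 b 0 x)))"

section \<open>Measures on phase space\<close>

text \<open>
  The \<open>x\<close>-marginal of the (vector-valued, locally finite) measure \<open>F w\<close> has density \<open>g\<close> with
  respect to Lebesgue measure.
\<close>

definition x_marginal_density ::
    "('a::euclidean_space \<times> 'a) measure \<Rightarrow> ('a \<times> 'a \<Rightarrow> 'b::euclidean_space) \<Rightarrow> ('a \<Rightarrow> 'b) \<Rightarrow> bool" where
  "x_marginal_density w F g \<longleftrightarrow>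
     (\<forall>A\<in>sets borel. bounded A \<longrightarrow>
        set_integrable w (A \<times> UNIV) F \<and> set_integrable lborel A g \<and>
        (LINT z:A \<times> UNIV|w. F z) = (LINT x:A|lborel. g x))"

definition velocity :: "real \<Rightarrow> ('a::euclidean_space \<Rightarrow> real) \<Rightarrow> ('a \<Rightarrow> 'a) \<Rightarrow> 'a \<Rightarrow> 'a" where
  "velocity m \<rho> J x = (if \<rho> x > 0 then (m / \<rho> x) *\<^sub>R J x else 0)"

text \<open>The measure \<open>\<rho>(x) \<delta>(\<xi> - u(x))\<close>.\<close>

definition monokinetic ::
    "('a::euclidean_space \<Rightarrow> real) \<Rightarrow> ('a \<Rightarrow> 'a) \<Rightarrow> ('a \<times> 'a) measure" where
  "monokinetic \<rho> u = distr (density lborel (\<lambda>x. ennreal (\<rho> x))) borel (\<lambda>x. (x, u x))"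

lemma integral_monokinetic:
  fixes \<phi> :: "'a::euclidean_space \<times> 'a \<Rightarrow> complex"
  assumes [measurable]: "\<rho> \<in> borel_measurable borel" "u \<in> borel_measurable borel"
      "\<phi> \<in> borel_measurable borel"
    and nonneg: "AE x in lborel. 0 \<le> \<rho> x"
  shows "(LINT z|monokinetic \<rho> u. \<phi> z) = (LINT x|lborel. \<rho> x *\<^sub>R \<phi> (x, u x))"
proof -
  have "(LINT z|monokinetic \<rho> u. \<phi> z)
      = (LINT x|density lborel (\<lambda>x. ennreal (\<rho> x)). \<phi> (x, u x))"
    unfolding monokinetic_def by (rule integral_distr) simp_all
  also have "\<dots> = (LINT x|lborel. \<rho> x *\<^sub>R \<phi> (x, u x))"
    by (rule integral_density) (use nonneg in simp_all)
  finally show ?thesis .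
qed

end

theory Submission
  imports Defs
begin

text \<open>
  Write \<open>p b\<close> for the weak derivatives of a wave function \<open>\<psi>\<close> in the directions of the basis, and let
  \<open>\<rho>\<close>, \<open>J\<close> and \<open>E\<close> be its density, current and energy density.  Since \<open>\<psi>\<close> is a scalar,
  \<open>|\<psi>|\<^sup>2 |p b|\<^sup>2 = (Re (p b * cnj \<psi>))\<^sup>2 + (Im (p b * cnj \<psi>))\<^sup>2\<close>, where the real part is half of the
  derivative of \<open>\<rho>\<close> and the imaginary part is \<open>m / h\<close> times a component of \<open>J\<close>.  Together with
  \<open>2 m E = h\<^sup>2 |\<nabla>\<psi>|\<^sup>2 - (h\<^sup>2 / 4) \<Delta>\<rho>\<close> this gives the pointwise identity
  \<open>2 m \<rho> E = m\<^sup>2 |J|\<^sup>2 + (h\<^sup>2 / 4) |\<nabla>\<rho>|\<^sup>2 - (h\<^sup>2 / 4) \<rho> \<Delta>\<rho>\<close>.  Tested against a smooth bump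
  and integrated by parts, the last two terms vanish in the limit because \<open>h \<nabla>\<rho>\<close> tends to \<open>0\<close> in
  \<open>L\<^sup>2\<close> on balls, and the limits satisfy \<open>2 m \<rho> E \<le> m\<^sup>2 |J|\<^sup>2\<close> almost everywhere.

  On the limit measure \<open>w\<close> this inequality is the equality case of the Cauchy-Schwarz inequality: where
  \<open>\<rho> > 0\<close>, the marginals of \<open>w\<close>, \<open>\<xi> w\<close> and \<open>|\<xi>|\<^sup>2 w\<close> show that the integral of \<open>|\<xi> - u(x)|\<^sup>2\<close>
  over a cylinder \<open>A \<times> UNIV\<close> is the integral of \<open>2 m E - m\<^sup>2 |J|\<^sup>2 / \<rho> \<le> 0\<close> over \<open>A\<close>.  Hence \<open>w\<close> is
  carried by the graph of \<open>u\<close>, and it is the image of its marginal \<open>\<rho> dx\<close> under \<open>x \<mapsto> (x, u x)\<close>.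
  This half is \<open>monokinetic_if_energy_le\<close>.

  Two points need care in the first half.  The function \<open>\<rho> \<Delta>\<rho>\<close> need not be integrable, so
  \<open>\<rho>\<close> is replaced as a multiplier by \<open>trunc e \<rho> = \<rho> / (1 + e \<rho>)\<close>; for fixed \<open>e > 0\<close> this leads to an
  inequality with the correct limit (\<open>truncated_energy_inequality\<close>, \<open>truncated_limit_inequality\<close>),
  and \<open>e\<close> tends to \<open>0\<close> only at the end.  All calculus for \<open>H\<^sup>2\<close> functions is done with difference
  quotients, which converge in \<open>L\<^sup>2\<close> to the weak derivatives (\<open>sobolev_difference_quotient\<close>); this also
  identifies the \<open>L\<^sup>1\<close> derivatives of the rotated kernel that define \<open>J\<close> and \<open>E\<close>.  Finally the energy
  densities converge only weakly, while \<open>trunc e \<rho>\<close> converges strongly; passing to the limit in the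
  product uses that weakly convergent sequences are bounded (\<open>L2_uniform_boundedness\<close>).
\<close>

section \<open>Smooth bumps on boxes\<close>

text \<open>
  The functions \<open>t \<mapsto> (1 / t) ^ k exp (- 1 / t)\<close>, extended by zero to \<open>t \<le> 0\<close>.  Their linear span is closed
  under differentiation.
\<close>

definition flat :: "nat \<Rightarrow> real \<Rightarrow> real" where
  "flat k t = (if t > 0 then (1 / t) ^ k * exp (- (1 / t)) else 0)"

lemma flat_nonneg: "0 \<le> flat k t"
  by (simp add: flat_def)

lemma flat_tendsto_0: "((flat k) \<longlongrightarrow> 0) (at 0)"
proof -
  have "((\<lambda>s::real. s ^ k / exp s) \<longlongrightarrow> 0) at_top"
    by (rule tendsto_power_div_exp_0)
  then have "((\<lambda>t::real. (inverse t) ^ k / exp (inverse t)) \<longlongrightarrow> 0) (at_right 0)"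
    by (rule filterlim_compose[OF _ filterlim_inverse_at_top_right])
  moreover have "eventually (\<lambda>t. (inverse t) ^ k / exp (inverse t) = flat k t) (at_right 0)"
    using eventually_at_right_less[of "0::real"]
    by eventually_elim (simp add: flat_def exp_minus field_simps)
  ultimately have r: "((flat k) \<longlongrightarrow> 0) (at_right 0)"
    by (rule Lim_transform_eventually)
  have "eventually (\<lambda>t. 0 = flat k t) (at_left 0)"
    by (simp add: eventually_at_left_field flat_def) (metis less_numeral_extra(1) linordered_field_no_lb)
  then have l: "((flat k) \<longlongrightarrow> 0) (at_left 0)"
    by (rule Lim_transform_eventually[OF tendsto_const])
  show ?thesis using l r by (simp add: filterlim_split_at)
qed

lemma flat_DERIV: "(flat k has_real_derivative (flat (k + 2) t - real k * flat (k + 1) t)) (at t)"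
proof -
  consider "t > 0" | "t < 0" | "t = 0" by linarith
  then show ?thesis
  proof cases
    case 1
    have "((\<lambda>t. (1 / t) ^ k * exp (- (1 / t))) has_real_derivative
       (flat (k + 2) t - real k * flat (k + 1) t)) (at t)"
      using 1
      by (auto intro!: derivative_eq_intros simp: flat_def power2_eq_square)
         (cases k; simp add: field_simps power_add)
    moreover have "eventually (\<lambda>s. flat k s = (1 / s) ^ k * exp (- (1 / s))) (nhds t)"
      using eventually_nhds_in_open[of "{0<..}" t] 1
      by (auto simp: flat_def elim: eventually_mono)
    ultimately show ?thesis by (subst DERIV_cong_ev[OF refl _ refl]) auto
  next
    case 2
    have "((\<lambda>t. 0) has_real_derivative (flat (k + 2) t - real k * flat (k + 1) t)) (at t)"
      using 2 by (simp add: flat_def)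
    moreover have "eventually (\<lambda>s. flat k s = 0) (nhds t)"
      using eventually_nhds_in_open[of "{..<0}" t] 2
      by (auto simp: flat_def elim: eventually_mono)
    ultimately show ?thesis by (subst DERIV_cong_ev[OF refl _ refl]) auto
  next
    case 3
    have "(flat k (0 + h) - flat k 0) / h = flat (Suc k) h" for h
      by (simp add: flat_def)
    then have "(flat k has_real_derivative 0) (at 0)"
      using flat_tendsto_0[of "Suc k"] unfolding DERIV_def by presburger
    then show ?thesis
      using 3 by (simp add: flat_def)
  qed
qed

text \<open>
  The algebra of functions generated by the functions \<open>flat k\<close> of affine coordinates.  It is closed under
  partial derivatives, so all its members are smooth; no product rule for iterated derivatives
  is needed.
\<close>

inductive_set flat_algebra :: "('a::euclidean_space \<Rightarrow> real) set" where
  const: "(\<lambda>x. r) \<in> flat_algebra"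
| base: "(\<lambda>x. flat k (x \<bullet> v + r)) \<in> flat_algebra"
| add: "f \<in> flat_algebra \<Longrightarrow> g \<in> flat_algebra \<Longrightarrow> (\<lambda>x. f x + g x) \<in> flat_algebra"
| mult: "f \<in> flat_algebra \<Longrightarrow> g \<in> flat_algebra \<Longrightarrow> (\<lambda>x. f x * g x) \<in> flat_algebra"

lemma flat_algebra_prod:
  "finite I \<Longrightarrow> (\<And>i. i \<in> I \<Longrightarrow> f i \<in> flat_algebra) \<Longrightarrow> (\<lambda>x. \<Prod>i\<in>I. f i x) \<in> flat_algebra"
  by (induction I rule: finite_induct) (auto intro: flat_algebra.const flat_algebra.mult)

lemma flat_algebra_derivative:
  "f \<in> flat_algebra \<Longrightarrow> \<exists>g\<in>flat_algebra. \<forall>x. \<exists>D. (f has_derivative D) (at x) \<and> D v = g x"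
proof (induction rule: flat_algebra.induct)
  case (const r)
  show ?case
    by (rule bexI[OF _ flat_algebra.const[of 0]]) (auto intro!: exI[of _ "\<lambda>_. 0"])
next
  case (base k u r)
  have l: "((\<lambda>x. x \<bullet> u + r) has_derivative (\<lambda>h. h \<bullet> u)) (at x)" for x
    by (auto intro!: derivative_eq_intros)
  have d: "((\<lambda>x. flat k (x \<bullet> u + r)) has_derivative
      (\<lambda>h. (flat (k + 2) (x \<bullet> u + r) - real k * flat (k + 1) (x \<bullet> u + r)) * (h \<bullet> u))) (at x)" for x
    using has_derivative_compose[OF l flat_DERIV[THEN has_field_derivative_imp_has_derivative]] .
  have "(\<lambda>x. (flat (k + 2) (x \<bullet> u + r) + (- real k) * flat (k + 1) (x \<bullet> u + r)) * (v \<bullet> u)) \<in> flat_algebra"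
    by (intro flat_algebra.intros)
  then show ?case
    by (rule bexI[rotated]) (use d in fastforce)
next
  case (add f g)
  then obtain f' g' where f': "f' \<in> flat_algebra" "\<forall>x. \<exists>D. (f has_derivative D) (at x) \<and> D v = f' x"
    and g': "g' \<in> flat_algebra" "\<forall>x. \<exists>D. (g has_derivative D) (at x) \<and> D v = g' x"
    by blast
  show ?case
  proof (rule bexI, intro allI)
    fix x
    obtain D D' where "(f has_derivative D) (at x)" "D v = f' x" "(g has_derivative D') (at x)" "D' v = g' x"
      using f' g' by meson
    then show "\<exists>D. ((\<lambda>x. f x + g x) has_derivative D) (at x) \<and> D v = f' x + g' x"
      by (intro exI[of _ "\<lambda>h. D h + D' h"]) (auto intro: has_derivative_add)
  qed (intro flat_algebra.intros f' g')
next
  case (mult f g)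
  then obtain f' g' where f': "f' \<in> flat_algebra" "\<forall>x. \<exists>D. (f has_derivative D) (at x) \<and> D v = f' x"
    and g': "g' \<in> flat_algebra" "\<forall>x. \<exists>D. (g has_derivative D) (at x) \<and> D v = g' x"
    by blast
  show ?case
  proof (rule bexI, intro allI)
    fix x
    obtain D D' where "(f has_derivative D) (at x)" "D v = f' x" "(g has_derivative D') (at x)" "D' v = g' x"
      using f' g' by meson
    then show "\<exists>D. ((\<lambda>x. f x * g x) has_derivative D) (at x) \<and> D v = f x * g' x + f' x * g x"
      by (intro exI[of _ "\<lambda>h. f x * D' h + D h * g x"]) (auto intro: has_derivative_mult)
  qed (intro flat_algebra.intros f' g' mult)
qed

lemma flat_algebra_differentiable: "f \<in> flat_algebra \<Longrightarrow> f differentiable (at x)"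
  using flat_algebra_derivative[of f 0] by (auto simp: differentiable_def)

lemma flat_algebra_dir_deriv: "f \<in> flat_algebra \<Longrightarrow> dir_deriv v f \<in> flat_algebra"
proof -
  assume "f \<in> flat_algebra"
  then obtain g where g: "g \<in> flat_algebra" "\<forall>x. \<exists>D. (f has_derivative D) (at x) \<and> D v = g x"
    using flat_algebra_derivative by blast
  have "dir_deriv v f = g"
    using g(2) by (metis dir_deriv_def ext frechet_derivative_at)
  then show ?thesis using g by simp
qed

lemma flat_algebra_smooth:
  assumes f: "f \<in> flat_algebra"
  shows "smooth f"
proof -
  have "iter_deriv vs f \<in> flat_algebra" for vs
    by (induction vs) (auto simp: iter_deriv_def f flat_algebra_dir_deriv)
  then show ?thesis
    by (auto simp: smooth_def differentiable_on_def intro!: differentiable_at_withinI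
        flat_algebra_differentiable)
qed

text \<open>
  A smooth function with values between \<open>0\<close> and \<open>1\<close> that vanishes outside \<open>box a c\<close>.  As \<open>k\<close> tends to
  infinity the bumps converge pointwise to the indicator function of the box.
\<close>

definition bump :: "nat \<Rightarrow> 'a::euclidean_space \<Rightarrow> 'a \<Rightarrow> 'a \<Rightarrow> real" where
  "bump k a c x = (\<Prod>b\<in>Basis. flat 0 (real (Suc k) * (x \<bullet> b - a \<bullet> b)) * flat 0 (real (Suc k) * (c \<bullet> b - x \<bullet> b)))"

lemma bump_flat_algebra: "bump k a c \<in> flat_algebra"
proof -
  have "(\<lambda>x. \<Prod>b\<in>Basis. flat 0 (x \<bullet> (real (Suc k) *\<^sub>R b) + - real (Suc k) * (a \<bullet> b)) *
      flat 0 (x \<bullet> (- real (Suc k) *\<^sub>R b) + real (Suc k) * (c \<bullet> b))) \<in> flat_algebra"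
    by (intro flat_algebra_prod flat_algebra.intros) auto
  also have "(\<lambda>x. \<Prod>b\<in>Basis. flat 0 (x \<bullet> (real (Suc k) *\<^sub>R b) + - real (Suc k) * (a \<bullet> b)) *
      flat 0 (x \<bullet> (- real (Suc k) *\<^sub>R b) + real (Suc k) * (c \<bullet> b))) = bump k a c"
    unfolding bump_def by (intro ext prod.cong refl arg_cong2[where f="(*)"] arg_cong2[where f=flat]) (auto simp: algebra_simps)
  finally show ?thesis .
qed

lemma bump_nonneg: "0 \<le> bump k a c x"
  by (auto simp: bump_def intro!: prod_nonneg mult_nonneg_nonneg flat_nonneg)

lemma flat_0_le_1: "flat 0 t \<le> 1"
  by (simp add: flat_def)

lemma bump_le_1: "bump k a c x \<le> 1"
  unfolding bump_def by (intro prod_le_1 conjI mult_nonneg_nonneg mult_le_one flat_nonneg flat_0_le_1)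

lemma bump_eq_0: "x \<notin> box a c \<Longrightarrow> bump k a c x = 0"
  by (force simp: bump_def box_def flat_def zero_less_mult_iff)

lemma bump_translate: "bump k a c (x - v) = bump k (a + v) (c + v) x"
  by (simp add: bump_def inner_simps algebra_simps)

lemma bump_tendsto: "(\<lambda>k. bump k a c x) \<longlonglongrightarrow> indicator (box a c) x"
proof (cases "x \<in> box a c")
  case True
  have *: "(\<lambda>k. flat 0 (real (Suc k) * t)) \<longlonglongrightarrow> 1" if "t > 0" for t
  proof -
    have "(\<lambda>k. exp (- (1 / (real (Suc k) * t)))) \<longlonglongrightarrow> exp (- 0)"
      using that by (intro tendsto_intros real_tendsto_divide_at_top
          filterlim_at_top_mult_tendsto_pos filterlim_compose[OF filterlim_real_sequentially filterlim_Suc])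
         (auto intro!: tendsto_divide_0[OF tendsto_const] filterlim_at_top_imp_at_infinity
          filterlim_tendsto_pos_mult_at_top filterlim_compose[OF filterlim_real_sequentially filterlim_Suc]
          filterlim_at_top_mult_tendsto_pos)
    then show ?thesis using that by (simp add: flat_def)
  qed
  have "(\<lambda>k. bump k a c x) \<longlonglongrightarrow> (\<Prod>b\<in>(Basis::'a set). 1 * 1)"
    unfolding bump_def using True by (intro tendsto_prod tendsto_mult *) (auto simp: box_def)
  then show ?thesis using True by simp
qed (simp add: bump_eq_0)

lemma bump_test_function: "test_function (bump k a c)"
proof -
  have "{x. bump k a c x \<noteq> 0} \<subseteq> cbox a c"
    using bump_eq_0 box_subset_cbox by blast
  then have "bounded {x. bump k a c x \<noteq> 0}" using bounded_subset bounded_cbox by blast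
  then show ?thesis
    by (simp add: test_function_def flat_algebra_smooth[OF bump_flat_algebra])
qed

lemma bump_continuous: "continuous_on UNIV (bump k a c)"
  by (simp add: continuous_at_imp_continuous_on differentiable_imp_continuous_within
      flat_algebra_differentiable[OF bump_flat_algebra])

lemma bump_measurable[measurable]: "bump k a c \<in> borel_measurable borel"
  by (rule borel_measurable_continuous_onI[OF bump_continuous])

lemma bump_deriv_continuous: "continuous_on UNIV (dir_deriv v (bump k a c))"
  by (simp add: continuous_at_imp_continuous_on differentiable_imp_continuous_within
      flat_algebra_differentiable[OF flat_algebra_dir_deriv[OF bump_flat_algebra]])

lemma bump_deriv_measurable[measurable]: "dir_deriv v (bump k a c) \<in> borel_measurable borel"
  by (rule borel_measurable_continuous_onI[OF bump_deriv_continuous])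

lemma bump_has_derivative: "(bump k a c has_derivative (\<lambda>v. dir_deriv v (bump k a c) x)) (at x)"
  unfolding dir_deriv_def
  using flat_algebra_differentiable[OF bump_flat_algebra] frechet_derivative_works by blast

lemma bump_line_DERIV:
  "((\<lambda>t. bump k a c (x + t *\<^sub>R v)) has_real_derivative dir_deriv v (bump k a c) (x + t *\<^sub>R v)) (at t)"
proof -
  have "((\<lambda>t. bump k a c (x + t *\<^sub>R v)) has_derivative
      (\<lambda>s. dir_deriv (s *\<^sub>R v) (bump k a c) (x + t *\<^sub>R v))) (at t)"
    by (rule has_derivative_compose[OF _ bump_has_derivative]) (auto intro!: derivative_eq_intros)
  moreover have "dir_deriv (s *\<^sub>R v) (bump k a c) y = s * dir_deriv v (bump k a c) y" for s y
    using linear_scale[OF has_derivative_linear[OF bump_has_derivative]] by auto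
  ultimately show ?thesis by (simp add: has_field_derivative_def mult_commute_abs)
qed

lemma bump_deriv_eq_0: "x \<notin> cbox a c \<Longrightarrow> dir_deriv v (bump k a c) x = 0"
proof -
  assume x: "x \<notin> cbox a c"
  have "(bump k a c has_derivative (\<lambda>_. 0)) (at x)"
  proof (rule has_derivative_transform_within_open[where f="\<lambda>_. 0" and s="- cbox a c"])
    show "0 = bump k a c y" if "y \<in> - cbox a c" for y
      using that bump_eq_0[of y a c k] box_subset_cbox[of a c] by auto
  qed (use x in auto)
  then show ?thesis by (metis dir_deriv_def frechet_derivative_at)
qed

lemma bump_deriv_bounded: obtains C where "C \<ge> 0" "\<And>x. \<bar>dir_deriv v (bump k a c) x\<bar> \<le> C"
proof -
  have "compact (dir_deriv v (bump k a c) ` cbox a c)"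
    by (intro compact_continuous_image continuous_on_subset[OF bump_deriv_continuous]) auto
  then obtain C where "\<forall>x\<in>cbox a c. \<bar>dir_deriv v (bump k a c) x\<bar> \<le> C"
    by (auto dest!: compact_imp_bounded simp: bounded_iff)
  then have "\<bar>dir_deriv v (bump k a c) x\<bar> \<le> max C 0" for x
    by (cases "x \<in> cbox a c") (force simp: bump_deriv_eq_0)+
  then show ?thesis using that[of "max C 0"] by auto
qed

lemma bump_Lipschitz:
  assumes "\<And>x. \<bar>dir_deriv v (bump k a c) x\<bar> \<le> C"
  shows "\<bar>bump k a c (x + t *\<^sub>R v) - bump k a c x\<bar> \<le> C * \<bar>t\<bar>"
proof -
  have "norm (bump k a c (x + t *\<^sub>R v) - bump k a c (x + 0 *\<^sub>R v)) \<le> C * norm (t - 0)"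
    by (rule field_differentiable_bound[of UNIV _ "\<lambda>t. dir_deriv v (bump k a c) (x + t *\<^sub>R v)"])
       (use bump_line_DERIV assms in auto)
  then show ?thesis by simp
qed

lemma bump_difference_quotient_le:
  assumes "\<And>x. \<bar>dir_deriv v (bump k a c) x\<bar> \<le> C" and "t \<noteq> 0"
  shows "\<bar>(bump k a c (x - t *\<^sub>R v) - bump k a c x) / t\<bar> \<le> C"
proof -
  have "\<bar>bump k a c (x + (- t) *\<^sub>R v) - bump k a c x\<bar> \<le> C * \<bar>- t\<bar>"
    by (rule bump_Lipschitz[OF assms(1)])
  then show ?thesis
    using assms(2) unfolding abs_divide by (subst pos_divide_le_eq) auto
qed

lemma bump_difference_quotient_tendsto:
  assumes "t \<longlonglongrightarrow> 0" "\<And>n. t n \<noteq> 0"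
  shows "(\<lambda>n. (bump k a c (x - t n *\<^sub>R v) - bump k a c x) / t n) \<longlonglongrightarrow> - dir_deriv v (bump k a c) x"
proof -
  have "((\<lambda>s. bump k a c (x + s *\<^sub>R v)) has_real_derivative dir_deriv v (bump k a c) x) (at 0)"
    using bump_line_DERIV[of k a c x v 0] by simp
  then have "((\<lambda>s. (bump k a c (x + s *\<^sub>R v) - bump k a c x) / s) \<longlongrightarrow> dir_deriv v (bump k a c) x) (at 0)"
    by (simp add: DERIV_def)
  moreover have "filterlim (\<lambda>n. - t n) (at 0) sequentially"
    using tendsto_minus[OF assms(1)] assms(2) by (auto simp: filterlim_at)
  ultimately have "(\<lambda>n. (bump k a c (x + (- t n) *\<^sub>R v) - bump k a c x) / (- t n)) \<longlonglongrightarrow> dir_deriv v (bump k a c) x"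
    by (rule filterlim_compose)
  from tendsto_minus[OF this] show ?thesis by simp
qed

section \<open>The fundamental lemma of the calculus of variations\<close>

lemma bounded_subset_ball0:
  fixes A :: "'a::real_normed_vector set"
  assumes "bounded A"
  obtains r where "r > 0" "A \<subseteq> ball 0 r"
  using bounded_subset_ballD[OF assms, of 0] by blast

lemma L1loc_fun_set_integrable:
  assumes f: "L1loc_fun f" and A: "A \<in> sets borel" "bounded A"
  shows "set_integrable lborel A f"
proof -
  obtain r where "r > 0" "A \<subseteq> ball 0 r" using bounded_subset_ball0 A(2) .
  then show ?thesis
    using f A by (intro set_integrable_subset[of lborel "ball 0 r" f A]) (auto simp: L1loc_fun_def)
qed

lemma measurable_if_on_balls:
  fixes f :: "'a::euclidean_space \<Rightarrow> 'b::euclidean_space"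
  assumes "\<And>n::nat. (\<lambda>x. indicator (ball 0 (real (Suc n))) x *\<^sub>R f x) \<in> borel_measurable borel"
  shows "f \<in> borel_measurable borel"
proof (rule borel_measurable_LIMSEQ_metric[OF assms])
  fix x :: 'a
  obtain N :: nat where "norm x < real N" using reals_Archimedean2 by blast
  then have "eventually (\<lambda>n. indicator (ball 0 (real (Suc n))) x *\<^sub>R f x = f x) sequentially"
    by (intro eventually_sequentiallyI[of N]) auto
  then show "(\<lambda>n. indicator (ball 0 (real (Suc n))) x *\<^sub>R f x) \<longlonglongrightarrow> f x"
    by (rule tendsto_eventually)
qed

lemma L1loc_fun_measurable:
  assumes "L1loc_fun f"
  shows "f \<in> borel_measurable borel"
proof (rule measurable_if_on_balls)
  fix n :: nat
  have "set_integrable lborel (ball 0 (real (Suc n))) f"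
    using assms by (auto simp: L1loc_fun_def)
  then show "(\<lambda>x. indicator (ball 0 (real (Suc n))) x *\<^sub>R f x) \<in> borel_measurable borel"
    unfolding set_integrable_def by (auto dest: borel_measurable_integrable)
qed

lemma integrable_bounded_times_L1loc:
  fixes \<phi> :: "'a::euclidean_space \<Rightarrow> real"
  assumes f: "L1loc_fun f" and [measurable]: "\<phi> \<in> borel_measurable borel"
    and C: "\<And>x. \<bar>\<phi> x\<bar> \<le> C" and A: "A \<in> sets borel" "bounded A" "\<And>x. x \<notin> A \<Longrightarrow> \<phi> x = 0"
  shows "integrable lborel (\<lambda>x. \<phi> x *\<^sub>R f x)"
proof -
  note [measurable] = L1loc_fun_measurable[OF f]
  show ?thesis
  proof (rule Bochner_Integration.integrable_bound)
    show "integrable lborel (\<lambda>x. C *\<^sub>R (indicator A x *\<^sub>R f x))"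
      using L1loc_fun_set_integrable[OF f A(1,2)] unfolding set_integrable_def
      by (rule integrable_scaleR_right)
    show "AE x in lborel. norm (\<phi> x *\<^sub>R f x) \<le> norm (C *\<^sub>R (indicator A x *\<^sub>R f x))"
    proof (rule AE_I2)
      fix x
      have "\<bar>\<phi> x\<bar> \<le> \<bar>C\<bar>" using C[of x] by linarith
      then show "norm (\<phi> x *\<^sub>R f x) \<le> norm (C *\<^sub>R (indicator A x *\<^sub>R f x))"
        using A(3)[of x] by (cases "x \<in> A") (auto intro: mult_right_mono)
    qed
  qed measurable
qed

lemma integrable_bump_times_L1loc:
  "L1loc_fun f \<Longrightarrow> integrable lborel (\<lambda>x. bump k a c x *\<^sub>R f x)"
  by (rule integrable_bounded_times_L1loc[where C=1 and A="box a c"])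
     (auto simp: bump_eq_0 bump_nonneg bump_le_1)

text \<open>
  The hypothesis passes from bumps to indicators of boxes, and Lebesgue differentiation recovers the
  values of \<open>f\<close> from its means over small boxes.
\<close>

lemma AE_nonpos_if_bump_integrals_nonpos:
  fixes f :: "'a::euclidean_space \<Rightarrow> real"
  assumes f: "L1loc_fun f"
    and le: "\<And>k a c. (LINT x|lborel. bump k a c x * f x) \<le> 0"
  shows "AE x in lborel. f x \<le> 0"
proof -
  note [measurable] = L1loc_fun_measurable[OF f]
  have box: "(LINT x:box a c|lborel. f x) \<le> 0" for a c
  proof (rule LIMSEQ_le_const2)
    show "(\<lambda>k. LINT x|lborel. bump k a c x * f x) \<longlonglongrightarrow> (LINT x:box a c|lborel. f x)"
      unfolding set_lebesgue_integral_def
    proof (rule integral_dominated_convergence[where w="\<lambda>x. norm (indicator (box a c) x *\<^sub>R f x)"])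
      show "integrable lborel (\<lambda>x. norm (indicator (box a c) x *\<^sub>R f x))"
        using L1loc_fun_set_integrable[OF f, of "box a c"] unfolding set_integrable_def by simp
      show "AE x in lborel. norm (bump k a c x * f x) \<le> norm (indicator (box a c) x *\<^sub>R f x)" for k
      proof (rule AE_I2)
        fix x
        show "norm (bump k a c x * f x) \<le> norm (indicator (box a c) x *\<^sub>R f x)"
          using bump_le_1[of k a c x] bump_nonneg[of k a c x] bump_eq_0[of x a c k]
          by (cases "x \<in> box a c") (auto simp: abs_mult intro: mult_left_le_one_le)
      qed
      show "AE x in lborel. (\<lambda>k. bump k a c x * f x) \<longlonglongrightarrow> indicator (box a c) x *\<^sub>R f x"
        by (auto intro!: AE_I2 tendsto_mult bump_tendsto)
    qed measurable
  qed (use le in auto)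
  have "f integrable_on cbox a b" for a b
    using set_borel_integral_eq_integral(1)[OF L1loc_fun_set_integrable[OF f, of "cbox a b"]] by simp
  then obtain N where N: "negligible N"
    "\<And>x e. x \<notin> N \<Longrightarrow> 0 < e \<Longrightarrow> \<exists>d>0. \<forall>h. 0 < h \<and> h < d \<longrightarrow>
        norm (integral (cbox x (x + h *\<^sub>R One)) f /\<^sub>R h ^ DIM('a) - f x) < e"
    using integrable_ccontinuous_explicit by blast
  have "f x \<le> 0" if xN: "x \<notin> N" for x
  proof (rule ccontr)
    assume "\<not> f x \<le> 0"
    then obtain d where d: "d > 0" "\<forall>h. 0 < h \<and> h < d \<longrightarrow>
        norm (integral (cbox x (x + h *\<^sub>R One)) f /\<^sub>R h ^ DIM('a) - f x) < f x"
      using N(2)[OF xN, of "f x"] by auto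
    have "integral (cbox x (x + (d/2) *\<^sub>R One)) f = (LINT x:box x (x + (d/2) *\<^sub>R One)|lborel. f x)"
      using set_borel_integral_eq_integral(2)[OF L1loc_fun_set_integrable[OF f, of "box x (x + (d/2) *\<^sub>R One)"]]
      by (simp add: integral_open_interval)
    then have "integral (cbox x (x + (d/2) *\<^sub>R One)) f \<le> 0" using box by simp
    then have "integral (cbox x (x + (d/2) *\<^sub>R One)) f /\<^sub>R (d/2) ^ DIM('a) \<le> 0"
      unfolding real_scaleR_def using d(1) by (intro mult_nonneg_nonpos) auto
    then show False using d(2)[rule_format, of "d/2"] d(1) by auto
  qed
  then have "AE x in lebesgue. f x \<le> 0"
    using N(1) by (auto simp: negligible_iff_null_sets intro!: AE_I'[of N])
  then show ?thesis by (simp add: AE_completion_iff)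
qed

lemma AE_zero_if_bump_integrals_zero:
  fixes f :: "'a::euclidean_space \<Rightarrow> 'b::euclidean_space"
  assumes f: "L1loc_fun f"
    and eq: "\<And>k a c. (LINT x|lborel. bump k a c x *\<^sub>R f x) = 0"
  shows "AE x in lborel. f x = 0"
proof -
  have *: "AE x in lborel. f x \<bullet> b \<le> 0" for b
  proof (rule AE_nonpos_if_bump_integrals_nonpos)
    show "L1loc_fun (\<lambda>x. f x \<bullet> b)"
      unfolding L1loc_fun_def
    proof (intro allI impI)
      fix r :: real assume "r > 0"
      then have "integrable lborel (\<lambda>x. (indicator (ball 0 r) x *\<^sub>R f x) \<bullet> b)"
        using f by (intro integrable_inner_left) (auto simp: L1loc_fun_def set_integrable_def)
      then show "set_integrable lborel (ball 0 r) (\<lambda>x. f x \<bullet> b)"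
        by (simp add: set_integrable_def)
    qed
    fix k :: nat and a c :: 'a
    have "(LINT x|lborel. bump k a c x * (f x \<bullet> b)) = (LINT x|lborel. (bump k a c x *\<^sub>R f x) \<bullet> b)"
      by simp
    also have "\<dots> = (LINT x|lborel. bump k a c x *\<^sub>R f x) \<bullet> b"
      using integrable_bump_times_L1loc[OF f] by (intro integral_inner_left) auto
    finally show "(LINT x|lborel. bump k a c x * (f x \<bullet> b)) \<le> 0" by (simp add: eq)
  qed
  have "AE x in lborel. \<forall>b\<in>Basis. f x \<bullet> b = 0"
  proof (rule AE_finite_allI)
    fix b :: 'b
    show "AE x in lborel. f x \<bullet> b = 0"
      using *[of b] *[of "-b"] by eventually_elim simp
  qed simp
  then show ?thesis
    by eventually_elim (simp add: euclidean_all_zero_iff)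
qed

section \<open>Convergence in the Lebesgue spaces\<close>

subsection \<open>Translations of Lebesgue measure\<close>

lemma lborel_distr_translate: "distr lborel borel (\<lambda>x. x + v) = (lborel :: 'a::euclidean_space measure)"
proof -
  have "(\<lambda>x. x + v) = (+) v" by (simp add: fun_eq_iff add.commute)
  then show ?thesis by (metis lborel_distr_plus)
qed

lemma lborel_integral_translate:
  fixes f :: "'a::euclidean_space \<Rightarrow> 'b::{banach, second_countable_topology}"
  assumes [measurable]: "f \<in> borel_measurable borel"
  shows "(LINT x|lborel. f (x + v)) = (LINT x|lborel. f x)"
  by (subst (2) lborel_distr_translate[of v, symmetric]) (simp add: integral_distr)

lemma lborel_integrable_translate:
  fixes f :: "'a::euclidean_space \<Rightarrow> 'b::{banach, second_countable_topology}"
  assumes "integrable lborel f"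
  shows "integrable lborel (\<lambda>x. f (x + v))"
  by (rule integrable_distr[where M'=borel and f=f and T="\<lambda>x. x + v" and M=lborel])
     (simp_all add: lborel_distr_translate assms)

subsection \<open>Norms and limits\<close>

text \<open>
  The \<open>L\<^sup>2\<close> norm as a real number.  It is meaningful for functions that satisfy \<open>L2_fun\<close>; on these it
  agrees with \<open>L2_norm_on UNIV\<close>.
\<close>

definition L2n :: "('a::euclidean_space \<Rightarrow> 'b::euclidean_space) \<Rightarrow> real" where
  "L2n f = sqrt (LINT x|lborel. (norm (f x))\<^sup>2)"

lemma L2_fun_iff:
  "L2_fun f \<longleftrightarrow> f \<in> borel_measurable borel \<and> integrable lborel (\<lambda>x. (norm (f x))\<^sup>2)"
proof -
  have "L2_norm_on UNIV f < \<infinity> \<longleftrightarrow> (\<integral>\<^sup>+x. ennreal ((norm (f x))\<^sup>2) \<partial>lborel) < \<infinity>"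
    by (auto simp: L2_norm_on_def Let_def top.not_eq_extremum)
  then show ?thesis
    by (auto simp: L2_fun_def integrable_iff_bounded)
qed

lemma L2_fun_measurable[measurable_dest]: "L2_fun f \<Longrightarrow> f \<in> borel_measurable borel"
  by (simp add: L2_fun_def)

lemma L2_fun_integrable: "L2_fun f \<Longrightarrow> integrable lborel (\<lambda>x. (norm (f x))\<^sup>2)"
  by (simp add: L2_fun_iff)

lemma L2n_nonneg: "0 \<le> L2n f"
  by (simp add: L2n_def)

lemma L2n_power2: "(L2n f)\<^sup>2 = (LINT x|lborel. (norm (f x))\<^sup>2)"
  by (simp add: L2n_def)

lemma L2_fun_bound:
  assumes "L2_fun f" "g \<in> borel_measurable borel" "AE x in lborel. norm (g x) \<le> C * norm (f x)"
  shows "L2_fun g"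
proof -
  have "integrable lborel (\<lambda>x. (norm (g x))\<^sup>2)"
  proof (rule Bochner_Integration.integrable_bound)
    show "integrable lborel (\<lambda>x. C\<^sup>2 * (norm (f x))\<^sup>2)"
      using L2_fun_integrable[OF assms(1)] by simp
    show "AE x in lborel. norm ((norm (g x))\<^sup>2) \<le> norm (C\<^sup>2 * (norm (f x))\<^sup>2)"
      using assms(3)
    proof eventually_elim
      case (elim x)
      then have "(norm (g x))\<^sup>2 \<le> (C * norm (f x))\<^sup>2" by (rule power_mono) simp
      then show ?case by (simp add: power_mult_distrib)
    qed
  qed (use assms in measurable)
  then show ?thesis using assms by (simp add: L2_fun_iff)
qed

lemma L2_fun_scaleR: "L2_fun f \<Longrightarrow> L2_fun (\<lambda>x. r *\<^sub>R f x)"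
  by (rule L2_fun_bound[where C="\<bar>r\<bar>"]) auto

lemma L2_fun_add: "L2_fun f \<Longrightarrow> L2_fun g \<Longrightarrow> L2_fun (\<lambda>x. f x + g x)"
proof -
  assume fg: "L2_fun f" "L2_fun g"
  have "integrable lborel (\<lambda>x. (norm (f x + g x))\<^sup>2)"
  proof (rule Bochner_Integration.integrable_bound)
    show "integrable lborel (\<lambda>x. 2 * (norm (f x))\<^sup>2 + 2 * (norm (g x))\<^sup>2)"
      by (intro Bochner_Integration.integrable_add integrable_mult_right L2_fun_integrable fg)
    show "AE x in lborel. norm ((norm (f x + g x))\<^sup>2) \<le> norm (2 * (norm (f x))\<^sup>2 + 2 * (norm (g x))\<^sup>2)"
    proof (rule AE_I2)
      fix x
      have "(norm (f x + g x))\<^sup>2 \<le> (norm (f x) + norm (g x))\<^sup>2"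
        by (intro power_mono norm_triangle_ineq) auto
      also have "\<dots> \<le> 2 * (norm (f x))\<^sup>2 + 2 * (norm (g x))\<^sup>2"
        using sum_squares_bound[of "norm (f x)" "norm (g x)"] by (simp add: power2_sum)
      finally show "norm ((norm (f x + g x))\<^sup>2) \<le> norm (2 * (norm (f x))\<^sup>2 + 2 * (norm (g x))\<^sup>2)"
        by simp
    qed
  qed (use fg in measurable)
  then show ?thesis using fg by (simp add: L2_fun_iff borel_measurable_add)
qed

lemma L2_fun_uminus: "L2_fun f \<Longrightarrow> L2_fun (\<lambda>x. - f x)"
  using L2_fun_scaleR[of f "-1"] by simp

lemma L2_fun_diff: "L2_fun f \<Longrightarrow> L2_fun g \<Longrightarrow> L2_fun (\<lambda>x. f x - g x)"
  using L2_fun_add[OF _ L2_fun_uminus, of f g] by simp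

lemma L2_fun_zero: "L2_fun (\<lambda>x. 0)"
  by (simp add: L2_fun_iff)

lemma L2_fun_translate: "L2_fun f \<Longrightarrow> L2_fun (\<lambda>x. f (x + v))"
  using lborel_integrable_translate[of "\<lambda>x. (norm (f x))\<^sup>2" v] by (auto simp: L2_fun_iff)

lemma cnj_measurable[measurable]: "cnj \<in> borel_measurable borel"
  by (intro borel_measurable_continuous_onI continuous_on_cnj continuous_on_id)

lemma L2_fun_cnj: "L2_fun f \<Longrightarrow> L2_fun (\<lambda>x. cnj (f x))"
  by (rule L2_fun_bound[where C=1 and f=f])
     (simp_all add: measurable_compose[OF L2_fun_measurable cnj_measurable])

lemma L2n_translate: "L2_fun f \<Longrightarrow> L2n (\<lambda>x. f (x + v)) = L2n f"
  using lborel_integral_translate[of "\<lambda>x. (norm (f x))\<^sup>2" v] by (simp add: L2n_def L2_fun_measurable)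

lemma L2n_scaleR: "L2n (\<lambda>x. r *\<^sub>R f x) = \<bar>r\<bar> * L2n f"
  by (simp add: L2n_def power_mult_distrib real_sqrt_mult)

lemma L2n_uminus: "L2n (\<lambda>x. - f x) = L2n f"
  by (simp add: L2n_def)

lemma L2n_minus_commute: "L2n (\<lambda>x. f x - g x) = L2n (\<lambda>x. g x - f x)"
  by (simp add: L2n_def norm_minus_commute)

lemma L2_norm_on_UNIV: "L2_fun f \<Longrightarrow> L2_norm_on UNIV f = ennreal (L2n f)"
  using nn_integral_eq_integral[OF L2_fun_integrable, of f]
  by (simp add: L2_norm_on_def Let_def L2n_def)

lemma L2_norms_integrable:
  assumes "L2_fun f" "L2_fun g"
  shows "integrable lborel (\<lambda>x. norm (f x) * norm (g x))"
proof (rule Bochner_Integration.integrable_bound)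
  show "integrable lborel (\<lambda>x. (norm (f x))\<^sup>2 + (norm (g x))\<^sup>2)"
    using assms by (auto dest: L2_fun_integrable)
  show "AE x in lborel. norm (norm (f x) * norm (g x)) \<le> norm ((norm (f x))\<^sup>2 + (norm (g x))\<^sup>2)"
  proof (rule AE_I2)
    fix x
    have "norm (f x) * norm (g x) \<le> 2 * norm (f x) * norm (g x)" by simp
    also have "\<dots> \<le> (norm (f x))\<^sup>2 + (norm (g x))\<^sup>2" by (rule sum_squares_bound)
    finally show "norm (norm (f x) * norm (g x)) \<le> norm ((norm (f x))\<^sup>2 + (norm (g x))\<^sup>2)"
      by simp
  qed
qed (use assms in measurable)

lemma L2_Cauchy_Schwarz:
  assumes "L2_fun f" "L2_fun g"
  shows "(LINT x|lborel. norm (f x) * norm (g x)) \<le> L2n f * L2n g"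
proof (rule power2_le_imp_le)
  have "(\<integral>\<^sup>+x. ennreal (norm (f x)) * ennreal (norm (g x)) \<partial>lborel)\<^sup>2 \<le>
      (\<integral>\<^sup>+x. ennreal (norm (f x)) ^ 2 \<partial>lborel) * (\<integral>\<^sup>+x. ennreal (norm (g x)) ^ 2 \<partial>lborel)"
    by (rule Cauchy_Schwarz_nn_integral) (use assms in measurable)
  moreover have "(\<integral>\<^sup>+x. ennreal (norm (f x)) * ennreal (norm (g x)) \<partial>lborel) = ennreal (LINT x|lborel. norm (f x) * norm (g x))"
    using nn_integral_eq_integral[OF L2_norms_integrable[OF assms]] by (simp add: ennreal_mult)
  moreover have "(\<integral>\<^sup>+x. ennreal (norm (f x)) ^ 2 \<partial>lborel) = ennreal (LINT x|lborel. (norm (f x))\<^sup>2)"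
    "(\<integral>\<^sup>+x. ennreal (norm (g x)) ^ 2 \<partial>lborel) = ennreal (LINT x|lborel. (norm (g x))\<^sup>2)"
    using nn_integral_eq_integral[OF L2_fun_integrable[OF assms(1)]]
      nn_integral_eq_integral[OF L2_fun_integrable[OF assms(2)]] by (simp_all add: ennreal_power)
  ultimately have "(ennreal (LINT x|lborel. norm (f x) * norm (g x)))\<^sup>2 \<le>
      ennreal (LINT x|lborel. (norm (f x))\<^sup>2) * ennreal (LINT x|lborel. (norm (g x))\<^sup>2)"
    by simp
  then have "ennreal ((LINT x|lborel. norm (f x) * norm (g x))\<^sup>2) \<le>
      ennreal ((LINT x|lborel. (norm (f x))\<^sup>2) * (LINT x|lborel. (norm (g x))\<^sup>2))"
    by (subst ennreal_power[symmetric], simp, subst ennreal_mult) auto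
  then have "(LINT x|lborel. norm (f x) * norm (g x))\<^sup>2 \<le>
      (LINT x|lborel. (norm (f x))\<^sup>2) * (LINT x|lborel. (norm (g x))\<^sup>2)"
    by (subst (asm) ennreal_le_iff) auto
  then show "(LINT x|lborel. norm (f x) * norm (g x))\<^sup>2 \<le> (L2n f * L2n g)\<^sup>2"
    by (simp add: power_mult_distrib L2n_power2)
qed (simp add: L2n_nonneg)

lemma L2n_triangle:
  assumes "L2_fun f" "L2_fun g"
  shows "L2n (\<lambda>x. f x + g x) \<le> L2n f + L2n g"
proof (rule power2_le_imp_le)
  note int = L2_fun_integrable[OF assms(1)] L2_fun_integrable[OF assms(2)] L2_norms_integrable[OF assms]
  have "(L2n (\<lambda>x. f x + g x))\<^sup>2 \<le> (LINT x|lborel. (norm (f x))\<^sup>2 + (norm (g x))\<^sup>2 + 2 * (norm (f x) * norm (g x)))"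
    unfolding L2n_power2
  proof (rule integral_mono)
    show "integrable lborel (\<lambda>x. (norm (f x + g x))\<^sup>2)"
      using L2_fun_integrable[OF L2_fun_add[OF assms]] .
    show "integrable lborel (\<lambda>x. (norm (f x))\<^sup>2 + (norm (g x))\<^sup>2 + 2 * (norm (f x) * norm (g x)))"
      using int by simp
    show "(norm (f x + g x))\<^sup>2 \<le> (norm (f x))\<^sup>2 + (norm (g x))\<^sup>2 + 2 * (norm (f x) * norm (g x))" for x
      using power_mono[OF norm_triangle_ineq[of "f x" "g x"], of 2] by (simp add: power2_sum)
  qed
  also have "\<dots> = (L2n f)\<^sup>2 + (L2n g)\<^sup>2 + 2 * (LINT x|lborel. norm (f x) * norm (g x))"
    using int by (simp add: L2n_power2)
  also have "\<dots> \<le> (L2n f + L2n g)\<^sup>2"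
    using L2_Cauchy_Schwarz[OF assms] by (simp add: power2_sum)
  finally show "(L2n (\<lambda>x. f x + g x))\<^sup>2 \<le> (L2n f + L2n g)\<^sup>2" .
qed (simp add: L2n_nonneg)

lemma L2n_mono_AE: "AE x in lborel. norm (f x) \<le> norm (g x) \<Longrightarrow> L2_fun f \<Longrightarrow> L2_fun g \<Longrightarrow> L2n f \<le> L2n g"
  unfolding L2n_def by (intro real_sqrt_le_mono integral_mono_AE L2_fun_integrable) auto

text \<open>
  Convergence of sequences in \<open>L\<^sup>2\<close> and in \<open>L\<^sup>1\<close>; membership of all terms and of the limit is part of the
  notion.
\<close>

definition L2_lim :: "(nat \<Rightarrow> 'a::euclidean_space \<Rightarrow> 'b::euclidean_space) \<Rightarrow> ('a \<Rightarrow> 'b) \<Rightarrow> bool" where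
  "L2_lim F f \<longleftrightarrow> (\<forall>n. L2_fun (F n)) \<and> L2_fun f \<and> (\<lambda>n. L2n (\<lambda>x. F n x - f x)) \<longlonglongrightarrow> 0"

definition L1_lim :: "(nat \<Rightarrow> 'a::euclidean_space \<Rightarrow> 'b::euclidean_space) \<Rightarrow> ('a \<Rightarrow> 'b) \<Rightarrow> bool" where
  "L1_lim F f \<longleftrightarrow> (\<forall>n. integrable lborel (F n)) \<and> integrable lborel f \<and>
     (\<lambda>n. LINT x|lborel. norm (F n x - f x)) \<longlonglongrightarrow> 0"

lemma L2_lim_const: "L2_fun f \<Longrightarrow> L2_lim (\<lambda>n. f) f"
  by (simp add: L2_lim_def L2n_def)

lemma L2_lim_cnj: "L2_lim F f \<Longrightarrow> L2_lim (\<lambda>n x. cnj (F n x)) (\<lambda>x. cnj (f x))"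
  by (simp add: L2_lim_def L2_fun_cnj L2n_def flip: complex_cnj_diff)

lemma bilinear_L2_integrable:
  fixes prod :: "'b::euclidean_space \<Rightarrow> 'c::euclidean_space \<Rightarrow> 'd::euclidean_space"
  assumes "bounded_bilinear prod" and fg: "L2_fun f" "L2_fun g"
  shows "integrable lborel (\<lambda>x. prod (f x) (g x))"
proof -
  interpret bounded_bilinear prod by fact
  obtain K where K: "norm (prod a b) \<le> norm a * norm b * K" for a b using bounded by blast
  show ?thesis
  proof (rule Bochner_Integration.integrable_bound)
    show "integrable lborel (\<lambda>x. norm (f x) * norm (g x) * K)"
      using L2_norms_integrable[OF fg] by simp
    have "continuous_on UNIV (\<lambda>z. prod (fst z) (snd z))"
      by (intro continuous_on continuous_intros)
    then show "(\<lambda>x. prod (f x) (g x)) \<in> borel_measurable lborel"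
      using borel_measurable_continuous_Pair[of f lborel g prod] fg by auto
    show "AE x in lborel. norm (prod (f x) (g x)) \<le> norm (norm (f x) * norm (g x) * K)"
      by (rule AE_I2) (metis K norm_ge_zero order_trans real_norm_def abs_ge_self)
  qed
qed

lemma bilinear_L2_L1_bound:
  fixes prod :: "'b::euclidean_space \<Rightarrow> 'c::euclidean_space \<Rightarrow> 'd::euclidean_space"
  assumes bb: "bounded_bilinear prod" and fg: "L2_fun f" "L2_fun g"
    and K: "\<And>a b. norm (prod a b) \<le> norm a * norm b * K"
  shows "(LINT x|lborel. norm (prod (f x) (g x))) \<le> L2n f * L2n g * \<bar>K\<bar>"
proof -
  have "(LINT x|lborel. norm (prod (f x) (g x))) \<le> (LINT x|lborel. norm (f x) * norm (g x) * \<bar>K\<bar>)"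
  proof (rule integral_mono)
    show "norm (prod (f x) (g x)) \<le> norm (f x) * norm (g x) * \<bar>K\<bar>" for x
      using K[of "f x" "g x"] by (smt (verit) mult_left_mono norm_ge_zero mult_nonneg_nonneg)
  qed (use L2_norms_integrable[OF fg] bilinear_L2_integrable[OF bb fg] in auto)
  also have "\<dots> \<le> L2n f * L2n g * \<bar>K\<bar>"
    using L2_Cauchy_Schwarz[OF fg] by (simp add: mult_right_mono)
  finally show ?thesis .
qed

lemma L2_lim_bounded_norm:
  assumes "L2_lim F f"
  shows "(\<lambda>n. L2n (F n)) \<longlonglongrightarrow> L2n f"
proof (rule Lim_transform_eventually[rotated])
  have "\<bar>L2n (F n) - L2n f\<bar> \<le> L2n (\<lambda>x. F n x - f x)" for n
  proof -
    have L2: "L2_fun (F n)" "L2_fun f" using assms by (auto simp: L2_lim_def)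
    have "L2n (F n) \<le> L2n (\<lambda>x. F n x - f x) + L2n f"
      using L2n_triangle[OF L2_fun_diff[OF L2] L2(2)] by simp
    moreover have "L2n f \<le> L2n (\<lambda>x. f x - F n x) + L2n (F n)"
      using L2n_triangle[OF L2_fun_diff[OF L2(2,1)] L2(1)] by simp
    ultimately show ?thesis unfolding L2n_minus_commute[of f "F n"] by linarith
  qed
  then have ev: "\<forall>\<^sub>F n in sequentially. norm (L2n (F n) - L2n f) \<le> L2n (\<lambda>x. F n x - f x)"
    by (intro always_eventually allI) (simp only: real_norm_def)
  have "(\<lambda>n. L2n (\<lambda>x. F n x - f x)) \<longlonglongrightarrow> 0" using assms by (simp add: L2_lim_def)
  with ev have "(\<lambda>n. L2n (F n) - L2n f) \<longlonglongrightarrow> 0" by (rule Lim_null_comparison)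
  then show "(\<lambda>n. (L2n (F n) - L2n f) + L2n f) \<longlonglongrightarrow> L2n f"
    using tendsto_add[OF _ tendsto_const, of "\<lambda>n. L2n (F n) - L2n f" 0 sequentially "L2n f"] by simp
qed simp

text \<open>
  Products of \<open>L\<^sup>2\<close> convergent sequences converge in \<open>L\<^sup>1\<close>.  The bilinear map will be the multiplication of
  complex numbers or an inner product.
\<close>

lemma L2_lim_bilinear:
  fixes prod :: "'b::euclidean_space \<Rightarrow> 'c::euclidean_space \<Rightarrow> 'd::euclidean_space"
  assumes bb: "bounded_bilinear prod" and F: "L2_lim F f" and G: "L2_lim G g"
  shows "L1_lim (\<lambda>n x. prod (F n x) (G n x)) (\<lambda>x. prod (f x) (g x))"
proof -
  interpret bounded_bilinear prod by fact
  obtain K where K: "norm (prod a b) \<le> norm a * norm b * K" for a b using bounded by blast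
  have L2: "L2_fun (F n)" "L2_fun (G n)" "L2_fun f" "L2_fun g" for n using F G by (auto simp: L2_lim_def)
  have lim: "(\<lambda>n. LINT x|lborel. norm (prod (F n x) (G n x) - prod (f x) (g x))) \<longlonglongrightarrow> 0"
  proof (rule tendsto_sandwich[OF _ _ tendsto_const])
    have "(\<lambda>n. L2n (\<lambda>x. F n x - f x) * L2n (G n) * \<bar>K\<bar> + L2n f * L2n (\<lambda>x. G n x - g x) * \<bar>K\<bar>)
       \<longlonglongrightarrow> 0 * L2n g * \<bar>K\<bar> + L2n f * 0 * \<bar>K\<bar>"
      using F G by (intro tendsto_intros L2_lim_bounded_norm) (auto simp: L2_lim_def)
    then show "(\<lambda>n. L2n (\<lambda>x. F n x - f x) * L2n (G n) * \<bar>K\<bar> + L2n f * L2n (\<lambda>x. G n x - g x) * \<bar>K\<bar>) \<longlonglongrightarrow> 0"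
      by simp
    show "\<forall>\<^sub>F n in sequentially. (LINT x|lborel. norm (prod (F n x) (G n x) - prod (f x) (g x))) \<le>
       L2n (\<lambda>x. F n x - f x) * L2n (G n) * \<bar>K\<bar> + L2n f * L2n (\<lambda>x. G n x - g x) * \<bar>K\<bar>"
    proof (rule always_eventually, rule allI)
      fix n
      note i = bilinear_L2_integrable[OF bb]
      have "(LINT x|lborel. norm (prod (F n x) (G n x) - prod (f x) (g x))) \<le>
         (LINT x|lborel. norm (prod (F n x - f x) (G n x)) + norm (prod (f x) (G n x - g x)))"
      proof (rule integral_mono)
        show "norm (prod (F n x) (G n x) - prod (f x) (g x)) \<le>
          norm (prod (F n x - f x) (G n x)) + norm (prod (f x) (G n x - g x))" for x
          using norm_triangle_ineq[of "prod (F n x - f x) (G n x)" "prod (f x) (G n x - g x)"]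
          by (simp add: diff_left diff_right)
      qed (intro Bochner_Integration.integrable_add integrable_norm Bochner_Integration.integrable_diff i L2 L2_fun_diff)+
      also have "\<dots> = (LINT x|lborel. norm (prod (F n x - f x) (G n x))) + (LINT x|lborel. norm (prod (f x) (G n x - g x)))"
        by (intro Bochner_Integration.integral_add integrable_norm i L2 L2_fun_diff)
      also have "\<dots> \<le> L2n (\<lambda>x. F n x - f x) * L2n (G n) * \<bar>K\<bar> + L2n f * L2n (\<lambda>x. G n x - g x) * \<bar>K\<bar>"
        by (intro add_mono bilinear_L2_L1_bound[OF bb _ _ K] L2 L2_fun_diff)
      finally show "(LINT x|lborel. norm (prod (F n x) (G n x) - prod (f x) (g x))) \<le>
       L2n (\<lambda>x. F n x - f x) * L2n (G n) * \<bar>K\<bar> + L2n f * L2n (\<lambda>x. G n x - g x) * \<bar>K\<bar>" .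
    qed
  qed simp
  show ?thesis
    using lim bilinear_L2_integrable[OF bb] L2 by (auto simp: L1_lim_def)
qed

lemma L1_lim_add:
  assumes "L1_lim F f" "L1_lim G g"
  shows "L1_lim (\<lambda>n x. F n x + G n x) (\<lambda>x. f x + g x)"
proof -
  have int: "integrable lborel (F n)" "integrable lborel (G n)" "integrable lborel f" "integrable lborel g" for n
    using assms by (auto simp: L1_lim_def)
  have "(\<lambda>n. LINT x|lborel. norm ((F n x + G n x) - (f x + g x))) \<longlonglongrightarrow> 0"
  proof (rule tendsto_sandwich[OF _ _ tendsto_const])
    show "(\<lambda>n. (LINT x|lborel. norm (F n x - f x)) + (LINT x|lborel. norm (G n x - g x))) \<longlonglongrightarrow> 0"
      using assms by (intro tendsto_add_zero) (auto simp: L1_lim_def)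
    have "(LINT x|lborel. norm ((F n x + G n x) - (f x + g x))) \<le>
        (LINT x|lborel. norm (F n x - f x) + norm (G n x - g x))" for n
      by (intro integral_mono) (use int norm_diff_triangle_ineq in auto)
    then show "\<forall>\<^sub>F n in sequentially. (LINT x|lborel. norm ((F n x + G n x) - (f x + g x))) \<le>
        (LINT x|lborel. norm (F n x - f x)) + (LINT x|lborel. norm (G n x - g x))"
      using int by simp
  qed simp
  then show ?thesis using int by (simp add: L1_lim_def)
qed

lemma L1_lim_linear:
  fixes T :: "'b::euclidean_space \<Rightarrow> 'c::euclidean_space"
  assumes T: "bounded_linear T" and F: "L1_lim F f"
  shows "L1_lim (\<lambda>n x. T (F n x)) (\<lambda>x. T (f x))"
proof -
  interpret bounded_linear T by fact
  obtain K where K: "norm (T a) \<le> norm a * K" for a using bounded by blast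
  have int: "integrable lborel (F n)" "integrable lborel f" for n
    using F by (auto simp: L1_lim_def)
  have "(\<lambda>n. LINT x|lborel. norm (T (F n x) - T (f x))) \<longlonglongrightarrow> 0"
  proof (rule tendsto_sandwich[OF _ _ tendsto_const])
    show "(\<lambda>n. (LINT x|lborel. norm (F n x - f x)) * K) \<longlonglongrightarrow> 0"
      using F by (intro tendsto_mult_left_zero) (auto simp: L1_lim_def)
    have "(LINT x|lborel. norm (T (F n x) - T (f x))) \<le> (LINT x|lborel. norm (F n x - f x) * K)" for n
      by (intro integral_mono) (use int K T in \<open>auto simp: diff[symmetric] intro!: integrable_bounded_linear[OF T]\<close>)
    then show "\<forall>\<^sub>F n in sequentially. (LINT x|lborel. norm (T (F n x) - T (f x))) \<le>
        (LINT x|lborel. norm (F n x - f x)) * K"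
      using int by simp
  qed simp
  then show ?thesis using int by (simp add: L1_lim_def integrable_bounded_linear[OF T])
qed

lemma L1_lim_unique:
  assumes F: "L1_lim F f" and G: "L1_lim G g" and FG: "\<And>n. AE x in lborel. F n x = G n x"
  shows "AE x in lborel. f x = g x"
proof -
  have int: "integrable lborel (F n)" "integrable lborel (G n)" "integrable lborel f" "integrable lborel g" for n
    using F G by (auto simp: L1_lim_def)
  have le: "(LINT x|lborel. norm (f x - g x)) \<le> (LINT x|lborel. norm (F n x - f x)) + (LINT x|lborel. norm (G n x - g x))" for n
  proof -
    have "(LINT x|lborel. norm (f x - g x)) \<le> (LINT x|lborel. norm (F n x - f x) + norm (G n x - g x))"
    proof (rule integral_mono_AE)
      show "AE x in lborel. norm (f x - g x) \<le> norm (F n x - f x) + norm (G n x - g x)"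
        using FG[of n]
      proof eventually_elim
        case (elim x)
        then show ?case
          using norm_triangle_ineq4[of "G n x - g x" "F n x - f x"] by simp
      qed
    qed (use int in auto)
    then show ?thesis using int by simp
  qed
  have "(\<lambda>n. (LINT x|lborel. norm (F n x - f x)) + (LINT x|lborel. norm (G n x - g x))) \<longlonglongrightarrow> 0"
    using F G by (intro tendsto_add_zero) (auto simp: L1_lim_def)
  then have "(LINT x|lborel. norm (f x - g x)) \<le> 0"
    by (rule LIMSEQ_le_const) (use le in auto)
  then have "(LINT x|lborel. norm (f x - g x)) = 0" by (intro antisym) auto
  then have "AE x in lborel. norm (f x - g x) = 0"
    using int by (subst (asm) integral_nonneg_eq_0_iff_AE) auto
  then show ?thesis by eventually_elim simp
qed

lemma L1_lim_integral_bounded_times: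
  assumes F: "L1_lim F f" and q[measurable]: "q \<in> borel_measurable borel" and C: "\<And>x. \<bar>q x\<bar> \<le> (C::real)"
  shows "(\<lambda>n. LINT x|lborel. q x *\<^sub>R F n x) \<longlonglongrightarrow> (LINT x|lborel. q x *\<^sub>R f x)"
    and "integrable lborel (\<lambda>x. q x *\<^sub>R f x)"
proof -
  have int: "integrable lborel (F n)" "integrable lborel f" for n
    using F by (auto simp: L1_lim_def)
  have C0: "\<bar>q x\<bar> \<le> \<bar>C\<bar>" for x using C[of x] by linarith
  have I: "integrable lborel (\<lambda>x. q x *\<^sub>R g x)" if "integrable lborel g" for g :: "'a \<Rightarrow> 'b"
    by (rule Bochner_Integration.integrable_bound[of _ "\<lambda>x. C *\<^sub>R g x"])
       (use that C0 in \<open>auto intro!: AE_I2 mult_right_mono borel_measurable_scaleR dest: borel_measurable_integrable\<close>)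
  show "integrable lborel (\<lambda>x. q x *\<^sub>R f x)" using I int by simp
  have "(\<lambda>n. (LINT x|lborel. q x *\<^sub>R F n x) - (LINT x|lborel. q x *\<^sub>R f x)) \<longlonglongrightarrow> 0"
  proof (rule Lim_null_comparison)
    show "(\<lambda>n. \<bar>C\<bar> * (LINT x|lborel. norm (F n x - f x))) \<longlonglongrightarrow> 0"
      using F by (intro tendsto_mult_right_zero) (auto simp: L1_lim_def)
    have "norm ((LINT x|lborel. q x *\<^sub>R F n x) - (LINT x|lborel. q x *\<^sub>R f x)) \<le> \<bar>C\<bar> * (LINT x|lborel. norm (F n x - f x))" for n
    proof -
      have "norm ((LINT x|lborel. q x *\<^sub>R F n x) - (LINT x|lborel. q x *\<^sub>R f x))
        = norm (LINT x|lborel. q x *\<^sub>R (F n x - f x))"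
        using I int by (simp add: scaleR_diff_right)
      also have "\<dots> \<le> (LINT x|lborel. \<bar>C\<bar> * norm (F n x - f x))"
        by (rule Bochner_Integration.integral_norm_bound_integral)
           (use I int C0 in \<open>auto intro: mult_right_mono\<close>)
      finally show ?thesis by simp
    qed
    then show "\<forall>\<^sub>F n in sequentially. norm ((LINT x|lborel. q x *\<^sub>R F n x) - (LINT x|lborel. q x *\<^sub>R f x))
      \<le> \<bar>C\<bar> * (LINT x|lborel. norm (F n x - f x))" by simp
  qed
  then show "(\<lambda>n. LINT x|lborel. q x *\<^sub>R F n x) \<longlonglongrightarrow> (LINT x|lborel. q x *\<^sub>R f x)"
    by (simp add: LIM_zero_iff)
qed

lemma L2_lim_AE_subseq:
  assumes "L2_lim F f"
  obtains r :: "nat \<Rightarrow> nat" where "strict_mono r" "AE x in lborel. (\<lambda>n. F (r n) x) \<longlonglongrightarrow> f x"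
proof -
  have "(\<lambda>n. (L2n (\<lambda>x. F n x - f x))\<^sup>2) \<longlonglongrightarrow> 0"
    using assms tendsto_power[of "\<lambda>n. L2n (\<lambda>x. F n x - f x)" 0 sequentially 2] by (simp add: L2_lim_def)
  then have "(\<lambda>n. LINT x|lborel. norm ((norm (F n x - f x))\<^sup>2)) \<longlonglongrightarrow> 0"
    by (simp add: L2n_power2)
  then obtain r :: "nat \<Rightarrow> nat" where r: "strict_mono r" "AE x in lborel. (\<lambda>n. (norm (F (r n) x - f x))\<^sup>2) \<longlonglongrightarrow> 0"
    using tendsto_L1_AE_subseq[of lborel "\<lambda>n x. (norm (F n x - f x))\<^sup>2"] assms
    by (auto simp: L2_lim_def L2_fun_integrable L2_fun_diff)
  have "AE x in lborel. (\<lambda>n. F (r n) x) \<longlonglongrightarrow> f x"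
    using r(2)
  proof eventually_elim
    case (elim x)
    then have "(\<lambda>n. sqrt ((norm (F (r n) x - f x))\<^sup>2)) \<longlonglongrightarrow> sqrt 0" by (rule tendsto_real_sqrt)
    then have "(\<lambda>n. F (r n) x - f x) \<longlonglongrightarrow> 0" by (simp add: tendsto_norm_zero_iff)
    then show ?case by (simp add: LIM_zero_iff)
  qed
  then show ?thesis using that r(1) by blast
qed

section \<open>Continuity of translations in the Lebesgue spaces\<close>

text \<open>
  Translations are isometries of \<open>L\<^sup>1\<close>, so the functions on which they act continuously form a closed set.
\<close>

lemma L1_lim_translate_approx:
  fixes f :: "'a::euclidean_space \<Rightarrow> 'b::euclidean_space"
  assumes f: "integrable lborel f"
    and approx: "\<And>e. e > 0 \<Longrightarrow> \<exists>g. L1_lim (\<lambda>n x. g (x + s n)) g \<and> (LINT x|lborel. norm (f x - g x)) < e"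
  shows "L1_lim (\<lambda>n x. f (x + s n)) f"
proof -
  have "(\<lambda>n. LINT x|lborel. norm (f (x + s n) - f x)) \<longlonglongrightarrow> 0"
  proof (rule LIMSEQ_I)
    fix e :: real assume e: "e > 0"
    obtain g where g: "L1_lim (\<lambda>n x. g (x + s n)) g" "(LINT x|lborel. norm (f x - g x)) < e / 3"
      using approx[of "e / 3"] e by auto
    have gi: "integrable lborel g" using g by (simp add: L1_lim_def)
    obtain N where N: "\<And>n. n \<ge> N \<Longrightarrow> norm ((LINT x|lborel. norm (g (x + s n) - g x)) - 0) < e / 3"
    proof -
      have "(\<lambda>n. LINT x|lborel. norm (g (x + s n) - g x)) \<longlonglongrightarrow> 0" using g(1) by (simp add: L1_lim_def)
      moreover have "e / 3 > 0" using e by simp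
      ultimately show ?thesis using that LIMSEQ_D by blast
    qed
    show "\<exists>N. \<forall>n\<ge>N. norm ((LINT x|lborel. norm (f (x + s n) - f x)) - 0) < e"
    proof (intro exI allI impI)
      fix n assume n: "n \<ge> N"
      have t: "(LINT x|lborel. norm (f (x + s n) - g (x + s n))) = (LINT x|lborel. norm (f x - g x))"
        using f gi by (intro lborel_integral_translate[where f="\<lambda>x. norm (f x - g x)"])
          (auto dest: borel_measurable_integrable)
      note int = f gi lborel_integrable_translate[OF f] lborel_integrable_translate[OF gi]
      have "(LINT x|lborel. norm (f (x + s n) - f x)) \<le>
        (LINT x|lborel. norm (f (x + s n) - g (x + s n)) + norm (g (x + s n) - g x) + norm (f x - g x))"
      proof (rule integral_mono)
        show "norm (f (x + s n) - f x) \<le>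
            norm (f (x + s n) - g (x + s n)) + norm (g (x + s n) - g x) + norm (f x - g x)" for x
          using norm_triangle_ineq[of "f (x + s n) - g (x + s n)" "g (x + s n) - g x"]
            norm_triangle_ineq4[of "f (x + s n) - g x" "f x - g x"] by simp
      qed (use int in auto)
      also have "\<dots> = (LINT x|lborel. norm (f x - g x)) + (LINT x|lborel. norm (g (x + s n) - g x)) +
          (LINT x|lborel. norm (f x - g x))"
        using int by (simp add: t)
      finally show "norm ((LINT x|lborel. norm (f (x + s n) - f x)) - 0) < e"
        using N[OF n] g(2) by simp
    qed
  qed
  then show ?thesis using f by (simp add: L1_lim_def lborel_integrable_translate)
qed

lemma L1_lim_translate_open:
  fixes U :: "'a::euclidean_space set"
  assumes U: "open U" "emeasure lborel U < \<infinity>" and s: "s \<longlonglongrightarrow> 0"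
  shows "L1_lim (\<lambda>n x. indicator U (x + s n) :: real) (indicator U)"
proof -
  have [measurable]: "U \<in> sets borel" using U by simp
  have i: "integrable lborel (indicator U :: 'a \<Rightarrow> real)"
    using U by (simp add: integrable_indicator_iff)
  have i1: "integrable lborel (\<lambda>x. indicator U (x + v) :: real)" for v
    by (rule lborel_integrable_translate[OF i])
  have i2: "integrable lborel (\<lambda>x. indicator U (x + v) * indicator U x :: real)" for v
    by (rule Bochner_Integration.integrable_bound[OF i]) (auto split: split_indicator)
  \<comment> \<open>For small translations, \<open>U\<close> and its translate differ by a set of small measure, since \<open>U\<close> is open.\<close>
  have "(LINT x|lborel. norm (indicator U (x + v) - indicator U x :: real)) =
      2 * measure lborel U - 2 * (LINT x|lborel. indicator U (x + v) * indicator U x)" for v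
  proof -
    have "(LINT x|lborel. norm (indicator U (x + v) - indicator U x :: real)) =
      (LINT x|lborel. indicator U (x + v) + indicator U x - 2 * (indicator U (x + v) * indicator U x))"
      by (intro Bochner_Integration.integral_cong) (auto split: split_indicator)
    also have "\<dots> = (LINT x|lborel. indicator U (x + v)) + (LINT x|lborel. indicator U x)
        - 2 * (LINT x|lborel. indicator U (x + v) * indicator U x)"
      using i i1 i2 by simp
    also have "(LINT x|lborel. indicator U (x + v)) = (LINT x|lborel. indicator U x :: real)"
      by (rule lborel_integral_translate) measurable
    finally show ?thesis by simp
  qed
  moreover have "(\<lambda>n. LINT x|lborel. indicator U (x + s n) * indicator U x) \<longlonglongrightarrow> (LINT x|lborel. indicator U x :: real)"
  proof (rule integral_dominated_convergence[OF _ _ i])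
    show "AE x in lborel. (\<lambda>n. indicator U (x + s n) * indicator U x) \<longlonglongrightarrow> (indicator U x :: real)"
    proof (rule AE_I2)
      fix x
      show "(\<lambda>n. indicator U (x + s n) * indicator U x) \<longlonglongrightarrow> (indicator U x :: real)"
      proof (cases "x \<in> U")
        case True
        have "(\<lambda>n. x + s n) \<longlonglongrightarrow> x" using tendsto_add[OF tendsto_const s, of x] by simp
        then have "eventually (\<lambda>n. x + s n \<in> U) sequentially" using U(1) True by (rule topological_tendstoD)
        then show ?thesis
          using True by (intro tendsto_eventually) (auto elim: eventually_mono)
      qed simp
    qed
  qed (auto split: split_indicator)
  then have "(\<lambda>n. 2 * measure lborel U - 2 * (LINT x|lborel. indicator U (x + s n) * indicator U x)) \<longlonglongrightarrow>
     2 * measure lborel U - 2 * (LINT x|lborel. indicator U x :: real)"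
    by (intro tendsto_intros)
  ultimately show ?thesis using i i1 by (simp add: L1_lim_def)
qed

lemma L1_lim_translate_indicator:
  fixes A :: "'a::euclidean_space set"
  assumes A: "A \<in> sets borel" "emeasure lborel A < \<infinity>" and s: "s \<longlonglongrightarrow> 0"
  shows "L1_lim (\<lambda>n x. indicator A (x + s n) :: real) (indicator A)"
proof (rule L1_lim_translate_approx)
  show "integrable lborel (indicator A :: 'a \<Rightarrow> real)"
    using A by (simp add: integrable_indicator_iff)
  fix e :: real assume e: "e > 0"
  obtain U where U: "open U" "A \<subseteq> U" "emeasure lborel (U - A) < e"
    using outer_regular_lborel[OF A(1) e] .
  have "emeasure lborel U \<le> emeasure lborel (U - A) + emeasure lborel A"
    using U A emeasure_subadditive[of "U - A" lborel A] by (simp add: Un_absorb2)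
  also have "\<dots> < \<infinity>"
    using order_less_trans[OF U(3) ennreal_less_top] A(2) by (simp add: ennreal_add_less_top)
  finally have Uf: "emeasure lborel U < \<infinity>" .
  have "(LINT x|lborel. norm (indicator A x - indicator U x :: real)) = (LINT x|lborel. indicator (U - A) x)"
    using U(2) by (intro Bochner_Integration.integral_cong) (auto split: split_indicator)
  also have "\<dots> = measure lborel (U - A)" by simp
  also have "\<dots> < e"
  proof -
    have "emeasure lborel (U - A) = ennreal (measure lborel (U - A))"
      using order_less_trans[OF U(3) ennreal_less_top] by (intro emeasure_eq_ennreal_measure) auto
    then show ?thesis using U(3) e by (simp add: ennreal_less_iff)
  qed
  finally show "\<exists>g. L1_lim (\<lambda>n x. g (x + s n)) g \<and> (LINT x|lborel. norm (indicator A x - g x :: real)) < e"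
    using L1_lim_translate_open[OF U(1) Uf s] by blast
qed

lemma L1_lim_translate:
  fixes f :: "'a::euclidean_space \<Rightarrow> 'b::euclidean_space"
  assumes f: "integrable lborel f" and s: "s \<longlonglongrightarrow> 0"
  shows "L1_lim (\<lambda>n x. f (x + s n)) f"
  using f
proof (induction rule: integrable_induct)
  case (base A c)
  then show ?case
    using L1_lim_linear[OF bounded_linear_scaleR_left L1_lim_translate_indicator[OF _ _ s], of A c] by simp
next
  case (add f g)
  then show ?case by (intro L1_lim_add)
next
  case (lim f S)
  show ?case
  proof (rule L1_lim_translate_approx)
    fix e :: real assume e: "e > 0"
    have "(\<lambda>i. LINT x|lborel. norm (f x - S i x)) \<longlonglongrightarrow> (LINT x::'a|lborel. (0::real))"
    proof (rule integral_dominated_convergence[where w="\<lambda>x. 3 * norm (f x)"])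
      show "integrable lborel (\<lambda>x. 3 * norm (f x))" using lim by simp
      show "AE x in lborel. (\<lambda>i. norm (f x - S i x)) \<longlonglongrightarrow> 0"
        using lim(2) by (auto intro!: AE_I2 tendsto_norm_zero LIM_zero_iff[THEN iffD2]
            simp: tendsto_minus_cancel_left[symmetric] norm_minus_commute[of "f _"])
      show "AE x in lborel. norm (norm (f x - S i x)) \<le> 3 * norm (f x)" for i
      proof (rule AE_I2)
        fix x :: 'a
        show "norm (norm (f x - S i x)) \<le> 3 * norm (f x)"
          using norm_triangle_ineq4[of "f x" "S i x"] lim(3)[of x i] by simp
      qed
    qed (use lim in \<open>auto dest: borel_measurable_integrable\<close>)
    then obtain i where "(LINT x|lborel. norm (f x - S i x)) < e"
      using order_tendstoD(2)[of _ 0 sequentially e] e by (auto simp: eventually_sequentially)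
    then show "\<exists>g. L1_lim (\<lambda>n x. g (x + s n)) g \<and> (LINT x|lborel. norm (f x - g x)) < e"
      using lim.IH[of i] lim by blast
  qed (use lim in auto)
qed

text \<open>
  With this inequality, continuity of translations in \<open>L\<^sup>2\<close> for \<open>f\<close> follows from the continuity in
  \<open>L\<^sup>1\<close> for \<open>|f| f\<close>.
\<close>

lemma norm_diff_power2_le:
  fixes a b :: "'b::real_inner"
  shows "(norm (a - b))\<^sup>2 \<le> 2 * norm (norm a *\<^sub>R a - norm b *\<^sub>R b)"
proof (cases "a = b")
  case False
  have eq: "2 * ((norm a *\<^sub>R a - norm b *\<^sub>R b) \<bullet> (a - b)) =
     (norm a + norm b) * (norm (a - b))\<^sup>2 + (norm a + norm b) * (norm a - norm b)\<^sup>2"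
  proof -
    have 1: "(norm (a - b))\<^sup>2 = (norm a)\<^sup>2 + (norm b)\<^sup>2 - 2 * (a \<bullet> b)"
      by (simp add: power2_norm_eq_inner inner_diff_left inner_diff_right inner_commute[of b a])
    have 2: "(norm a *\<^sub>R a - norm b *\<^sub>R b) \<bullet> (a - b) =
       norm a * (norm a)\<^sup>2 + norm b * (norm b)\<^sup>2 - (norm a + norm b) * (a \<bullet> b)"
      unfolding power2_norm_eq_inner
      by (simp add: inner_diff_left inner_diff_right inner_commute[of b a] distrib_right)
    show ?thesis unfolding 1 2 by (simp add: power2_eq_square algebra_simps)
  qed
  have n: "norm (a - b) > 0" using False by simp
  have "norm (a - b) * (norm (a - b))\<^sup>2 \<le> (norm a + norm b) * (norm (a - b))\<^sup>2"
    by (intro mult_right_mono norm_triangle_ineq4) auto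
  also have "\<dots> \<le> 2 * ((norm a *\<^sub>R a - norm b *\<^sub>R b) \<bullet> (a - b))"
    unfolding eq by simp
  also have "\<dots> \<le> 2 * (norm (norm a *\<^sub>R a - norm b *\<^sub>R b) * norm (a - b))"
    by (intro mult_left_mono norm_cauchy_schwarz) auto
  finally have "norm (a - b) * (norm (a - b))\<^sup>2 \<le> norm (a - b) * (2 * norm (norm a *\<^sub>R a - norm b *\<^sub>R b))"
    by (simp add: mult_ac)
  then show ?thesis using n by (rule mult_left_le_imp_le)
qed simp

lemma L2_lim_translate:
  fixes f :: "'a::euclidean_space \<Rightarrow> 'b::euclidean_space"
  assumes f: "L2_fun f" and s: "s \<longlonglongrightarrow> 0"
  shows "L2_lim (\<lambda>n x. f (x + s n)) f"
proof -
  define g where "g x = norm (f x) *\<^sub>R f x" for x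
  have fm[measurable]: "f \<in> borel_measurable borel" using f by (rule L2_fun_measurable)
  have gi: "integrable lborel g"
    unfolding g_def using L2_fun_integrable[OF f]
    by (subst integrable_norm_iff[symmetric]) (auto simp: power2_eq_square)
  have "L1_lim (\<lambda>n x. g (x + s n)) g" by (rule L1_lim_translate[OF gi s])
  then have lim: "(\<lambda>n. LINT x|lborel. norm (g (x + s n) - g x)) \<longlonglongrightarrow> 0" by (simp add: L1_lim_def)
  have "(\<lambda>n. (L2n (\<lambda>x. f (x + s n) - f x))\<^sup>2) \<longlonglongrightarrow> 0"
  proof (rule tendsto_sandwich[OF _ _ tendsto_const])
    show "(\<lambda>n. 2 * (LINT x|lborel. norm (g (x + s n) - g x))) \<longlonglongrightarrow> 0"
      using lim by (rule tendsto_mult_right_zero)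
    have "(L2n (\<lambda>x. f (x + s n) - f x))\<^sup>2 \<le> (LINT x|lborel. 2 * norm (g (x + s n) - g x))" for n
      unfolding L2n_power2
    proof (rule integral_mono)
      show "integrable lborel (\<lambda>x. (norm (f (x + s n) - f x))\<^sup>2)"
        by (intro L2_fun_integrable L2_fun_diff L2_fun_translate f)
      show "integrable lborel (\<lambda>x. 2 * norm (g (x + s n) - g x))"
        using gi lborel_integrable_translate[OF gi] by simp
    qed (simp add: g_def norm_diff_power2_le)
    then show "\<forall>\<^sub>F n in sequentially. (L2n (\<lambda>x. f (x + s n) - f x))\<^sup>2 \<le> 2 * (LINT x|lborel. norm (g (x + s n) - g x))"
      by simp
  qed simp
  then have "(\<lambda>n. sqrt ((L2n (\<lambda>x. f (x + s n) - f x))\<^sup>2)) \<longlonglongrightarrow> sqrt 0" by (rule tendsto_real_sqrt)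
  then show ?thesis using f by (simp add: L2_lim_def L2_fun_translate L2n_nonneg)
qed

section \<open>Difference quotients of Sobolev functions\<close>

text \<open>
  Lebesgue measure on the unit interval, as a probability measure on the real line.
\<close>

definition unit_iv :: "real measure" where
  "unit_iv = density lborel (indicator {0..1})"

lemma sets_unit_iv[simp, measurable_cong]: "sets unit_iv = sets borel"
  by (simp add: unit_iv_def)

lemma space_unit_iv[simp]: "space unit_iv = UNIV"
  by (simp add: unit_iv_def)

lemma emeasure_unit_iv: "emeasure unit_iv UNIV = 1"
  by (simp add: unit_iv_def emeasure_density)

lemma finite_measure_unit_iv: "finite_measure unit_iv"
  by (rule finite_measureI) (simp add: emeasure_unit_iv)

lemma integrable_unit_iv_bounded:
  fixes f :: "real \<Rightarrow> 'b::{banach, second_countable_topology}"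
  assumes "f \<in> borel_measurable borel" "\<And>s. norm (f s) \<le> C"
  shows "integrable unit_iv f"
proof -
  interpret finite_measure unit_iv by (rule finite_measure_unit_iv)
  show ?thesis by (rule integrable_const_bound[where B=C]) (use assms in auto)
qed

lemma measure_unit_iv: "measure unit_iv UNIV = 1"
  by (simp add: emeasure_unit_iv measure_def)

lemma integral_unit_iv_FTC:
  fixes F :: "real \<Rightarrow> real"
  assumes "\<And>s. (F has_real_derivative f s) (at s)" "continuous_on UNIV f"
  shows "(LINT s|unit_iv. f s) = F 1 - F 0"
proof -
  have [measurable]: "f \<in> borel_measurable borel"
    using assms(2) by (rule borel_measurable_continuous_onI)
  have "(LINT s|unit_iv. f s) = (LINT s|density lborel (\<lambda>s. ennreal (indicator {0..1} s)). f s)"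
    by (simp add: unit_iv_def ennreal_indicator)
  also have "\<dots> = (LINT s|lborel. indicator {0..1} s *\<^sub>R f s)"
    by (rule integral_density) auto
  also have "\<dots> = F 1 - F 0"
    using assms by (intro integral_FTC_atLeastAtMost)
      (auto intro: has_vector_derivative_at_within continuous_on_subset
        simp: has_real_derivative_iff_has_vector_derivative)
  finally show ?thesis .
qed

text \<open>
  A uniform bound on the \<open>L\<^sup>1\<close> norms of \<open>F s\<close>, required for all real \<open>s\<close>, makes \<open>F\<close> integrable on the
  product.
\<close>

lemma unit_Fubini:
  fixes F :: "real \<Rightarrow> 'a::euclidean_space \<Rightarrow> 'b::euclidean_space"
  assumes meas: "case_prod F \<in> borel_measurable (borel \<Otimes>\<^sub>M borel)"
    and int: "\<And>s. integrable lborel (F s)"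
    and bound: "\<And>s. (LINT x|lborel. norm (F s x)) \<le> K"
  shows "(LINT s|unit_iv. LINT x|lborel. F s x) = (LINT x|lborel. LINT s|unit_iv. F s x)"
    and "integrable lborel (\<lambda>x. LINT s|unit_iv. F s x)"
    and "AE x in lborel. integrable unit_iv (\<lambda>s. F s x)"
proof -
  interpret finite_measure unit_iv by (rule finite_measure_unit_iv)
  interpret pair_sigma_finite unit_iv "lborel :: 'a measure" ..
  have [measurable]: "case_prod F \<in> borel_measurable (unit_iv \<Otimes>\<^sub>M lborel)"
    using meas by (simp cong: measurable_cong_sets sets_pair_measure_cong)
  have "integrable (unit_iv \<Otimes>\<^sub>M lborel) (case_prod F)"
  proof (rule Fubini_integrable)
    have "(\<lambda>s. LINT x|lborel. norm (case_prod F (s, x))) \<in> borel_measurable unit_iv"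
      by measurable
    then show "integrable unit_iv (\<lambda>s. LINT x|lborel. norm (case_prod F (s, x)))"
      by (intro integrable_unit_iv_bounded[where C=K])
         (use bound in \<open>auto simp: measurable_cong_sets[OF sets_unit_iv refl]\<close>)
  qed (use int in auto)
  then show "(LINT s|unit_iv. LINT x|lborel. F s x) = (LINT x|lborel. LINT s|unit_iv. F s x)"
    "integrable lborel (\<lambda>x. LINT s|unit_iv. F s x)"
    "AE x in lborel. integrable unit_iv (\<lambda>s. F s x)"
    by (rule Fubini_integral[symmetric], rule integrable_snd, rule AE_integrable_snd)
qed

lemma L2_fun_L1loc:
  fixes f :: "'a::euclidean_space \<Rightarrow> 'b::euclidean_space"
  assumes f: "L2_fun f" and B: "B \<in> sets borel" "emeasure lborel B < \<infinity>"
  shows "integrable lborel (\<lambda>x. indicator B x *\<^sub>R f x)"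
    and "(LINT x|lborel. norm (indicator B x *\<^sub>R f x)) \<le> measure lborel B + (L2n f)\<^sup>2"
proof -
  have [measurable]: "f \<in> borel_measurable borel" using f by (rule L2_fun_measurable)
  have i: "integrable lborel (indicator B :: 'a \<Rightarrow> real)" using B by (simp add: integrable_indicator_iff)
  have le: "norm (indicator B x *\<^sub>R f x) \<le> indicator B x + (norm (f x))\<^sup>2" for x
  proof -
    have "2 * norm (f x) \<le> 1 + (norm (f x))\<^sup>2" using sum_squares_bound[of 1 "norm (f x)"] by simp
    then have "norm (f x) \<le> 1 + (norm (f x))\<^sup>2" using norm_ge_zero[of "f x"] by linarith
    then show ?thesis by (auto split: split_indicator)
  qed
  show *: "integrable lborel (\<lambda>x. indicator B x *\<^sub>R f x)"
  proof (rule Bochner_Integration.integrable_bound)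
    show "integrable lborel (\<lambda>x. indicator B x + (norm (f x))\<^sup>2)"
      using i L2_fun_integrable[OF f] by simp
    show "AE x in lborel. norm (indicator B x *\<^sub>R f x) \<le> norm (indicator B x + (norm (f x))\<^sup>2)"
      using le by (intro AE_I2) (auto intro: order_trans)
  qed (use B in measurable)
  have "(LINT x|lborel. norm (indicator B x *\<^sub>R f x)) \<le> (LINT x|lborel. indicator B x + (norm (f x))\<^sup>2)"
    by (intro integral_mono integrable_norm Bochner_Integration.integrable_add * i L2_fun_integrable f le)
  also have "\<dots> = measure lborel B + (L2n f)\<^sup>2"
    using i L2_fun_integrable[OF f] by (simp add: L2n_power2)
  finally show "(LINT x|lborel. norm (indicator B x *\<^sub>R f x)) \<le> measure lborel B + (L2n f)\<^sup>2" .
qed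

lemma L2_fun_L1loc_fun: "L2_fun f \<Longrightarrow> L1loc_fun f"
  unfolding L1loc_fun_def set_integrable_def
  by (intro allI impI L2_fun_L1loc(1)) (auto intro!: emeasure_bounded_finite[unfolded infinity_ennreal_def])

lemma bounded_times_L2_fun_bound:
  fixes f :: "'a::euclidean_space \<Rightarrow> 'b::euclidean_space"
  assumes f: "L2_fun f" and B: "B \<in> sets borel" "emeasure lborel B < \<infinity>"
    and q[measurable]: "q \<in> borel_measurable borel" "\<And>x. \<bar>q x\<bar> \<le> C * indicator B x"
  shows "integrable lborel (\<lambda>x. q x *\<^sub>R f x)"
    and "(LINT x|lborel. norm (q x *\<^sub>R f x)) \<le> \<bar>C\<bar> * (measure lborel B + (L2n f)\<^sup>2)"
proof -
  have [measurable]: "f \<in> borel_measurable borel" using f by (rule L2_fun_measurable)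
  note L = L2_fun_L1loc[OF f B]
  have le: "norm (q x *\<^sub>R f x) \<le> \<bar>C\<bar> * norm (indicator B x *\<^sub>R f x)" for x
  proof -
    have "\<bar>q x\<bar> \<le> \<bar>C\<bar> * indicator B x" using q(2)[of x] by (auto split: split_indicator)
    then have "\<bar>q x\<bar> * norm (f x) \<le> (\<bar>C\<bar> * indicator B x) * norm (f x)" by (rule mult_right_mono) simp
    then show ?thesis by (simp add: mult_ac)
  qed
  show *: "integrable lborel (\<lambda>x. q x *\<^sub>R f x)"
  proof (rule Bochner_Integration.integrable_bound)
    show "integrable lborel (\<lambda>x. \<bar>C\<bar> * norm (indicator B x *\<^sub>R f x))"
      by (intro integrable_mult_right integrable_norm L(1))
  qed (use le in auto)
  have "(LINT x|lborel. norm (q x *\<^sub>R f x)) \<le> (LINT x|lborel. \<bar>C\<bar> * norm (indicator B x *\<^sub>R f x))"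
    by (intro integral_mono integrable_norm integrable_mult_right * L(1) le)
  also have "\<dots> \<le> \<bar>C\<bar> * (measure lborel B + (L2n f)\<^sup>2)"
    using mult_left_mono[OF L(2), of "\<bar>C\<bar>"] by simp
  finally show "(LINT x|lborel. norm (q x *\<^sub>R f x)) \<le> \<bar>C\<bar> * (measure lborel B + (L2n f)\<^sup>2)" .
qed

lemma measure_translate_cbox:
  fixes a c v :: "'a::euclidean_space"
  shows "measure lborel (cbox (a + v) (c + v)) = measure lborel (cbox a c)"
  by (simp add: content_cbox_cases inner_simps)

lemma bump_deriv_translate: "dir_deriv b (bump k a c) (x - v) = dir_deriv b (bump k (a + v) (c + v)) x"
proof -
  have "((\<lambda>x. bump k a c (x - v)) has_derivative (\<lambda>w. dir_deriv w (bump k a c) (x - v))) (at x)"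
    by (rule has_derivative_compose[OF _ bump_has_derivative]) (auto intro!: derivative_eq_intros)
  then have "(bump k (a + v) (c + v) has_derivative (\<lambda>w. dir_deriv w (bump k a c) (x - v))) (at x)"
    by (simp add: bump_translate)
  then show ?thesis by (simp add: dir_deriv_def[of b "bump k (a + v) (c + v)"] frechet_derivative_at[symmetric])
qed

lemma bump_minus_line: "bump k a c (x - t *\<^sub>R b) - bump k a c x =
   - t * (LINT s|unit_iv. dir_deriv b (bump k a c) (x - (s * t) *\<^sub>R b))"
proof -
  have "(LINT s|unit_iv. - t * dir_deriv b (bump k a c) (x - (s * t) *\<^sub>R b)) =
     bump k a c (x - (1 * t) *\<^sub>R b) - bump k a c (x - (0 * t) *\<^sub>R b)"
  proof (rule integral_unit_iv_FTC)
    fix s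
    have "((\<lambda>s. bump k a c (x + (- (s * t)) *\<^sub>R b)) has_real_derivative
       dir_deriv b (bump k a c) (x + (- (s * t)) *\<^sub>R b) * (- t)) (at s)"
      by (rule DERIV_chain2[OF bump_line_DERIV]) (auto intro!: derivative_eq_intros)
    then show "((\<lambda>s. bump k a c (x - (s * t) *\<^sub>R b)) has_real_derivative
       - t * dir_deriv b (bump k a c) (x - (s * t) *\<^sub>R b)) (at s)" by (simp add: mult.commute)
  next
    have "continuous_on UNIV (\<lambda>s. dir_deriv b (bump k a c) (x - (s * t) *\<^sub>R b))"
      by (rule continuous_on_compose2[OF bump_deriv_continuous]) (auto intro!: continuous_intros)
    then show "continuous_on UNIV (\<lambda>s. - t * dir_deriv b (bump k a c) (x - (s * t) *\<^sub>R b))"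
      by (intro continuous_intros)
  qed
  then show ?thesis by simp
qed

text \<open>
  The fundamental theorem of calculus along the direction \<open>b\<close>.  It holds for the bumps; by duality, with
  Fubini's theorem and the definition of the weak derivative, both sides have the same integral against
  every bump.
\<close>

lemma weak_partial_line_integral:
  fixes f g :: "'a::euclidean_space \<Rightarrow> 'b::euclidean_space"
  assumes w: "weak_partial b f g" and f: "L2_fun f" and g: "L2_fun g"
  shows "AE x in lborel. f (x + t *\<^sub>R b) - f x = t *\<^sub>R (LINT s|unit_iv. g (x + (s * t) *\<^sub>R b))"
proof -
  have [measurable]: "f \<in> borel_measurable borel" "g \<in> borel_measurable borel"
    using f g by (auto dest: L2_fun_measurable)
  interpret finite_measure unit_iv by (rule finite_measure_unit_iv)
  define A where "A x = (LINT s|unit_iv. g (x + (s * t) *\<^sub>R b))" for x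
  have A_bounded_times: "integrable lborel (\<lambda>x. q x *\<^sub>R A x)"
      "(LINT s|unit_iv. LINT x|lborel. q x *\<^sub>R g (x + (s * t) *\<^sub>R b)) = (LINT x|lborel. q x *\<^sub>R A x)"
    if q[measurable]: "q \<in> borel_measurable borel" and qB: "\<And>x. \<bar>q x\<bar> \<le> C * indicator B x"
      and B: "B \<in> sets borel" "emeasure lborel B < \<infinity>" for q C B
  proof -
    note bd = bounded_times_L2_fun_bound[OF L2_fun_translate[OF g] B q qB, unfolded L2n_translate[OF g]]
    have m: "case_prod (\<lambda>s x. q x *\<^sub>R g (x + (s * t) *\<^sub>R b)) \<in> borel_measurable (borel \<Otimes>\<^sub>M borel)"
      by measurable
    note F = unit_Fubini[of "\<lambda>s x. q x *\<^sub>R g (x + (s * t) *\<^sub>R b)", OF m bd]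
    show "integrable lborel (\<lambda>x. q x *\<^sub>R A x)" using F(2) by (simp add: A_def)
    show "(LINT s|unit_iv. LINT x|lborel. q x *\<^sub>R g (x + (s * t) *\<^sub>R b)) = (LINT x|lborel. q x *\<^sub>R A x)"
      using F(1) by (simp add: A_def)
  qed
  have A: "L1loc_fun A"
    unfolding L1loc_fun_def set_integrable_def
    by (intro allI impI, rule A_bounded_times(1)[where C=1 and B="ball 0 _"])
       (auto intro!: emeasure_bounded_finite[unfolded infinity_ennreal_def] borel_measurable_indicator split: split_indicator)
  have ftr: "L1loc_fun (\<lambda>x. f (x + t *\<^sub>R b))" "L1loc_fun f"
    by (intro L2_fun_L1loc_fun L2_fun_translate f)+
  have "AE x in lborel. f (x + t *\<^sub>R b) - f x - t *\<^sub>R A x = 0"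
  proof (rule AE_zero_if_bump_integrals_zero)
    show "L1loc_fun (\<lambda>x. f (x + t *\<^sub>R b) - f x - t *\<^sub>R A x)"
      using A ftr by (simp add: L1loc_fun_def)
    fix k :: nat and a c :: 'a
    let ?\<phi> = "bump k a c" and ?d = "dir_deriv b (bump k a c)"
    note ib = integrable_bump_times_L1loc[of _ k a c]
    obtain C where C: "C \<ge> 0" "\<And>x. \<bar>?d x\<bar> \<le> C" using bump_deriv_bounded[of b k a c] by blast
    \<comment> \<open>A translate of a bump is again a bump, so the weak derivative may be tested against it.\<close>
    have weak: "(LINT x|lborel. ?d (x - (s * t) *\<^sub>R b) *\<^sub>R f x) = - (LINT x|lborel. ?\<phi> x *\<^sub>R g (x + (s * t) *\<^sub>R b))" for s
    proof -
      have "(LINT x|lborel. ?d (x - (s * t) *\<^sub>R b) *\<^sub>R f x) = - (LINT x|lborel. ?\<phi> (x - (s * t) *\<^sub>R b) *\<^sub>R g x)"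
        using w unfolding weak_partial_def
        by (simp add: bump_deriv_translate bump_translate bump_test_function)
      also have "(LINT x|lborel. ?\<phi> (x - (s * t) *\<^sub>R b) *\<^sub>R g x) = (LINT x|lborel. ?\<phi> x *\<^sub>R g (x + (s * t) *\<^sub>R b))"
        using lborel_integral_translate[of "\<lambda>x. ?\<phi> (x - (s * t) *\<^sub>R b) *\<^sub>R g x" "(s * t) *\<^sub>R b"] by simp
      finally show ?thesis .
    qed
    have left: "(LINT x|lborel. (?\<phi> (x - t *\<^sub>R b) - ?\<phi> x) *\<^sub>R f x) =
        t *\<^sub>R (LINT x|lborel. ?\<phi> x *\<^sub>R A x)"
    proof -
      have B: "cbox (a + v) (c + v) \<in> sets borel" "emeasure lborel (cbox (a + v) (c + v)) < \<infinity>" for v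
        by (auto intro!: emeasure_bounded_finite[unfolded infinity_ennreal_def])
      have q: "(\<lambda>x. ?d (x - v)) \<in> borel_measurable borel"
        "\<And>x. \<bar>?d (x - v)\<bar> \<le> C * indicator (cbox (a + v) (c + v)) x" for v
        using C bump_deriv_eq_0[of "_ - v" a c b k]
        by (auto split: split_indicator simp: mem_box inner_simps algebra_simps)
      note bd = bounded_times_L2_fun_bound[OF f B q, unfolded measure_translate_cbox]
      have m: "case_prod (\<lambda>s x. ?d (x - (s * t) *\<^sub>R b) *\<^sub>R f x) \<in> borel_measurable (borel \<Otimes>\<^sub>M borel)"
        by measurable
      have "(LINT x|lborel. (?\<phi> (x - t *\<^sub>R b) - ?\<phi> x) *\<^sub>R f x) =
         (LINT x|lborel. - t *\<^sub>R (LINT s|unit_iv. ?d (x - (s * t) *\<^sub>R b) *\<^sub>R f x))"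
      proof (intro Bochner_Integration.integral_cong refl)
        fix x
        have "integrable unit_iv (\<lambda>s. ?d (x - (s * t) *\<^sub>R b))"
          by (rule integrable_unit_iv_bounded) (use C in auto)
        then show "(?\<phi> (x - t *\<^sub>R b) - ?\<phi> x) *\<^sub>R f x = - t *\<^sub>R (LINT s|unit_iv. ?d (x - (s * t) *\<^sub>R b) *\<^sub>R f x)"
          by (simp add: bump_minus_line)
      qed
      also have "\<dots> = - t *\<^sub>R (LINT x|lborel. LINT s|unit_iv. ?d (x - (s * t) *\<^sub>R b) *\<^sub>R f x)"
        by simp
      also have "(LINT x|lborel. LINT s|unit_iv. ?d (x - (s * t) *\<^sub>R b) *\<^sub>R f x) =
          (LINT s|unit_iv. LINT x|lborel. ?d (x - (s * t) *\<^sub>R b) *\<^sub>R f x)"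
        by (rule unit_Fubini(1)[OF m bd, symmetric])
      also have "\<dots> = - (LINT s|unit_iv. LINT x|lborel. ?\<phi> x *\<^sub>R g (x + (s * t) *\<^sub>R b))"
        by (simp add: weak)
      also have "(LINT s|unit_iv. LINT x|lborel. ?\<phi> x *\<^sub>R g (x + (s * t) *\<^sub>R b)) = (LINT x|lborel. ?\<phi> x *\<^sub>R A x)"
        by (rule A_bounded_times(2)[where C=1 and B="box a c"])
           (auto simp: bump_nonneg bump_le_1 bump_eq_0 split: split_indicator intro!: emeasure_bounded_finite[unfolded infinity_ennreal_def])
      finally show ?thesis by simp
    qed
    have shift: "(LINT x|lborel. ?\<phi> x *\<^sub>R f (x + t *\<^sub>R b)) = (LINT x|lborel. ?\<phi> (x - t *\<^sub>R b) *\<^sub>R f x)"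
      using lborel_integral_translate[of "\<lambda>x. ?\<phi> (x - t *\<^sub>R b) *\<^sub>R f x" "t *\<^sub>R b"] by simp
    have i2: "integrable lborel (\<lambda>x. ?\<phi> (x - t *\<^sub>R b) *\<^sub>R f x)"
      unfolding bump_translate by (rule integrable_bump_times_L1loc[OF ftr(2)])
    have "(LINT x|lborel. ?\<phi> x *\<^sub>R (f (x + t *\<^sub>R b) - f x - t *\<^sub>R A x)) =
      (LINT x|lborel. ?\<phi> x *\<^sub>R f (x + t *\<^sub>R b)) - (LINT x|lborel. ?\<phi> x *\<^sub>R f x) - (LINT x|lborel. t *\<^sub>R (?\<phi> x *\<^sub>R A x))"
    proof -
      have "(LINT x|lborel. ?\<phi> x *\<^sub>R (f (x + t *\<^sub>R b) - f x - t *\<^sub>R A x)) =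
         (LINT x|lborel. (?\<phi> x *\<^sub>R f (x + t *\<^sub>R b) - ?\<phi> x *\<^sub>R f x) - t *\<^sub>R (?\<phi> x *\<^sub>R A x))"
        by (intro Bochner_Integration.integral_cong refl) (simp add: scaleR_diff_right mult.commute)
      also have "\<dots> = (LINT x|lborel. ?\<phi> x *\<^sub>R f (x + t *\<^sub>R b) - ?\<phi> x *\<^sub>R f x)
          - (LINT x|lborel. t *\<^sub>R (?\<phi> x *\<^sub>R A x))"
        by (intro Bochner_Integration.integral_diff Bochner_Integration.integrable_diff
            integrable_scaleR_right ib ftr A)
      finally show ?thesis using ib[OF ftr(1)] ib[OF ftr(2)] by simp
    qed
    also have "\<dots> = (LINT x|lborel. (?\<phi> (x - t *\<^sub>R b) - ?\<phi> x) *\<^sub>R f x) - t *\<^sub>R (LINT x|lborel. ?\<phi> x *\<^sub>R A x)"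
      unfolding shift using i2 ib[OF ftr(2)] by (simp add: scaleR_diff_left del: scaleR_scaleR)
    finally show "(LINT x|lborel. ?\<phi> x *\<^sub>R (f (x + t *\<^sub>R b) - f x - t *\<^sub>R A x)) = 0"
      by (simp add: left)
  qed
  then show ?thesis by eventually_elim (simp add: A_def)
qed

lemma unit_iv_Jensen:
  fixes w :: "real \<Rightarrow> 'b::euclidean_space"
  assumes w[measurable]: "w \<in> borel_measurable borel"
  shows "ennreal ((norm (LINT s|unit_iv. w s))\<^sup>2) \<le> (\<integral>\<^sup>+s. ennreal ((norm (w s))\<^sup>2) \<partial>unit_iv)"
proof (cases "integrable unit_iv w")
  case True
  have m: "(\<lambda>s. ennreal (norm (w s))) \<in> borel_measurable unit_iv" by measurable
  have "ennreal (norm (LINT s|unit_iv. w s)) \<le> (\<integral>\<^sup>+s. ennreal (norm (w s)) * 1 \<partial>unit_iv)"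
    using integral_norm_bound_ennreal[OF True] by simp
  then have "(ennreal (norm (LINT s|unit_iv. w s)))\<^sup>2 \<le> (\<integral>\<^sup>+s. ennreal (norm (w s)) * 1 \<partial>unit_iv)\<^sup>2"
    by (intro power_mono) auto
  also have "\<dots> \<le> (\<integral>\<^sup>+s. ennreal (norm (w s)) ^ 2 \<partial>unit_iv) * (\<integral>\<^sup>+s. 1 ^ 2 \<partial>unit_iv)"
    by (rule Cauchy_Schwarz_nn_integral[OF m]) simp
  finally show ?thesis using emeasure_unit_iv by (simp add: ennreal_power)
next
  case False
  then show ?thesis by (simp add: not_integrable_integral_eq)
qed

text \<open>
  The difference quotient is the mean of the translates of \<open>g\<close> along the segment.  By Jensen's inequality
  its squared distance from \<open>g\<close> is at most the mean of the squared distances of these translates from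
  \<open>g\<close>, which tends to \<open>0\<close> by continuity of translations.
\<close>

lemma sobolev_difference_quotient:
  fixes f g :: "'a::euclidean_space \<Rightarrow> 'b::euclidean_space"
  assumes w: "weak_partial b f g" and f: "L2_fun f" and g: "L2_fun g"
    and t: "t \<longlonglongrightarrow> 0" "\<And>n. t n \<noteq> 0"
  shows "L2_lim (\<lambda>n x. (f (x + t n *\<^sub>R b) - f x) /\<^sub>R t n) g"
proof -
  have fm[measurable]: "f \<in> borel_measurable borel" and gm[measurable]: "g \<in> borel_measurable borel"
    using f g by (auto dest: L2_fun_measurable)
  interpret finite_measure unit_iv by (rule finite_measure_unit_iv)
  interpret pair_sigma_finite unit_iv "lborel :: 'a measure" ..
  define N where "N v = (L2n (\<lambda>x. g (x + v *\<^sub>R b) - g x))\<^sup>2" for v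
  have Q: "L2_fun (\<lambda>x. (f (x + t n *\<^sub>R b) - f x) /\<^sub>R t n)" for n
    by (intro L2_fun_scaleR L2_fun_diff L2_fun_translate f)
  have Nm: "N \<in> borel_measurable borel"
    unfolding N_def L2n_power2 by measurable
  have Nb: "N v \<le> (2 * L2n g)\<^sup>2" for v
    unfolding N_def
  proof (rule power_mono)
    have "L2n (\<lambda>x. g (x + v *\<^sub>R b) + - g x) \<le> L2n (\<lambda>x. g (x + v *\<^sub>R b)) + L2n (\<lambda>x. - g x)"
      by (intro L2n_triangle L2_fun_translate L2_fun_uminus g)
    then show "L2n (\<lambda>x. g (x + v *\<^sub>R b) - g x) \<le> 2 * L2n g"
      by (simp add: L2n_translate[OF g] L2n_uminus)
  qed (simp add: L2n_nonneg)
  have N0: "0 \<le> N v" for v by (simp add: N_def)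
  have main: "(L2n (\<lambda>x. (f (x + t n *\<^sub>R b) - f x) /\<^sub>R t n - g x))\<^sup>2 \<le> (LINT s|unit_iv. N (s * t n))" for n
  proof -
    \<comment> \<open>Localisation in \<open>x\<close> is needed, because \<open>g\<close> is only locally integrable.\<close>
    have int_s: "AE x in lborel. integrable unit_iv (\<lambda>s. g (x + (s * t n) *\<^sub>R b))"
    proof -
      have "AE x in lborel. \<forall>k::nat. integrable unit_iv (\<lambda>s. indicator (ball 0 (real k)) x *\<^sub>R g (x + (s * t n) *\<^sub>R b))"
      proof (subst AE_all_countable, rule allI)
        fix k :: nat
        have B[measurable]: "ball 0 (real k) \<in> sets (borel :: 'a measure)" and Bf: "emeasure lborel (ball (0::'a) (real k)) < \<infinity>"
          by (auto intro!: emeasure_bounded_finite[unfolded infinity_ennreal_def])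
        note bd = L2_fun_L1loc[OF L2_fun_translate[OF g] B Bf, unfolded L2n_translate[OF g]]
        have m: "case_prod (\<lambda>s x. indicator (ball 0 (real k)) x *\<^sub>R g (x + (s * t n) *\<^sub>R b)) \<in> borel_measurable (borel \<Otimes>\<^sub>M borel)"
          unfolding split_beta by measurable
        show "AE x in lborel. integrable unit_iv (\<lambda>s. indicator (ball 0 (real k)) x *\<^sub>R g (x + (s * t n) *\<^sub>R b))"
          by (rule unit_Fubini(3)[OF m bd])
      qed
      then show ?thesis
      proof eventually_elim
        case (elim x)
        obtain k :: nat where "norm x < real k" using reals_Archimedean2 by blast
        then show ?case using elim[rule_format, of k] by simp
      qed
    qed
    have eq: "AE x in lborel. (f (x + t n *\<^sub>R b) - f x) /\<^sub>R t n - g x = (LINT s|unit_iv. g (x + (s * t n) *\<^sub>R b) - g x)"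
      using weak_partial_line_integral[OF w f g, of "t n"] int_s
      by eventually_elim (simp add: t measure_unit_iv)
    have "ennreal ((L2n (\<lambda>x. (f (x + t n *\<^sub>R b) - f x) /\<^sub>R t n - g x))\<^sup>2) =
       (\<integral>\<^sup>+x. ennreal ((norm ((f (x + t n *\<^sub>R b) - f x) /\<^sub>R t n - g x))\<^sup>2) \<partial>lborel)"
      unfolding L2n_power2 by (intro nn_integral_eq_integral[symmetric] L2_fun_integrable L2_fun_diff Q g) auto
    also have "\<dots> = (\<integral>\<^sup>+x. ennreal ((norm (LINT s|unit_iv. g (x + (s * t n) *\<^sub>R b) - g x))\<^sup>2) \<partial>lborel)"
      using eq by (intro nn_integral_cong_AE) (auto elim: eventually_mono)
    also have "\<dots> \<le> (\<integral>\<^sup>+x. (\<integral>\<^sup>+s. ennreal ((norm (g (x + (s * t n) *\<^sub>R b) - g x))\<^sup>2) \<partial>unit_iv) \<partial>lborel)"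
      by (intro nn_integral_mono unit_iv_Jensen) measurable
    also have "\<dots> = (\<integral>\<^sup>+s. (\<integral>\<^sup>+x. ennreal ((norm (g (x + (s * t n) *\<^sub>R b) - g x))\<^sup>2) \<partial>lborel) \<partial>unit_iv)"
      by (rule Fubini') measurable
    also have "\<dots> = (\<integral>\<^sup>+s. ennreal (N (s * t n)) \<partial>unit_iv)"
      unfolding N_def L2n_power2
      by (intro nn_integral_cong nn_integral_eq_integral L2_fun_integrable L2_fun_diff L2_fun_translate g) auto
    also have "\<dots> = ennreal (LINT s|unit_iv. N (s * t n))"
      by (intro nn_integral_eq_integral integrable_unit_iv_bounded[where C="(2 * L2n g)\<^sup>2"])
         (use Nm Nb N0 in auto)
    finally show ?thesis by (subst (asm) ennreal_le_iff) (auto intro!: integral_nonneg_AE simp: N0)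
  qed
  have "(\<lambda>n. LINT s|unit_iv. N (s * t n)) \<longlonglongrightarrow> (LINT s|unit_iv. 0)"
  proof (rule integral_dominated_convergence[where w="\<lambda>s. (2 * L2n g)\<^sup>2"])
    show "AE s in unit_iv. (\<lambda>n. N (s * t n)) \<longlonglongrightarrow> 0"
    proof (rule AE_I2)
      fix s
      have "(\<lambda>n. (s * t n) *\<^sub>R b) \<longlonglongrightarrow> 0"
        using tendsto_scaleR[OF tendsto_mult[OF tendsto_const t(1), of s] tendsto_const, of b] by simp
      then have "(\<lambda>n. L2n (\<lambda>x. g (x + (s * t n) *\<^sub>R b) - g x)) \<longlonglongrightarrow> 0"
        using L2_lim_translate[OF g] by (simp add: L2_lim_def)
      from tendsto_power[OF this, of 2] show "(\<lambda>n. N (s * t n)) \<longlonglongrightarrow> 0"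
        by (simp add: N_def)
    qed
  qed (use Nm Nb N0 in auto)
  then have lim: "(\<lambda>n. LINT s|unit_iv. N (s * t n)) \<longlonglongrightarrow> 0" by simp
  have "(\<lambda>n. (L2n (\<lambda>x. (f (x + t n *\<^sub>R b) - f x) /\<^sub>R t n - g x))\<^sup>2) \<longlonglongrightarrow> 0"
    by (rule tendsto_sandwich[OF _ _ tendsto_const lim]) (use main in auto)
  then have "(\<lambda>n. sqrt ((L2n (\<lambda>x. (f (x + t n *\<^sub>R b) - f x) /\<^sub>R t n - g x))\<^sup>2)) \<longlonglongrightarrow> sqrt 0"
    by (rule tendsto_real_sqrt)
  then show ?thesis using Q g by (simp add: L2_lim_def L2n_nonneg)
qed

section \<open>The moments of the Wigner function in terms of the wave function\<close>

lemma L2_lim_shift: "L2_lim F f \<Longrightarrow> L2_lim (\<lambda>n x. F n (x + v)) (\<lambda>x. f (x + v))"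
  using L2n_translate[OF L2_fun_diff, of "F _" f v] by (auto simp: L2_lim_def L2_fun_translate)

lemma L1_partial_seq:
  assumes P: "L1_partial b F G" and t: "t \<longlonglongrightarrow> 0" "\<And>n. t n \<noteq> 0"
  shows "L1_lim (\<lambda>n x. (F (y + t n *\<^sub>R b) x - F y x) /\<^sub>R t n) (G y)"
proof -
  have int: "integrable lborel (F z)" "integrable lborel (G z)" for z
    using P by (auto simp: L1_partial_def)
  have "filterlim t (at 0) sequentially"
    using t by (auto simp: filterlim_at)
  moreover have "((\<lambda>s. \<integral>\<^sup>+x. ennreal (norm ((F (y + s *\<^sub>R b) x - F y x) /\<^sub>R s - G y x)) \<partial>lborel) \<longlongrightarrow> 0) (at (0::real))"
    using P by (simp add: L1_partial_def)
  ultimately have "(\<lambda>n. \<integral>\<^sup>+x. ennreal (norm ((F (y + t n *\<^sub>R b) x - F y x) /\<^sub>R t n - G y x)) \<partial>lborel) \<longlonglongrightarrow> 0"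
    by (rule filterlim_compose[rotated])
  moreover have "(\<integral>\<^sup>+x. ennreal (norm ((F (y + t n *\<^sub>R b) x - F y x) /\<^sub>R t n - G y x)) \<partial>lborel)
     = ennreal (LINT x|lborel. norm ((F (y + t n *\<^sub>R b) x - F y x) /\<^sub>R t n - G y x))" for n
    using int by (intro nn_integral_eq_integral) auto
  ultimately have "(\<lambda>n. ennreal (LINT x|lborel. norm ((F (y + t n *\<^sub>R b) x - F y x) /\<^sub>R t n - G y x))) \<longlonglongrightarrow> ennreal 0"
    by simp
  then have "(\<lambda>n. LINT x|lborel. norm ((F (y + t n *\<^sub>R b) x - F y x) /\<^sub>R t n - G y x)) \<longlonglongrightarrow> 0"
    by (subst (asm) tendsto_ennreal_iff) auto
  then show ?thesis using int by (simp add: L1_lim_def)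
qed

text \<open>
  The rotated kernel with two different functions and with \<open>c\<close> in place of \<open>h / 2\<close>.  Its derivative in
  \<open>y\<close> is a combination of kernels of the same form, so one lemma on difference quotients yields the first
  and the second derivative of the rotated kernel.
\<close>

definition corr :: "real \<Rightarrow> ('a::euclidean_space \<Rightarrow> complex) \<Rightarrow> ('a \<Rightarrow> complex) \<Rightarrow> 'a \<Rightarrow> 'a \<Rightarrow> complex" where
  "corr c f g y x = f (x + c *\<^sub>R y) * cnj (g (x - c *\<^sub>R y))"

lemma corr_difference_quotient:
  fixes f f' g g' :: "'a::euclidean_space \<Rightarrow> complex"
  assumes f: "weak_partial b f f'" "L2_fun f" "L2_fun f'"
    and g: "weak_partial b g g'" "L2_fun g" "L2_fun g'"
    and c: "c \<noteq> 0" and t: "t \<longlonglongrightarrow> 0" "\<And>n. t n \<noteq> 0"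
  shows "L1_lim (\<lambda>n x. (corr c f g (y + t n *\<^sub>R b) x - corr c f g y x) /\<^sub>R t n)
     (\<lambda>x. c *\<^sub>R (corr c f' g y x - corr c f g' y x))"
proof -
  have ct: "(\<lambda>n. c * t n) \<longlonglongrightarrow> 0" "\<And>n. c * t n \<noteq> 0" "(\<lambda>n. - (c * t n)) \<longlonglongrightarrow> 0" "\<And>n. - (c * t n) \<noteq> 0"
    using tendsto_mult_right_zero[OF t(1), of c] tendsto_minus[OF tendsto_mult_right_zero[OF t(1), of c]] t c by auto
  have s: "(\<lambda>n. - (c * t n) *\<^sub>R b) \<longlonglongrightarrow> 0"
    using tendsto_scaleR[OF ct(3) tendsto_const, of b] by simp
  have 1: "L2_lim (\<lambda>n x. (f (x + c *\<^sub>R y + (c * t n) *\<^sub>R b) - f (x + c *\<^sub>R y)) /\<^sub>R (c * t n)) (\<lambda>x. f' (x + c *\<^sub>R y))"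
    by (rule L2_lim_shift[OF sobolev_difference_quotient[OF f ct(1,2)]])
  have 2: "L2_lim (\<lambda>n x. cnj (g (x - c *\<^sub>R y + - (c * t n) *\<^sub>R b))) (\<lambda>x. cnj (g (x - c *\<^sub>R y)))"
    using L2_lim_cnj[OF L2_lim_shift[OF L2_lim_translate[OF g(2) s], of "- (c *\<^sub>R y)"]] by simp
  have 3: "L2_lim (\<lambda>n x. f (x + c *\<^sub>R y)) (\<lambda>x. f (x + c *\<^sub>R y))"
    by (intro L2_lim_const L2_fun_translate f)
  have 4: "L2_lim (\<lambda>n x. cnj ((g (x - c *\<^sub>R y + - (c * t n) *\<^sub>R b) - g (x - c *\<^sub>R y)) /\<^sub>R (- (c * t n)))) (\<lambda>x. cnj (g' (x - c *\<^sub>R y)))"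
    using L2_lim_cnj[OF L2_lim_shift[OF sobolev_difference_quotient[OF g ct(3,4)], of "- (c *\<^sub>R y)"]] by simp
  note 5 = L1_lim_linear[OF bounded_linear_scaleR_right[of c] L1_lim_add[OF L2_lim_bilinear[OF bounded_bilinear_mult 1 2]
      L1_lim_linear[OF bounded_linear_scaleR_right[of "-1"] L2_lim_bilinear[OF bounded_bilinear_mult 3 4]]]]
  have eq: "c *\<^sub>R ((f1 - f0) /\<^sub>R (c * t n) * cnj g1 + (-1) *\<^sub>R (f0 * cnj ((g1 - g0) /\<^sub>R (- (c * t n))))) =
     (f1 * cnj g1 - f0 * cnj g0) /\<^sub>R t n" for n f1 f0 g1 g0
    using c t(2)[of n] by (simp add: scaleR_conv_of_real field_simps)
  have arg: "x + c *\<^sub>R (y + t n *\<^sub>R b) = x + c *\<^sub>R y + (c * t n) *\<^sub>R b"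
    "x - c *\<^sub>R (y + t n *\<^sub>R b) = x - c *\<^sub>R y + - (c * t n) *\<^sub>R b" for x n
    by (simp_all add: algebra_simps)
  have "(\<lambda>n x. (corr c f g (y + t n *\<^sub>R b) x - corr c f g y x) /\<^sub>R t n) =
     (\<lambda>n x. c *\<^sub>R ((f (x + c *\<^sub>R y + (c * t n) *\<^sub>R b) - f (x + c *\<^sub>R y)) /\<^sub>R (c * t n) * cnj (g (x - c *\<^sub>R y + - (c * t n) *\<^sub>R b))
      + (-1) *\<^sub>R (f (x + c *\<^sub>R y) * cnj ((g (x - c *\<^sub>R y + - (c * t n) *\<^sub>R b) - g (x - c *\<^sub>R y)) /\<^sub>R (- (c * t n))))))"
    unfolding corr_def arg by (simp only: eq)
  moreover have "(\<lambda>x. c *\<^sub>R (corr c f' g y x - corr c f g' y x)) =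
     (\<lambda>x. c *\<^sub>R (f' (x + c *\<^sub>R y) * cnj (g (x - c *\<^sub>R y)) + (-1) *\<^sub>R (f (x + c *\<^sub>R y) * cnj (g' (x - c *\<^sub>R y)))))"
    by (simp add: corr_def)
  ultimately show ?thesis using 5 by simp
qed

lemma null_sequence: "(\<lambda>n. inverse (real (Suc n))) \<longlonglongrightarrow> 0" "\<And>n. inverse (real (Suc n)) \<noteq> 0"
  using LIMSEQ_inverse_real_of_nat by auto

lemma rot_kernel_corr: "rot_kernel h \<psi> x y = corr (h / 2) \<psi> \<psi> y x"
  by (simp add: rot_kernel_def corr_def)

lemma L1_partial_rot_kernel:
  fixes \<psi> p :: "'a::euclidean_space \<Rightarrow> complex"
  assumes \<psi>: "weak_partial b \<psi> p" "L2_fun \<psi>" "L2_fun p" and h: "h > 0"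
    and D: "L1_partial b (\<lambda>y x. rot_kernel h \<psi> x y) D"
  shows "AE x in lborel. D y x = (h / 2) *\<^sub>R (corr (h / 2) p \<psi> y x - corr (h / 2) \<psi> p y x)"
proof (rule L1_lim_unique[OF L1_partial_seq[OF D null_sequence]])
  show "L1_lim (\<lambda>n x. (corr (h / 2) \<psi> \<psi> (y + inverse (real (Suc n)) *\<^sub>R b) x - corr (h / 2) \<psi> \<psi> y x) /\<^sub>R inverse (real (Suc n)))
     (\<lambda>x. (h / 2) *\<^sub>R (corr (h / 2) p \<psi> y x - corr (h / 2) \<psi> p y x))"
    by (rule corr_difference_quotient[OF \<psi> \<psi> _ null_sequence]) (use h in simp)
qed (simp add: rot_kernel_corr)

lemma L1_partial2_rot_kernel:
  fixes \<psi> p q :: "'a::euclidean_space \<Rightarrow> complex"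
  assumes \<psi>: "weak_partial b \<psi> p" "L2_fun \<psi>" "L2_fun p" and p: "weak_partial b p q" "L2_fun q" and h: "h > 0"
    and D: "L1_partial b (\<lambda>y x. rot_kernel h \<psi> x y) D" and D2: "L1_partial b D D2"
  shows "AE x in lborel. D2 0 x = complex_of_real (h\<^sup>2 / 2 * (Re (q x * cnj (\<psi> x)) - (cmod (p x))\<^sup>2))"
proof -
  let ?c = "h / 2" and ?t = "\<lambda>n. inverse (real (Suc n))"
  have c: "?c \<noteq> 0" using h by simp
  note q = p(1) \<psi>(3) p(2)
  have alg: "(r *\<^sub>R (p1 - q1) - r *\<^sub>R (p0 - q0)) /\<^sub>R s = r *\<^sub>R ((p1 - p0) /\<^sub>R s + (-1) *\<^sub>R ((q1 - q0) /\<^sub>R s))"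
    for r s :: real and p0 p1 q0 q1 :: complex
    by (simp add: algebra_simps)
  have "L1_lim (\<lambda>n x. ?c *\<^sub>R ((corr ?c p \<psi> (0 + ?t n *\<^sub>R b) x - corr ?c p \<psi> 0 x) /\<^sub>R ?t n +
      (-1) *\<^sub>R ((corr ?c \<psi> p (0 + ?t n *\<^sub>R b) x - corr ?c \<psi> p 0 x) /\<^sub>R ?t n)))
     (\<lambda>x. ?c *\<^sub>R (?c *\<^sub>R (corr ?c q \<psi> 0 x - corr ?c p p 0 x) + (-1) *\<^sub>R (?c *\<^sub>R (corr ?c p p 0 x - corr ?c \<psi> q 0 x))))"
    by (intro L1_lim_linear[OF bounded_linear_scaleR_right] L1_lim_add
        corr_difference_quotient[OF q \<psi> c null_sequence] corr_difference_quotient[OF \<psi> q c null_sequence])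
  note lim = this
  have "AE x in lborel. D2 0 x = ?c *\<^sub>R (?c *\<^sub>R (corr ?c q \<psi> 0 x - corr ?c p p 0 x) + (-1) *\<^sub>R (?c *\<^sub>R (corr ?c p p 0 x - corr ?c \<psi> q 0 x)))"
  proof (rule L1_lim_unique[OF L1_partial_seq[OF D2 null_sequence, of 0] lim])
    fix n
    show "AE x in lborel. (D (0 + ?t n *\<^sub>R b) x - D 0 x) /\<^sub>R ?t n =
       ?c *\<^sub>R ((corr ?c p \<psi> (0 + ?t n *\<^sub>R b) x - corr ?c p \<psi> 0 x) /\<^sub>R ?t n +
      (-1) *\<^sub>R ((corr ?c \<psi> p (0 + ?t n *\<^sub>R b) x - corr ?c \<psi> p 0 x) /\<^sub>R ?t n))"
      using L1_partial_rot_kernel[OF \<psi> h D, of "0 + ?t n *\<^sub>R b"] L1_partial_rot_kernel[OF \<psi> h D, of 0]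
      by eventually_elim (simp only: alg)
  qed
  then show ?thesis
  proof eventually_elim
    case (elim x)
    have "q x * cnj (\<psi> x) + \<psi> x * cnj (q x) = complex_of_real (2 * Re (q x * cnj (\<psi> x)))"
      using complex_add_cnj[of "q x * cnj (\<psi> x)"] by (simp add: mult.commute)
    moreover have "p x * cnj (p x) = complex_of_real ((cmod (p x))\<^sup>2)"
      by (simp only: complex_norm_square)
    moreover have "D2 0 x = ?c\<^sup>2 *\<^sub>R ((q x * cnj (\<psi> x) + \<psi> x * cnj (q x)) - 2 * (p x * cnj (p x)))"
      using elim by (simp add: corr_def algebra_simps power2_eq_square scaleR_conv_of_real)
    ultimately have "D2 0 x = ?c\<^sup>2 *\<^sub>R (complex_of_real (2 * Re (q x * cnj (\<psi> x))) - 2 * complex_of_real ((cmod (p x))\<^sup>2))"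
      by (simp only:)
    also have "?c\<^sup>2 *\<^sub>R (complex_of_real (2 * r) - 2 * complex_of_real s) = complex_of_real (h\<^sup>2 / 2 * (r - s))" for r s
      by (simp add: complex_eq_iff power2_eq_square field_simps)
    finally show ?case .
  qed
qed

lemma wigner_current_eq:
  fixes \<psi> :: "'a::euclidean_space \<Rightarrow> complex"
  assumes \<psi>: "\<And>b. b \<in> Basis \<Longrightarrow> weak_partial b \<psi> (p b)" "L2_fun \<psi>" "\<And>b. b \<in> Basis \<Longrightarrow> L2_fun (p b)"
    and h: "h > 0" and J: "wigner_current m h \<psi> J"
  shows "AE x in lborel. \<forall>b\<in>Basis. J x \<bullet> b = h / m * Im (p b x * cnj (\<psi> x))"
proof (rule AE_finite_allI)
  obtain D where D: "\<And>b. b \<in> Basis \<Longrightarrow> L1_partial b (\<lambda>y x. rot_kernel h \<psi> x y) (D b)"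
    "\<And>b. b \<in> Basis \<Longrightarrow> AE x in lborel. complex_of_real (J x \<bullet> b) = - (\<i> / complex_of_real m) * D b 0 x"
    using J unfolding wigner_current_def by blast
  fix b :: 'a assume b: "b \<in> Basis"
  show "AE x in lborel. J x \<bullet> b = h / m * Im (p b x * cnj (\<psi> x))"
    using D(2)[OF b] L1_partial_rot_kernel[OF \<psi>(1)[OF b] \<psi>(2) \<psi>(3)[OF b] h D(1)[OF b], of 0]
  proof eventually_elim
    case (elim x)
    have "p b x * cnj (\<psi> x) - \<psi> x * cnj (p b x) = complex_of_real (2 * Im (p b x * cnj (\<psi> x))) * \<i>"
      using complex_diff_cnj[of "p b x * cnj (\<psi> x)"] by (simp add: mult.commute)
    with elim have "complex_of_real (J x \<bullet> b) =
        - (\<i> / complex_of_real m) * ((h / 2) *\<^sub>R (complex_of_real (2 * Im (p b x * cnj (\<psi> x))) * \<i>))"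
      by (simp only: corr_def scaleR_zero_right add_0_right diff_zero)
    moreover have "- (\<i> / complex_of_real m) * ((h / 2) *\<^sub>R (complex_of_real (2 * k) * \<i>)) = complex_of_real (h / m * k)" for k
      by (simp add: complex_eq_iff)
    ultimately have "complex_of_real (J x \<bullet> b) = complex_of_real (h / m * Im (p b x * cnj (\<psi> x)))"
      by (rule trans)
    then show ?case by (simp only: of_real_eq_iff)
  qed
qed simp

lemma wigner_energy_eq:
  fixes \<psi> :: "'a::euclidean_space \<Rightarrow> complex"
  assumes \<psi>: "\<And>b. b \<in> Basis \<Longrightarrow> weak_partial b \<psi> (p b)" "L2_fun \<psi>" "\<And>b. b \<in> Basis \<Longrightarrow> L2_fun (p b)"
    and p: "\<And>b. b \<in> Basis \<Longrightarrow> weak_partial b (p b) (q b)" "\<And>b. b \<in> Basis \<Longrightarrow> L2_fun (q b)"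
    and h: "h > 0" and E: "wigner_energy m h \<psi> E"
  shows "AE x in lborel. E x = h\<^sup>2 / (4 * m) * (\<Sum>b\<in>Basis. (cmod (p b x))\<^sup>2 - Re (q b x * cnj (\<psi> x)))"
proof -
  obtain D D2 where D: "\<And>b. b \<in> Basis \<Longrightarrow> L1_partial b (\<lambda>y x. rot_kernel h \<psi> x y) (D b)"
    "\<And>b. b \<in> Basis \<Longrightarrow> L1_partial b (D b) (D2 b)"
    "AE x in lborel. complex_of_real (E x) = - (1 / (2 * complex_of_real m)) * (\<Sum>b\<in>Basis. D2 b 0 x)"
    using E unfolding wigner_energy_def by blast
  have "AE x in lborel. \<forall>b\<in>Basis. D2 b 0 x = complex_of_real (h\<^sup>2 / 2 * (Re (q b x * cnj (\<psi> x)) - (cmod (p b x))\<^sup>2))"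
    by (intro AE_finite_allI finite_Basis L1_partial2_rot_kernel[OF \<psi>(1) \<psi>(2) \<psi>(3) p(1) p(2) h D(1) D(2)])
  with D(3) show ?thesis
  proof eventually_elim
    case (elim x)
    have "complex_of_real (E x) = complex_of_real (- (1 / (2 * m)) * (\<Sum>b\<in>Basis. h\<^sup>2 / 2 * (Re (q b x * cnj (\<psi> x)) - (cmod (p b x))\<^sup>2)))"
      using elim by simp
    then have "E x = - (1 / (2 * m)) * (\<Sum>b\<in>Basis. h\<^sup>2 / 2 * (Re (q b x * cnj (\<psi> x)) - (cmod (p b x))\<^sup>2))"
      by (simp only: of_real_eq_iff)
    also have "\<dots> = h\<^sup>2 / (4 * m) * (\<Sum>b\<in>Basis. (cmod (p b x))\<^sup>2 - Re (q b x * cnj (\<psi> x)))"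
      unfolding sum_distrib_left[symmetric]
      by (simp add: sum_subtractf algebra_simps)
    finally show ?case .
  qed
qed

text \<open>
  The density is only known to have a weak gradient; the product rule for it is obtained by testing the
  difference quotients of \<open>|\<psi>|\<^sup>2\<close>, which converge in \<open>L\<^sup>1\<close>, against bumps.
\<close>

lemma wigner_density_gradient:
  fixes \<psi> p :: "'a::euclidean_space \<Rightarrow> complex"
  assumes \<psi>: "weak_partial b \<psi> p" "L2_fun \<psi>" "L2_fun p"
    and G: "weak_partial b (wigner_density h \<psi>) G"
  shows "AE x in lborel. G x = 2 * Re (p x * cnj (\<psi> x))"
proof -
  let ?t = "\<lambda>n. inverse (real (Suc n))"
  let ?\<rho> = "wigner_density h \<psi>"
  note t = null_sequence
  have ts: "(\<lambda>n. ?t n *\<^sub>R b) \<longlonglongrightarrow> 0" using tendsto_scaleR[OF t(1) tendsto_const, of b] by simp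
  have [measurable]: "\<psi> \<in> borel_measurable borel" "p \<in> borel_measurable borel" using \<psi> by (auto dest: L2_fun_measurable)
  have \<rho>: "?\<rho> x = (cmod (\<psi> x))\<^sup>2" for x by (rule wigner_density_eq)
  have \<rho>i: "integrable lborel ?\<rho>" using L2_fun_integrable[OF \<psi>(2)] by (simp add: \<rho>[abs_def])
  have \<rho>m[measurable]: "?\<rho> \<in> borel_measurable borel" using \<rho>i by (auto dest: borel_measurable_integrable)
  have prod: "L1_lim (\<lambda>n x. (\<psi> (x + ?t n *\<^sub>R b) - \<psi> x) /\<^sub>R ?t n * cnj (\<psi> (x + ?t n *\<^sub>R b)) +
       \<psi> x * cnj ((\<psi> (x + ?t n *\<^sub>R b) - \<psi> x) /\<^sub>R ?t n)) (\<lambda>x. p x * cnj (\<psi> x) + \<psi> x * cnj (p x))"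
    by (intro L1_lim_add L2_lim_bilinear[OF bounded_bilinear_mult] L2_lim_cnj L2_lim_const
        sobolev_difference_quotient[OF \<psi> t] L2_lim_translate[OF _ ts] \<psi>)
  have lim: "L1_lim (\<lambda>n x. (?\<rho> (x + ?t n *\<^sub>R b) - ?\<rho> x) /\<^sub>R ?t n) (\<lambda>x. 2 * Re (p x * cnj (\<psi> x)))"
  proof -
    have "Re ((f1 - f0) /\<^sub>R s * cnj f1 + f0 * cnj ((f1 - f0) /\<^sub>R s)) = ((cmod f1)\<^sup>2 - (cmod f0)\<^sup>2) /\<^sub>R s" for f1 f0 s
      by (simp add: cmod_power2) (simp add: algebra_simps power2_eq_square)
    moreover have "Re (a * cnj c + c * cnj a) = 2 * Re (a * cnj c)" for a c
      by (simp add: algebra_simps)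
    ultimately show ?thesis
      using L1_lim_linear[OF bounded_linear_Re prod]
      by (simp only: \<rho>)
  qed
  have Gl: "L1loc_fun G" using G by (simp add: weak_partial_def)
  have Pi: "integrable lborel (\<lambda>x. 2 * Re (p x * cnj (\<psi> x)))" using lim by (simp add: L1_lim_def)
  have Pl: "L1loc_fun (\<lambda>x. 2 * Re (p x * cnj (\<psi> x)))"
    unfolding L1loc_fun_def set_integrable_def
    by (intro allI impI integrable_mult_indicator[OF _ Pi]) simp
  have "AE x in lborel. G x - 2 * Re (p x * cnj (\<psi> x)) = 0"
  proof (rule AE_zero_if_bump_integrals_zero)
    show "L1loc_fun (\<lambda>x. G x - 2 * Re (p x * cnj (\<psi> x)))"
      unfolding L1loc_fun_def
    proof (intro allI impI set_integral_diff(1))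
      fix r :: real assume "r > 0"
      then show "set_integrable lborel (ball 0 r) G" "set_integrable lborel (ball 0 r) (\<lambda>x. 2 * Re (p x * cnj (\<psi> x)))"
        using Gl Pl unfolding L1loc_fun_def by blast+
    qed
    fix k :: nat and a c :: 'a
    let ?\<phi> = "bump k a c" and ?d = "dir_deriv b (bump k a c)"
    have *: "(\<lambda>n. LINT x|lborel. ?\<phi> x *\<^sub>R ((?\<rho> (x + ?t n *\<^sub>R b) - ?\<rho> x) /\<^sub>R ?t n)) \<longlonglongrightarrow>
        (LINT x|lborel. ?\<phi> x *\<^sub>R (2 * Re (p x * cnj (\<psi> x))))"
      by (rule L1_lim_integral_bounded_times[OF lim, of _ 1]) (auto simp: bump_nonneg bump_le_1)
    have eq: "(LINT x|lborel. ?\<phi> x *\<^sub>R ((?\<rho> (x + ?t n *\<^sub>R b) - ?\<rho> x) /\<^sub>R ?t n)) =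
        (LINT x|lborel. (?\<phi> (x - ?t n *\<^sub>R b) - ?\<phi> x) / ?t n * ?\<rho> x)" for n
    proof -
      have i: "integrable lborel (\<lambda>x. ?\<phi> (x + u) * ?\<rho> (x + v))" for u v
        by (rule Bochner_Integration.integrable_bound[OF lborel_integrable_translate[OF \<rho>i, of v]])
           (auto simp: abs_mult bump_nonneg bump_le_1 intro!: mult_left_le_one_le)
      have i': "integrable lborel (\<lambda>x. ?\<phi> x * ?\<rho> (x + v))" "integrable lborel (\<lambda>x. ?\<phi> (x - v) * ?\<rho> x)" for v
        using i[of 0 v] i[of "-v" 0] by simp_all
      have sh: "(LINT x|lborel. ?\<phi> x * ?\<rho> (x + v)) = (LINT x|lborel. ?\<phi> (x - v) * ?\<rho> x)" for v
        using lborel_integral_translate[of "\<lambda>x. ?\<phi> (x - v) * ?\<rho> x" v] by simp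
      have "(LINT x|lborel. ?\<phi> x *\<^sub>R ((?\<rho> (x + ?t n *\<^sub>R b) - ?\<rho> x) /\<^sub>R ?t n)) =
        (LINT x|lborel. (?\<phi> x * ?\<rho> (x + ?t n *\<^sub>R b) - ?\<phi> x * ?\<rho> x) / ?t n)"
        by (intro Bochner_Integration.integral_cong refl) (simp add: field_simps)
      also have "\<dots> = ((LINT x|lborel. ?\<phi> x * ?\<rho> (x + ?t n *\<^sub>R b)) - (LINT x|lborel. ?\<phi> x * ?\<rho> x)) / ?t n"
        using i'(1)[of "?t n *\<^sub>R b"] i'(1)[of 0] by (simp only: integral_divide_zero Bochner_Integration.integral_diff add_0_right)
      also have "\<dots> = (LINT x|lborel. (?\<phi> (x - ?t n *\<^sub>R b) * ?\<rho> x - ?\<phi> x * ?\<rho> x) / ?t n)"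
        unfolding sh using i'(2)[of "?t n *\<^sub>R b"] i'(1)[of 0] by (simp only: integral_divide_zero Bochner_Integration.integral_diff add_0_right)
      also have "\<dots> = (LINT x|lborel. (?\<phi> (x - ?t n *\<^sub>R b) - ?\<phi> x) / ?t n * ?\<rho> x)"
        by (intro Bochner_Integration.integral_cong refl) (simp add: field_simps)
      finally show ?thesis .
    qed
    obtain C where C: "C \<ge> 0" "\<And>x. \<bar>?d x\<bar> \<le> C" using bump_deriv_bounded[of b k a c] by blast
    have "(\<lambda>n. LINT x|lborel. (?\<phi> (x - ?t n *\<^sub>R b) - ?\<phi> x) / ?t n * ?\<rho> x) \<longlonglongrightarrow> (LINT x|lborel. - ?d x * ?\<rho> x)"
    proof (rule integral_dominated_convergence[where w="\<lambda>x. C * ?\<rho> x"])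
      show "integrable lborel (\<lambda>x. C * ?\<rho> x)" using \<rho>i by simp
      show "AE x in lborel. (\<lambda>n. (?\<phi> (x - ?t n *\<^sub>R b) - ?\<phi> x) / ?t n * ?\<rho> x) \<longlonglongrightarrow> - ?d x * ?\<rho> x"
        by (intro AE_I2 tendsto_mult tendsto_const bump_difference_quotient_tendsto t)
      show "AE x in lborel. norm ((?\<phi> (x - ?t n *\<^sub>R b) - ?\<phi> x) / ?t n * ?\<rho> x) \<le> C * ?\<rho> x" for n
      proof (rule AE_I2)
        fix x
        have "\<bar>(?\<phi> (x - ?t n *\<^sub>R b) - ?\<phi> x) / ?t n\<bar> \<le> C"
          by (rule bump_difference_quotient_le[OF C(2) t(2)])
        then have "\<bar>(?\<phi> (x - ?t n *\<^sub>R b) - ?\<phi> x) / ?t n\<bar> * ?\<rho> x \<le> C * ?\<rho> x"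
          by (rule mult_right_mono) (simp add: \<rho>)
        then show "norm ((?\<phi> (x - ?t n *\<^sub>R b) - ?\<phi> x) / ?t n * ?\<rho> x) \<le> C * ?\<rho> x"
          by (simp only: real_norm_def abs_mult) (simp add: \<rho>)
      qed
    qed measurable
    with * have "(LINT x|lborel. ?\<phi> x *\<^sub>R (2 * Re (p x * cnj (\<psi> x)))) = (LINT x|lborel. - ?d x * ?\<rho> x)"
      unfolding eq by (rule LIMSEQ_unique)
    also have "\<dots> = - (LINT x|lborel. ?d x *\<^sub>R ?\<rho> x)" by simp
    also have "\<dots> = (LINT x|lborel. ?\<phi> x *\<^sub>R G x)"
      using G bump_test_function[of k a c] by (simp only: weak_partial_def minus_minus)
    finally show "(LINT x|lborel. ?\<phi> x *\<^sub>R (G x - 2 * Re (p x * cnj (\<psi> x)))) = 0"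
      using integrable_bump_times_L1loc[OF Gl, of k a c] integrable_bump_times_L1loc[OF Pl, of k a c]
      by (simp only: scaleR_diff_right Bochner_Integration.integral_diff)
  qed
  then show ?thesis by eventually_elim simp
qed

section \<open>The energy inequality\<close>

text \<open>
  A bounded Lipschitz substitute for the identity on \<open>s \<ge> 0\<close>.  It increases to the identity as \<open>e\<close> decreases
  to \<open>0\<close>, and \<open>z \<mapsto> trunc e (|z|\<^sup>2) z\<close> is Lipschitz on the complex plane.
\<close>

definition trunc :: "real \<Rightarrow> real \<Rightarrow> real" where
  "trunc e s = s / (1 + e * s)"

lemma trunc_nonneg: "e > 0 \<Longrightarrow> s \<ge> 0 \<Longrightarrow> 0 \<le> trunc e s"
  by (simp add: trunc_def)

lemma trunc_le: "e > 0 \<Longrightarrow> s \<ge> 0 \<Longrightarrow> trunc e s \<le> s"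
  by (simp add: trunc_def divide_le_eq add_pos_nonneg) (simp add: distrib_left)

lemma trunc_le_inverse: "e > 0 \<Longrightarrow> s \<ge> 0 \<Longrightarrow> trunc e s \<le> 1 / e"
  by (simp add: trunc_def divide_simps add_pos_nonneg)

lemma trunc_diff:
  assumes "e > 0" "s \<ge> 0" "s' \<ge> 0"
  shows "trunc e s' - trunc e s = (s' - s) / ((1 + e * s') * (1 + e * s))"
proof -
  have "1 + e * s > 0" "1 + e * s' > 0" using assms by (auto intro: add_pos_nonneg)
  then show ?thesis by (simp add: trunc_def field_simps)
qed

lemma trunc_measurable[measurable]: "trunc e \<in> borel_measurable borel"
  unfolding trunc_def by measurable

lemma L2_lim_dominated:
  fixes X :: "nat \<Rightarrow> 'a::euclidean_space \<Rightarrow> 'b::euclidean_space" and g :: "'a \<Rightarrow> 'c::euclidean_space"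
  assumes meas: "\<And>n. X n \<in> borel_measurable borel" "Y \<in> borel_measurable borel" and g: "L2_fun g"
    and lim: "AE x in lborel. (\<lambda>n. X n x) \<longlonglongrightarrow> Y x"
    and bound: "\<And>n. AE x in lborel. norm (X n x) \<le> C * norm (g x)"
  shows "L2_lim X Y"
proof -
  have X: "L2_fun (X n)" for n by (rule L2_fun_bound[OF g meas(1) bound])
  have Yb: "AE x in lborel. norm (Y x) \<le> C * norm (g x)"
  proof -
    have "AE x in lborel. \<forall>n. norm (X n x) \<le> C * norm (g x)"
      using bound by (simp add: AE_all_countable)
    with lim show ?thesis
    proof eventually_elim
      case (elim x)
      show ?case by (rule LIMSEQ_le_const2[OF tendsto_norm[OF elim(1)]]) (use elim(2) in auto)
    qed
  qed
  then have Y: "L2_fun Y" by (rule L2_fun_bound[OF g meas(2)])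
  have "(\<lambda>n. LINT x|lborel. (norm (X n x - Y x))\<^sup>2) \<longlonglongrightarrow> (LINT x::'a|lborel. 0)"
  proof (rule integral_dominated_convergence[where w="\<lambda>x. (2 * C)\<^sup>2 * (norm (g x))\<^sup>2"])
    show "integrable lborel (\<lambda>x. (2 * C)\<^sup>2 * (norm (g x))\<^sup>2)"
      using L2_fun_integrable[OF g] by simp
    show "AE x in lborel. (\<lambda>n. (norm (X n x - Y x))\<^sup>2) \<longlonglongrightarrow> 0"
      using lim
    proof eventually_elim
      case (elim x)
      show ?case
        using tendsto_power[OF tendsto_norm_zero[OF LIM_zero[OF elim]], of 2] by simp
    qed
    show "AE x in lborel. norm ((norm (X n x - Y x))\<^sup>2) \<le> (2 * C)\<^sup>2 * (norm (g x))\<^sup>2" for n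
      using bound[of n] Yb
    proof eventually_elim
      case (elim x)
      have "norm (X n x - Y x) \<le> 2 * C * norm (g x)"
        using norm_triangle_ineq4[of "X n x" "Y x"] elim by simp
      then have "(norm (X n x - Y x))\<^sup>2 \<le> (2 * C * norm (g x))\<^sup>2"
        by (intro power_mono) auto
      then show ?case by (simp add: power_mult_distrib)
    qed
  qed (use meas in measurable)
  then have "(\<lambda>n. sqrt (LINT x|lborel. (norm (X n x - Y x))\<^sup>2)) \<longlonglongrightarrow> sqrt 0"
    by (intro tendsto_real_sqrt) simp
  then show ?thesis using X Y by (simp add: L2_lim_def L2n_def)
qed

text \<open>
  The bound on the difference quotients of \<open>z \<mapsto> trunc e (|z|\<^sup>2) z\<close> that makes this map Lipschitz; the
  denominator is the one in \<open>trunc_diff\<close>.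
\<close>

lemma slope_bound:
  fixes z z' :: complex
  assumes e: "e > 0"
  shows "norm z * norm (z' + z) / ((1 + e * (norm z')\<^sup>2) * (1 + e * (norm z)\<^sup>2)) \<le> 2 / e"
proof -
  have pos: "(1 + e * (norm z')\<^sup>2) * (1 + e * (norm z)\<^sup>2) > 0"
    using e by (intro mult_pos_pos add_pos_nonneg) auto
  have "norm z * norm (z' + z) \<le> norm z * (norm z' + norm z)"
    by (intro mult_left_mono norm_triangle_ineq) auto
  also have "\<dots> \<le> 2 * ((norm z')\<^sup>2 + (norm z)\<^sup>2)"
    using sum_squares_bound[of "norm z" "norm z'"] mult_nonneg_nonneg[OF norm_ge_zero[of z] norm_ge_zero[of z']]
      zero_le_square[of "norm z'"] zero_le_square[of "norm z"]
    unfolding power2_eq_square distrib_left by linarith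
  finally have 0: "norm z * norm (z' + z) \<le> 2 * ((norm z')\<^sup>2 + (norm z)\<^sup>2)" .
  have 1: "e * (norm z * norm (z' + z)) \<le> 2 * (e * (norm z')\<^sup>2 + e * (norm z)\<^sup>2)"
    using mult_left_mono[OF 0, of e] e by (simp add: algebra_simps)
  have "e * (norm z')\<^sup>2 + e * (norm z)\<^sup>2 \<le> (1 + e * (norm z')\<^sup>2) * (1 + e * (norm z)\<^sup>2)"
    using e by (simp add: algebra_simps)
  with 1 have "e * (norm z * norm (z' + z)) \<le> 2 * ((1 + e * (norm z')\<^sup>2) * (1 + e * (norm z)\<^sup>2))"
    by (auto intro: order_trans)
  then show ?thesis using pos e by (simp add: field_simps)
qed

lemma bounded_times_integrable:
  fixes f :: "'a::euclidean_space \<Rightarrow> real"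
  assumes f: "integrable lborel f" and q[measurable]: "q \<in> borel_measurable borel" and C: "\<And>x. \<bar>q x\<bar> \<le> C"
  shows "integrable lborel (\<lambda>x. q x * f x)"
proof (rule Bochner_Integration.integrable_bound)
  show "integrable lborel (\<lambda>x. C * f x)" using f by simp
  show "AE x in lborel. norm (q x * f x) \<le> norm (C * f x)"
  proof (rule AE_I2)
    fix x
    have "\<bar>q x\<bar> \<le> \<bar>C\<bar>" using C[of x] by linarith
    then show "norm (q x * f x) \<le> norm (C * f x)" by (simp add: abs_mult mult_right_mono)
  qed
qed (use borel_measurable_integrable[OF f] in measurable)

text \<open>
  Here \<open>I\<close> is the inner product of \<open>p\<close> with the derivative of \<open>P = \<phi> \<beta> \<psi>\<close>, where \<open>\<phi>\<close> is the bump and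
  \<open>\<beta> = trunc e (|\<psi>|\<^sup>2)\<close>.  In the proof the difference quotient of \<open>p\<close> is moved to \<open>P\<close> by translation.
  The quotients of \<open>P\<close>, paired with \<open>p\<close>, are written as \<open>X n \<bullet> Q n\<close> plus \<open>Z n\<close> up to signs, where \<open>Q n\<close> is
  the quotient of \<open>\<psi>\<close>, which converges in \<open>L\<^sup>2\<close>.  The factors \<open>X n\<close> are dominated by a multiple of
  \<open>|p|\<close> and converge almost everywhere, hence in \<open>L\<^sup>2\<close>.
\<close>

lemma truncated_integration_by_parts:
  fixes \<psi> p q :: "'a::euclidean_space \<Rightarrow> complex" and k :: nat and a c :: 'a
  assumes \<psi>: "weak_partial b \<psi> p" "L2_fun \<psi>" "L2_fun p" and p: "weak_partial b p q" "L2_fun q"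
    and e: "e > 0"
  defines "\<beta> \<equiv> \<lambda>x. trunc e ((cmod (\<psi> x))\<^sup>2)"
  defines "I \<equiv> \<lambda>x. bump k a c x * \<beta> x * (cmod (p x))\<^sup>2
     + 2 * bump k a c x * (p x \<bullet> \<psi> x)\<^sup>2 / (1 + e * (cmod (\<psi> x))\<^sup>2)\<^sup>2
     + dir_deriv b (bump k a c) x * \<beta> x * (p x \<bullet> \<psi> x)"
  shows "integrable lborel (\<lambda>x. bump k a c x * \<beta> x * (q x \<bullet> \<psi> x))"
    and "integrable lborel (\<lambda>x. bump k a c x * \<beta> x * (cmod (p x))\<^sup>2)"
    and "integrable lborel I"
    and "(LINT x|lborel. bump k a c x * \<beta> x * (q x \<bullet> \<psi> x)) = - (LINT x|lborel. I x)"
proof -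
  let ?\<phi> = "bump k a c" and ?d = "dir_deriv b (bump k a c)"
  have [measurable]: "\<psi> \<in> borel_measurable borel" "p \<in> borel_measurable borel" "q \<in> borel_measurable borel"
    using \<psi> p by (auto dest: L2_fun_measurable)
  have \<beta>m[measurable]: "\<beta> \<in> borel_measurable borel" unfolding \<beta>_def by measurable
  have \<beta>0: "0 \<le> \<beta> x" "\<beta> x \<le> 1 / e" for x
    using e by (auto simp: \<beta>_def trunc_nonneg trunc_le_inverse)
  have \<phi>\<beta>: "\<bar>?\<phi> x * \<beta> x\<bar> \<le> 1 / e" for x
    using \<beta>0[of x] mult_mono[OF bump_le_1[of k a c x] \<beta>0(2)[of x]] bump_nonneg[of k a c x] by simp
  obtain C where C: "C \<ge> 0" "\<And>x. \<bar>?d x\<bar> \<le> C" using bump_deriv_bounded[of b k a c] by blast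
  show int1: "integrable lborel (\<lambda>x. ?\<phi> x * \<beta> x * (q x \<bullet> \<psi> x))"
    by (rule bounded_times_integrable[OF bilinear_L2_integrable[OF bounded_bilinear_inner p(2) \<psi>(2)] _ \<phi>\<beta>]) measurable
  show "integrable lborel (\<lambda>x. ?\<phi> x * \<beta> x * (cmod (p x))\<^sup>2)"
    by (rule bounded_times_integrable[OF L2_fun_integrable[OF \<psi>(3)] _ \<phi>\<beta>]) measurable
  define P where "P x = (?\<phi> x * \<beta> x) *\<^sub>R \<psi> x" for x
  have P: "L2_fun P"
    unfolding P_def
  proof (rule L2_fun_bound[OF \<psi>(2)])
    show "AE x in lborel. norm ((?\<phi> x * \<beta> x) *\<^sub>R \<psi> x) \<le> 1 / e * norm (\<psi> x)"
      using \<phi>\<beta> by (auto intro!: AE_I2 mult_right_mono simp only: norm_scaleR norm_ge_zero)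
  qed measurable
  \<comment> \<open>A sequence of steps along which the translates of \<open>\<psi>\<close> converge almost everywhere.\<close>
  let ?t = "\<lambda>n. inverse (real (Suc n))"
  have "(\<lambda>n. - ?t n *\<^sub>R b) \<longlonglongrightarrow> 0"
    using tendsto_scaleR[OF tendsto_minus[OF null_sequence(1)] tendsto_const, of b] by simp
  from L2_lim_AE_subseq[OF L2_lim_translate[OF \<psi>(2) this]]
  obtain r :: "nat \<Rightarrow> nat" where r: "strict_mono r" "AE x in lborel. (\<lambda>n. \<psi> (x + - ?t (r n) *\<^sub>R b)) \<longlonglongrightarrow> \<psi> x" .
  define t where "t n = ?t (r n)" for n
  have t0: "t \<longlonglongrightarrow> 0" using LIMSEQ_subseq_LIMSEQ[OF null_sequence(1) r(1)] by (simp add: t_def[abs_def] o_def)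
  have tp: "t n > 0" for n by (simp add: t_def)
  have tn: "t n \<noteq> 0" "- t n \<noteq> 0" for n using tp[of n] by auto
  have mt0: "(\<lambda>n. - t n) \<longlonglongrightarrow> 0" using tendsto_minus[OF t0] by simp
  have ae: "AE x in lborel. (\<lambda>n. \<psi> (x - t n *\<^sub>R b)) \<longlonglongrightarrow> \<psi> x" using r(2) by (simp add: t_def)
  have xt: "(\<lambda>n. x - t n *\<^sub>R b) \<longlonglongrightarrow> x" for x :: 'a
    using tendsto_diff[OF tendsto_const tendsto_scaleR[OF t0 tendsto_const], of x b] by simp
  have \<phi>t: "(\<lambda>n. ?\<phi> (x - t n *\<^sub>R b)) \<longlonglongrightarrow> ?\<phi> x" for x
    using continuous_on_tendsto_compose[OF bump_continuous xt] by auto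
  have L1: "(\<lambda>n. LINT x|lborel. P x \<bullet> ((p (x + t n *\<^sub>R b) - p x) /\<^sub>R t n)) \<longlonglongrightarrow> (LINT x|lborel. P x \<bullet> q x)"
  proof -
    have "L1_lim (\<lambda>n x. P x \<bullet> ((p (x + t n *\<^sub>R b) - p x) /\<^sub>R t n)) (\<lambda>x. P x \<bullet> q x)"
      by (intro L2_lim_bilinear[OF bounded_bilinear_inner] L2_lim_const P
          sobolev_difference_quotient[OF p(1) \<psi>(3) p(2) t0 tn(1)])
    from L1_lim_integral_bounded_times(1)[OF this, of "\<lambda>_. 1" 1] show ?thesis by simp
  qed
  define X where "X n x = ?\<phi> (x - t n *\<^sub>R b) *\<^sub>R (\<beta> (x - t n *\<^sub>R b) *\<^sub>R p x +
      ((p x \<bullet> \<psi> x) / ((1 + e * (cmod (\<psi> (x - t n *\<^sub>R b)))\<^sup>2) * (1 + e * (cmod (\<psi> x))\<^sup>2))) *\<^sub>R (\<psi> (x - t n *\<^sub>R b) + \<psi> x))" for n x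
  define Y where "Y x = ?\<phi> x *\<^sub>R (\<beta> x *\<^sub>R p x +
      ((p x \<bullet> \<psi> x) / ((1 + e * (cmod (\<psi> x))\<^sup>2) * (1 + e * (cmod (\<psi> x))\<^sup>2))) *\<^sub>R (\<psi> x + \<psi> x))" for x
  define Q where "Q n x = (\<psi> (x + - t n *\<^sub>R b) - \<psi> x) /\<^sub>R (- t n)" for n x
  define Z where "Z n x = \<beta> x * (p x \<bullet> \<psi> x) * ((?\<phi> (x - t n *\<^sub>R b) - ?\<phi> x) / t n)" for n x
  have Xm: "X n \<in> borel_measurable borel" for n unfolding X_def by measurable
  have Ym: "Y \<in> borel_measurable borel" unfolding Y_def by measurable
  have Zm: "Z n \<in> borel_measurable borel" for n unfolding Z_def by measurable
  have XY: "L2_lim X Y"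
  proof (rule L2_lim_dominated[OF Xm Ym \<psi>(3)])
    show "AE x in lborel. (\<lambda>n. X n x) \<longlonglongrightarrow> Y x"
      using ae
    proof eventually_elim
      case (elim x)
      have nz: "1 + e * (cmod z)\<^sup>2 \<noteq> 0" for z using e by (smt (verit) mult_nonneg_nonneg zero_le_power2)
      show ?case
        unfolding X_def Y_def \<beta>_def trunc_def using nz
        by (intro tendsto_intros \<phi>t elim) auto
    qed
    show "AE x in lborel. norm (X n x) \<le> (3 / e) * norm (p x)" for n
    proof (rule AE_I2)
      fix x
      let ?z = "\<psi> (x - t n *\<^sub>R b)" and ?w = "\<psi> x"
      let ?D = "(1 + e * (cmod ?z)\<^sup>2) * (1 + e * (cmod ?w)\<^sup>2)"
      have D: "?D > 0" using e by (intro mult_pos_pos add_pos_nonneg) auto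
      have "norm (((p x \<bullet> ?w) / ?D) *\<^sub>R (?z + ?w)) = \<bar>p x \<bullet> ?w\<bar> * norm (?z + ?w) / ?D"
        using D by simp
      also have "\<dots> \<le> (norm (p x) * norm ?w) * norm (?z + ?w) / ?D"
        using D Cauchy_Schwarz_ineq2[of "p x" ?w] by (intro divide_right_mono mult_right_mono) auto
      also have "\<dots> = norm (p x) * (norm ?w * norm (?z + ?w) / ?D)" by simp
      also have "\<dots> \<le> norm (p x) * (2 / e)"
        by (intro mult_left_mono slope_bound e) auto
      finally have 1: "norm (((p x \<bullet> ?w) / ?D) *\<^sub>R (?z + ?w)) \<le> norm (p x) * (2 / e)" .
      have 2: "norm (\<beta> (x - t n *\<^sub>R b) *\<^sub>R p x) \<le> norm (p x) * (1 / e)"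
        using \<beta>0[of "x - t n *\<^sub>R b"] mult_right_mono[OF \<beta>0(2)[of "x - t n *\<^sub>R b"], of "norm (p x)"]
        by (simp add: mult.commute)
      let ?V = "\<beta> (x - t n *\<^sub>R b) *\<^sub>R p x + ((p x \<bullet> ?w) / ?D) *\<^sub>R (?z + ?w)"
      have "norm (X n x) = ?\<phi> (x - t n *\<^sub>R b) * norm ?V"
        unfolding X_def by (simp add: bump_nonneg)
      also have "\<dots> \<le> norm ?V"
        by (intro mult_left_le_one_le) (auto simp: bump_nonneg bump_le_1)
      also have "\<dots> \<le> norm (p x) * (1 / e) + norm (p x) * (2 / e)"
        by (rule order_trans[OF norm_triangle_ineq add_mono[OF 2 1]])
      also have "\<dots> = (3 / e) * norm (p x)" using e by (simp add: field_simps)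
      finally show "norm (X n x) \<le> (3 / e) * norm (p x)" .
    qed
  qed
  have Ql: "L2_lim Q p"
    unfolding Q_def by (rule sobolev_difference_quotient[OF \<psi> mt0 tn(2)])
  have XQ: "L1_lim (\<lambda>n x. X n x \<bullet> Q n x) (\<lambda>x. Y x \<bullet> p x)"
    by (rule L2_lim_bilinear[OF bounded_bilinear_inner XY Ql])
  have p\<psi>: "integrable lborel (\<lambda>x. norm (p x) * norm (\<psi> x))"
    by (rule L2_norms_integrable[OF \<psi>(3) \<psi>(2)])
  have dom: "integrable lborel (\<lambda>x. C / e * (norm (p x) * norm (\<psi> x)))" using p\<psi> by simp
  have p\<psi>\<beta>: "\<bar>\<beta> x * (p x \<bullet> \<psi> x)\<bar> \<le> 1 / e * (norm (p x) * norm (\<psi> x))" for x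
  proof -
    have "\<bar>\<beta> x * (p x \<bullet> \<psi> x)\<bar> = \<beta> x * \<bar>p x \<bullet> \<psi> x\<bar>" using \<beta>0(1)[of x] by (simp add: abs_mult)
    also have "\<dots> \<le> 1 / e * (norm (p x) * norm (\<psi> x))"
      using \<beta>0[of x] e by (intro mult_mono Cauchy_Schwarz_ineq2) auto
    finally show ?thesis .
  qed
  have Zb: "\<bar>Z n x\<bar> \<le> C / e * (norm (p x) * norm (\<psi> x))" for n x
  proof -
    have "\<bar>(?\<phi> (x - t n *\<^sub>R b) - ?\<phi> x) / t n\<bar> \<le> C"
      by (rule bump_difference_quotient_le[OF C(2) tn(1)])
    then have "\<bar>Z n x\<bar> \<le> (1 / e * (norm (p x) * norm (\<psi> x))) * C"
      unfolding Z_def abs_mult[of "\<beta> x * (p x \<bullet> \<psi> x)"] using p\<psi>\<beta>[of x] C e by (intro mult_mono) auto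
    then show ?thesis by (simp add: field_simps)
  qed
  have Zi: "integrable lborel (Z n)" for n
    by (rule Bochner_Integration.integrable_bound[OF dom])
       (simp only: measurable_lborel2 Zm, simp only: real_norm_def, rule AE_I2, rule order_trans[OF Zb abs_ge_self])
  have di: "integrable lborel (\<lambda>x. ?d x * \<beta> x * (p x \<bullet> \<psi> x))"
  proof (rule Bochner_Integration.integrable_bound[OF dom])
    show "AE x in lborel. norm (?d x * \<beta> x * (p x \<bullet> \<psi> x)) \<le> norm (C / e * (norm (p x) * norm (\<psi> x)))"
    proof (rule AE_I2)
      fix x
      have "\<bar>?d x\<bar> * \<bar>\<beta> x * (p x \<bullet> \<psi> x)\<bar> \<le> C * (1 / e * (norm (p x) * norm (\<psi> x)))"
        using C p\<psi>\<beta> by (intro mult_mono) auto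
      then show "norm (?d x * \<beta> x * (p x \<bullet> \<psi> x)) \<le> norm (C / e * (norm (p x) * norm (\<psi> x)))"
        by (simp only: real_norm_def mult.assoc abs_mult[of "?d x"] times_divide_eq_left mult_1_left divide_inverse)
    qed
  qed measurable
  have Zl: "(\<lambda>n. LINT x|lborel. Z n x) \<longlonglongrightarrow> (LINT x|lborel. - (?d x * \<beta> x * (p x \<bullet> \<psi> x)))"
  proof (rule integral_dominated_convergence[OF _ _ dom])
    show "AE x in lborel. (\<lambda>n. Z n x) \<longlonglongrightarrow> - (?d x * \<beta> x * (p x \<bullet> \<psi> x))"
    proof (rule AE_I2)
      fix x
      have "(\<lambda>n. (?\<phi> (x - t n *\<^sub>R b) - ?\<phi> x) / t n) \<longlonglongrightarrow> - ?d x"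
        by (rule bump_difference_quotient_tendsto[OF t0 tn(1)])
      from tendsto_mult[OF tendsto_const this, of "\<beta> x * (p x \<bullet> \<psi> x)"]
      show "(\<lambda>n. Z n x) \<longlonglongrightarrow> - (?d x * \<beta> x * (p x \<bullet> \<psi> x))"
        by (simp add: Z_def mult_ac)
    qed
    show "AE x in lborel. norm (Z n x) \<le> C / e * (norm (p x) * norm (\<psi> x))" for n
      using Zb by simp
  qed (use Zm in measurable)
  have eq: "(LINT x|lborel. P x \<bullet> ((p (x + t n *\<^sub>R b) - p x) /\<^sub>R t n)) =
     - (LINT x|lborel. X n x \<bullet> Q n x) + (LINT x|lborel. Z n x)" for n
  proof -
    have Pm[measurable]: "P \<in> borel_measurable borel" using P by (rule L2_fun_measurable)
    have i: "integrable lborel (\<lambda>x. P (x + u) \<bullet> p (x + v))" for u v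
      by (intro bilinear_L2_integrable[OF bounded_bilinear_inner] L2_fun_translate P \<psi>)
    have "(LINT x|lborel. P x \<bullet> ((p (x + t n *\<^sub>R b) - p x) /\<^sub>R t n)) =
      (LINT x|lborel. (P x \<bullet> p (x + t n *\<^sub>R b) - P x \<bullet> p x) / t n)"
      by (intro Bochner_Integration.integral_cong refl) (simp add: inner_diff_right divide_inverse_commute)
    also have "\<dots> = ((LINT x|lborel. P x \<bullet> p (x + t n *\<^sub>R b)) - (LINT x|lborel. P x \<bullet> p x)) / t n"
      using i[of 0 "t n *\<^sub>R b"] i[of 0 0] by (simp only: integral_divide_zero Bochner_Integration.integral_diff add_0_right)
    also have "(LINT x|lborel. P x \<bullet> p (x + t n *\<^sub>R b)) = (LINT x|lborel. P (x - t n *\<^sub>R b) \<bullet> p x)"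
      using lborel_integral_translate[of "\<lambda>x. P (x - t n *\<^sub>R b) \<bullet> p x" "t n *\<^sub>R b"] by simp
    also have "((LINT x|lborel. P (x - t n *\<^sub>R b) \<bullet> p x) - (LINT x|lborel. P x \<bullet> p x)) / t n =
       (LINT x|lborel. (P (x - t n *\<^sub>R b) \<bullet> p x - P x \<bullet> p x) / t n)"
      using i[of "- (t n *\<^sub>R b)" 0] i[of 0 0] by (simp add: Bochner_Integration.integral_diff)
    also have "\<dots> = (LINT x|lborel. - (X n x \<bullet> Q n x) + Z n x)"
    proof (intro Bochner_Integration.integral_cong refl)
      fix x
      let ?f = "?\<phi> (x - t n *\<^sub>R b)" and ?z = "\<psi> (x - t n *\<^sub>R b)" and ?w = "\<psi> x"
      let ?B = "\<beta> (x - t n *\<^sub>R b)"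
      let ?D = "(1 + e * (cmod ?z)\<^sup>2) * (1 + e * (cmod ?w)\<^sup>2)"
      have diff: "?B - \<beta> x = (?z + ?w) \<bullet> (?z - ?w) / ?D"
      proof -
        have "(cmod ?z)\<^sup>2 - (cmod ?w)\<^sup>2 = (?z + ?w) \<bullet> (?z - ?w)"
          by (simp add: power2_norm_eq_inner inner_add_left inner_diff_right inner_commute[of ?w ?z])
        then show ?thesis unfolding \<beta>_def using trunc_diff[OF e, of "(cmod ?w)\<^sup>2" "(cmod ?z)\<^sup>2"] by simp
      qed
      have "P (x - t n *\<^sub>R b) \<bullet> p x - P x \<bullet> p x
        = ?f * ?B * ((?z - ?w) \<bullet> p x) + ?f * (?B - \<beta> x) * (?w \<bullet> p x) + (?f - ?\<phi> x) * \<beta> x * (?w \<bullet> p x)"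
        by (simp add: P_def inner_diff_left algebra_simps)
      also have "\<dots> = ?f * (?B * (p x \<bullet> (?z - ?w)) + (p x \<bullet> ?w) / ?D * ((?z + ?w) \<bullet> (?z - ?w)))
          + \<beta> x * (p x \<bullet> ?w) * (?f - ?\<phi> x)"
        unfolding diff by (simp add: inner_commute algebra_simps)
      also have "\<dots> = X n x \<bullet> (?z - ?w) + \<beta> x * (p x \<bullet> ?w) * (?f - ?\<phi> x)"
        by (simp add: X_def inner_add_left)
      finally have "(P (x - t n *\<^sub>R b) \<bullet> p x - P x \<bullet> p x) / t n =
          (X n x \<bullet> (?z - ?w)) / t n + \<beta> x * (p x \<bullet> ?w) * (?f - ?\<phi> x) / t n"
        by (simp add: add_divide_distrib)
      then show "(P (x - t n *\<^sub>R b) \<bullet> p x - P x \<bullet> p x) / t n = - (X n x \<bullet> Q n x) + Z n x"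
        by (simp add: Q_def Z_def divide_inverse_commute)
    qed
    also have "\<dots> = - (LINT x|lborel. X n x \<bullet> Q n x) + (LINT x|lborel. Z n x)"
      using XQ Zi by (simp add: L1_lim_def)
    finally show ?thesis .
  qed
  have "(\<lambda>n. LINT x|lborel. X n x \<bullet> Q n x) \<longlonglongrightarrow> (LINT x|lborel. Y x \<bullet> p x)"
    using L1_lim_integral_bounded_times(1)[OF XQ, of "\<lambda>_. 1" 1] by simp
  from tendsto_add[OF tendsto_minus[OF this] Zl]
  have "(\<lambda>n. LINT x|lborel. P x \<bullet> ((p (x + t n *\<^sub>R b) - p x) /\<^sub>R t n)) \<longlonglongrightarrow>
     - (LINT x|lborel. Y x \<bullet> p x) + (LINT x|lborel. - (?d x * \<beta> x * (p x \<bullet> \<psi> x)))"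
    unfolding eq .
  from LIMSEQ_unique[OF L1 this]
  have "(LINT x|lborel. P x \<bullet> q x) = - (LINT x|lborel. Y x \<bullet> p x) - (LINT x|lborel. ?d x * \<beta> x * (p x \<bullet> \<psi> x))"
    by simp
  also have "\<dots> = - (LINT x|lborel. Y x \<bullet> p x + ?d x * \<beta> x * (p x \<bullet> \<psi> x))"
    using XQ di by (simp add: L1_lim_def)
  finally have fin: "(LINT x|lborel. P x \<bullet> q x) = - (LINT x|lborel. Y x \<bullet> p x + ?d x * \<beta> x * (p x \<bullet> \<psi> x))" .
  have I: "I = (\<lambda>x. Y x \<bullet> p x + ?d x * \<beta> x * (p x \<bullet> \<psi> x))"
  proof (rule ext)
    fix x
    have 1: "(\<psi> x + \<psi> x) \<bullet> p x = 2 * (p x \<bullet> \<psi> x)"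
      unfolding inner_add_left by (simp add: inner_commute)
    have 2: "Y x \<bullet> p x = ?\<phi> x * (\<beta> x * (p x \<bullet> p x) +
       (p x \<bullet> \<psi> x) / ((1 + e * (cmod (\<psi> x))\<^sup>2) * (1 + e * (cmod (\<psi> x))\<^sup>2)) * ((\<psi> x + \<psi> x) \<bullet> p x))"
      unfolding Y_def by (simp only: inner_add_left inner_scaleR_left)
    have 3: "u * (v * w + y / (D * D) * (2 * y)) = u * v * w + 2 * u * y\<^sup>2 / D\<^sup>2" for u v w y D :: real
      by (simp add: power2_eq_square distrib_left)
    show "I x = Y x \<bullet> p x + ?d x * \<beta> x * (p x \<bullet> \<psi> x)"
      unfolding I_def 2 1 3 power2_norm_eq_inner[of "p x"] ..
  qed
  show "integrable lborel I" unfolding I using XQ di by (simp add: L1_lim_def)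
  show "(LINT x|lborel. ?\<phi> x * \<beta> x * (q x \<bullet> \<psi> x)) = - (LINT x|lborel. I x)"
    using fin unfolding I by (simp add: P_def inner_commute)
qed

lemma sobolev_H_derivatives:
  assumes "sobolev_H 2 f"
  obtains p q where "L2_fun f" "\<And>b. b \<in> Basis \<Longrightarrow> weak_partial b f (p b)" "\<And>b. b \<in> Basis \<Longrightarrow> L2_fun (p b)"
    "\<And>b. b \<in> Basis \<Longrightarrow> weak_partial b (p b) (q b)" "\<And>b. b \<in> Basis \<Longrightarrow> L2_fun (q b)"
proof -
  have f: "L2_fun f" "\<forall>b\<in>Basis. \<exists>g. weak_partial b f g \<and> L2_fun g \<and> (\<forall>b\<in>Basis. \<exists>g'. weak_partial b g g' \<and> L2_fun g')"
    using assms by (simp_all add: numeral_2_eq_2)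
  from bchoice[OF f(2)] obtain p where p: "\<forall>b\<in>Basis. weak_partial b f (p b) \<and> L2_fun (p b) \<and> (\<forall>b'\<in>Basis. \<exists>g'. weak_partial b' (p b) g' \<and> L2_fun g')"
    by blast
  then have "\<forall>b\<in>Basis. \<exists>g'. weak_partial b (p b) g' \<and> L2_fun g'" by blast
  from bchoice[OF this] obtain q where "\<forall>b\<in>Basis. weak_partial b (p b) (q b) \<and> L2_fun (q b)" by blast
  then show ?thesis using that[of p q] f(1) p by blast
qed

text \<open>
  The pointwise form of the energy inequality.  The left-hand side is the contribution of one direction to
  \<open>2 m E\<close> times bump and truncation, after integration by parts; \<open>d\<close> stands for the derivative of the bump, \<open>J\<close> and \<open>G\<close> for
  components of the current and of the density gradient.
\<close>

lemma energy_integrand_bound: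
  fixes p \<psi> :: complex
  assumes e: "e > 0" and \<phi>: "0 \<le> \<phi>" and d: "\<bar>d\<bar> \<le> C" and h: "h > 0" and m: "m > 0"
    and J: "J = h / m * Im (p * cnj \<psi>)" and G: "G = 2 * Re (p * cnj \<psi>)"
  defines "s \<equiv> (cmod \<psi>)\<^sup>2"
  shows "h\<^sup>2 / 2 * (\<phi> * trunc e s * (cmod p)\<^sup>2 +
      (\<phi> * trunc e s * (cmod p)\<^sup>2 + 2 * \<phi> * (p \<bullet> \<psi>)\<^sup>2 / (1 + e * s)\<^sup>2 + d * trunc e s * (p \<bullet> \<psi>)))
     \<le> \<phi> * (m\<^sup>2 * J\<^sup>2) + h\<^sup>2 / 2 * (\<phi> * G\<^sup>2) + h\<^sup>2 / 4 * (C * (s * \<bar>G\<bar>))"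
proof -
  have G2: "p \<bullet> \<psi> = G / 2" by (simp add: G inner_complex_def)
  have s0: "s \<ge> 0" by (simp add: s_def)
  have C0: "C \<ge> 0" using d by simp
  \<comment> \<open>The identity that expresses that the state is pure.\<close>
  have lag: "(Re p * Re \<psi> + Im p * Im \<psi>)\<^sup>2 + (Im p * Re \<psi> - Re p * Im \<psi>)\<^sup>2 =
      ((Re p)\<^sup>2 + (Im p)\<^sup>2) * ((Re \<psi>)\<^sup>2 + (Im \<psi>)\<^sup>2)"
    by (simp add: power2_eq_square algebra_simps)
  have "s * (cmod p)\<^sup>2 = (Re (p * cnj \<psi>))\<^sup>2 + (Im (p * cnj \<psi>))\<^sup>2"
    unfolding s_def cmod_power2 using lag by (simp add: mult.commute)
  then have sp: "h\<^sup>2 * (s * (cmod p)\<^sup>2) = h\<^sup>2 / 4 * G\<^sup>2 + m\<^sup>2 * J\<^sup>2"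
    using m by (simp add: J G power2_eq_square field_simps)
  have 1: "trunc e s * (cmod p)\<^sup>2 \<le> s * (cmod p)\<^sup>2"
    by (intro mult_right_mono trunc_le e s0) simp
  have a: "h\<^sup>2 * (\<phi> * trunc e s * (cmod p)\<^sup>2) \<le> \<phi> * (h\<^sup>2 / 4 * G\<^sup>2 + m\<^sup>2 * J\<^sup>2)"
  proof -
    have "h\<^sup>2 * \<phi> * (trunc e s * (cmod p)\<^sup>2) \<le> h\<^sup>2 * \<phi> * (s * (cmod p)\<^sup>2)"
      using 1 \<phi> by (intro mult_left_mono) auto
    also have "\<dots> = \<phi> * (h\<^sup>2 / 4 * G\<^sup>2 + m\<^sup>2 * J\<^sup>2)" unfolding sp[symmetric] by simp
    finally show ?thesis by (simp add: mult_ac)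
  qed
  have "1 \<le> 1 + e * s" using e s0 by simp
  then have "1 \<le> (1 + e * s)\<^sup>2" by (rule one_le_power)
  then have "(G / 2)\<^sup>2 / (1 + e * s)\<^sup>2 \<le> (G / 2)\<^sup>2 / 1"
    by (intro divide_left_mono) auto
  from mult_left_mono[OF this, of "h\<^sup>2 * \<phi>"] \<phi>
  have b: "h\<^sup>2 * (\<phi> * (p \<bullet> \<psi>)\<^sup>2 / (1 + e * s)\<^sup>2) \<le> \<phi> * (h\<^sup>2 / 4 * G\<^sup>2)"
    unfolding G2 by (simp add: power_divide mult_ac)
  have "d * trunc e s * (p \<bullet> \<psi>) \<le> \<bar>d\<bar> * (trunc e s * \<bar>G / 2\<bar>)"
    unfolding G2 using trunc_nonneg[OF e s0] abs_ge_self[of "d * trunc e s * (G / 2)"] by (simp add: abs_mult)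
  also have "\<dots> \<le> C * (s * \<bar>G / 2\<bar>)"
    by (intro mult_mono d mult_right_mono trunc_le e s0 C0 mult_nonneg_nonneg trunc_nonneg) auto
  finally have c0: "d * trunc e s * (p \<bullet> \<psi>) \<le> C * (s * \<bar>G / 2\<bar>)" .
  have "h\<^sup>2 / 2 * (d * trunc e s * (p \<bullet> \<psi>)) \<le> h\<^sup>2 / 2 * (C * (s * \<bar>G / 2\<bar>))"
    by (rule mult_left_mono[OF c0]) simp
  also have "\<dots> = h\<^sup>2 / 4 * (C * (s * \<bar>G\<bar>))" by simp
  finally have c: "h\<^sup>2 / 2 * (d * trunc e s * (p \<bullet> \<psi>)) \<le> h\<^sup>2 / 4 * (C * (s * \<bar>G\<bar>))" .
  have "h\<^sup>2 / 2 * (\<phi> * trunc e s * (cmod p)\<^sup>2 +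
      (\<phi> * trunc e s * (cmod p)\<^sup>2 + 2 * \<phi> * (p \<bullet> \<psi>)\<^sup>2 / (1 + e * s)\<^sup>2 + d * trunc e s * (p \<bullet> \<psi>))) =
     h\<^sup>2 * (\<phi> * trunc e s * (cmod p)\<^sup>2) + h\<^sup>2 * (\<phi> * (p \<bullet> \<psi>)\<^sup>2 / (1 + e * s)\<^sup>2)
       + h\<^sup>2 / 2 * (d * trunc e s * (p \<bullet> \<psi>))"
    by (simp add: algebra_simps)
  also have "\<dots> \<le> \<phi> * (h\<^sup>2 / 4 * G\<^sup>2 + m\<^sup>2 * J\<^sup>2) + \<phi> * (h\<^sup>2 / 4 * G\<^sup>2) + h\<^sup>2 / 4 * (C * (s * \<bar>G\<bar>))"
    by (intro add_mono a b c)
  also have "\<dots> = \<phi> * (m\<^sup>2 * J\<^sup>2) + h\<^sup>2 / 2 * (\<phi> * G\<^sup>2) + h\<^sup>2 / 4 * (C * (s * \<bar>G\<bar>))"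
    by (simp add: algebra_simps)
  finally show ?thesis .
qed

text \<open>
  The right-hand side is \<open>m\<^sup>2 |J|\<^sup>2\<close> tested against the bump, plus terms that are controlled by \<open>h\<close> times
  the norm of the density gradient on \<open>B\<close>.
\<close>

lemma truncated_energy_inequality:
  fixes \<psi> :: "'a::euclidean_space \<Rightarrow> complex" and G J :: "'a \<Rightarrow> 'a"
  assumes m: "m > 0" and h: "h > 0" and e: "e > 0"
    and \<psi>: "sobolev_H 2 \<psi>"
    and grad: "weak_gradient (wigner_density h \<psi>) G"
    and J: "wigner_current m h \<psi> J" and E: "wigner_energy m h \<psi> E" and Em: "E \<in> borel_measurable borel"
    and B: "B \<in> sets borel" "box a c \<subseteq> B" "cbox a c \<subseteq> B"
    and GB: "L2_fun (\<lambda>x. indicator B x *\<^sub>R G x)" and JB: "L2_fun (\<lambda>x. indicator B x *\<^sub>R J x)"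
    and RB: "L2_fun (\<lambda>x. indicator B x * wigner_density h \<psi> x)"
    and C: "\<And>b x. b \<in> Basis \<Longrightarrow> \<bar>dir_deriv b (bump k a c) x\<bar> \<le> C"
  shows "integrable lborel (\<lambda>x. bump k a c x * trunc e (wigner_density h \<psi> x) * E x)"
    and "2 * m * (LINT x|lborel. bump k a c x * trunc e (wigner_density h \<psi> x) * E x) \<le>
      m\<^sup>2 * (LINT x|lborel. bump k a c x * (norm (J x))\<^sup>2) +
      h\<^sup>2 * ((L2n (\<lambda>x. indicator B x *\<^sub>R G x))\<^sup>2 +
        C * real DIM('a) * (L2n (\<lambda>x. indicator B x * wigner_density h \<psi> x) * L2n (\<lambda>x. indicator B x *\<^sub>R G x)))"
proof -
  let ?\<phi> = "bump k a c" and ?R = "wigner_density h \<psi>"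
  obtain p q where L: "L2_fun \<psi>" "\<And>b. b \<in> Basis \<Longrightarrow> weak_partial b \<psi> (p b)" "\<And>b. b \<in> Basis \<Longrightarrow> L2_fun (p b)"
    "\<And>b. b \<in> Basis \<Longrightarrow> weak_partial b (p b) (q b)" "\<And>b. b \<in> Basis \<Longrightarrow> L2_fun (q b)"
    using sobolev_H_derivatives[OF \<psi>] by blast
  have [measurable]: "\<psi> \<in> borel_measurable borel" using L(1) by (rule L2_fun_measurable)
  have R: "?R x = (cmod (\<psi> x))\<^sup>2" for x by (rule wigner_density_eq)
  have Rm[measurable]: "?R \<in> borel_measurable borel" unfolding R[abs_def] by measurable
  have Jeq: "AE x in lborel. \<forall>b\<in>Basis. J x \<bullet> b = h / m * Im (p b x * cnj (\<psi> x))"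
    by (rule wigner_current_eq[OF L(2) L(1) L(3) h J])
  have Eeq: "AE x in lborel. E x = h\<^sup>2 / (4 * m) * (\<Sum>b\<in>Basis. (cmod (p b x))\<^sup>2 - Re (q b x * cnj (\<psi> x)))"
    by (rule wigner_energy_eq[OF L(2) L(1) L(3) L(4) L(5) h E])
  have Geq: "AE x in lborel. \<forall>b\<in>Basis. G x \<bullet> b = 2 * Re (p b x * cnj (\<psi> x))"
    using grad unfolding weak_gradient_def
    by (intro AE_finite_allI finite_Basis wigner_density_gradient[OF L(2) L(1) L(3)]) auto
  define I where "I b x = ?\<phi> x * trunc e (?R x) * (cmod (p b x))\<^sup>2
     + 2 * ?\<phi> x * (p b x \<bullet> \<psi> x)\<^sup>2 / (1 + e * ?R x)\<^sup>2
     + dir_deriv b ?\<phi> x * trunc e (?R x) * (p b x \<bullet> \<psi> x)" for b x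
  note ibp = truncated_integration_by_parts[OF L(2) L(1) L(3) L(4) L(5) e, where k=k and a=a and c=c, folded R]
  have i1: "integrable lborel (\<lambda>x. ?\<phi> x * trunc e (?R x) * (q b x \<bullet> \<psi> x))" if "b \<in> Basis" for b
    using ibp(1)[OF that that that that] .
  have i2: "integrable lborel (\<lambda>x. ?\<phi> x * trunc e (?R x) * (cmod (p b x))\<^sup>2)" if "b \<in> Basis" for b
    using ibp(2)[OF that that that that] .
  have i3: "integrable lborel (I b)" if "b \<in> Basis" for b
    unfolding I_def[abs_def] using ibp(3)[OF that that that that] .
  have i4: "(LINT x|lborel. ?\<phi> x * trunc e (?R x) * (q b x \<bullet> \<psi> x)) = - (LINT x|lborel. I b x)" if "b \<in> Basis" for b
    unfolding I_def[abs_def] using ibp(4)[OF that that that that] .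
  let ?L = "\<lambda>x. \<Sum>b\<in>Basis. h\<^sup>2 / (4 * m) * (?\<phi> x * trunc e (?R x) * (cmod (p b x))\<^sup>2 - ?\<phi> x * trunc e (?R x) * (q b x \<bullet> \<psi> x))"
  have i5: "integrable lborel (\<lambda>x. h\<^sup>2 / (4 * m) * (?\<phi> x * trunc e (?R x) * (cmod (p b x))\<^sup>2 - ?\<phi> x * trunc e (?R x) * (q b x \<bullet> \<psi> x)))" if "b \<in> Basis" for b
    by (rule integrable_mult_right, rule Bochner_Integration.integrable_diff[OF i2[OF that] i1[OF that]])
  have i6: "integrable lborel (\<lambda>x. h\<^sup>2 / 2 * (?\<phi> x * trunc e (?R x) * (cmod (p b x))\<^sup>2 + I b x))" if "b \<in> Basis" for b
    by (rule integrable_mult_right, rule Bochner_Integration.integrable_add[OF i2[OF that] i3[OF that]])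
  have Lint: "integrable lborel ?L"
    by (rule Bochner_Integration.integrable_sum, rule i5)
  have EL: "AE x in lborel. ?\<phi> x * trunc e (?R x) * E x = ?L x"
    using Eeq
  proof eventually_elim
    case (elim x)
    have "q b x \<bullet> \<psi> x = Re (q b x * cnj (\<psi> x))" for b by (simp add: inner_complex_def)
    then show ?case unfolding elim
      by (simp only: sum_distrib_left right_diff_distrib mult_ac)
  qed
  have Lm: "(\<lambda>x. ?\<phi> x * trunc e (?R x) * E x) \<in> borel_measurable lborel" using Em by measurable
  show "integrable lborel (\<lambda>x. ?\<phi> x * trunc e (?R x) * E x)"
    using Lint integrable_cong_AE[OF Lm borel_measurable_integrable[OF Lint] EL] by simp
  have Ssum: "2 * m * (LINT x|lborel. ?\<phi> x * trunc e (?R x) * E x) =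
     (LINT x|lborel. (\<Sum>b\<in>Basis. h\<^sup>2 / 2 * (?\<phi> x * trunc e (?R x) * (cmod (p b x))\<^sup>2 + I b x)))"
  proof -
    define S where "S b = (LINT x|lborel. ?\<phi> x * trunc e (?R x) * (cmod (p b x))\<^sup>2)" for b
    define T where "T b = (LINT x|lborel. I b x)" for b
    have "(LINT x|lborel. ?\<phi> x * trunc e (?R x) * E x) = (LINT x|lborel. ?L x)"
      by (rule integral_cong_AE[OF Lm borel_measurable_integrable[OF Lint] EL])
    also have "\<dots> = (\<Sum>b\<in>Basis. (LINT x|lborel. h\<^sup>2 / (4 * m) * (?\<phi> x * trunc e (?R x) * (cmod (p b x))\<^sup>2 - ?\<phi> x * trunc e (?R x) * (q b x \<bullet> \<psi> x))))"
      by (rule Bochner_Integration.integral_sum, rule i5)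
    also have "\<dots> = (\<Sum>b\<in>Basis. h\<^sup>2 / (4 * m) * ((LINT x|lborel. ?\<phi> x * trunc e (?R x) * (cmod (p b x))\<^sup>2) + (LINT x|lborel. I b x)))"
    proof (rule sum.cong[OF refl])
      fix b :: 'a assume b: "b \<in> Basis"
      show "(LINT x|lborel. h\<^sup>2 / (4 * m) * (?\<phi> x * trunc e (?R x) * (cmod (p b x))\<^sup>2 - ?\<phi> x * trunc e (?R x) * (q b x \<bullet> \<psi> x))) =
        h\<^sup>2 / (4 * m) * ((LINT x|lborel. ?\<phi> x * trunc e (?R x) * (cmod (p b x))\<^sup>2) + (LINT x|lborel. I b x))"
        unfolding integral_mult_right_zero Bochner_Integration.integral_diff[OF i2[OF b] i1[OF b]] i4[OF b] diff_minus_eq_add ..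
    qed
    finally have 1: "(LINT x|lborel. ?\<phi> x * trunc e (?R x) * E x) = (\<Sum>b\<in>Basis. h\<^sup>2 / (4 * m) * (S b + T b))"
      unfolding S_def T_def .
    have 2: "2 * m * (h\<^sup>2 / (4 * m) * z) = h\<^sup>2 / 2 * z" for z using m by simp
    have "2 * m * (LINT x|lborel. ?\<phi> x * trunc e (?R x) * E x) = (\<Sum>b\<in>Basis. h\<^sup>2 / 2 * (S b + T b))"
      unfolding 1 sum_distrib_left[of "2 * m"] 2 ..
    also have "\<dots> = (\<Sum>b\<in>Basis. (LINT x|lborel. h\<^sup>2 / 2 * (?\<phi> x * trunc e (?R x) * (cmod (p b x))\<^sup>2 + I b x)))"
    proof (rule sum.cong[OF refl])
      fix b :: 'a assume b: "b \<in> Basis"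
      show "h\<^sup>2 / 2 * (S b + T b) =
        (LINT x|lborel. h\<^sup>2 / 2 * (?\<phi> x * trunc e (?R x) * (cmod (p b x))\<^sup>2 + I b x))"
        unfolding integral_mult_right_zero Bochner_Integration.integral_add[OF i2[OF b] i3[OF b]] S_def T_def ..
    qed
    also have "\<dots> = (LINT x|lborel. (\<Sum>b\<in>Basis. h\<^sup>2 / 2 * (?\<phi> x * trunc e (?R x) * (cmod (p b x))\<^sup>2 + I b x)))"
      by (rule Bochner_Integration.integral_sum[symmetric], rule i6)
    finally show ?thesis .
  qed
  let ?G = "\<lambda>x. indicator B x *\<^sub>R G x" and ?J = "\<lambda>x. indicator B x *\<^sub>R J x" and ?RB = "\<lambda>x. indicator B x * ?R x"
  let ?U = "\<lambda>x. m\<^sup>2 * (?\<phi> x * (norm (?J x))\<^sup>2) + h\<^sup>2 * ((norm (?G x))\<^sup>2 + C * real DIM('a) * (norm (?RB x) * norm (?G x)))"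
  have C0: "C \<ge> 0" using C[OF SOME_Basis, of 0] by linarith
  have j1: "integrable lborel (\<lambda>x. ?\<phi> x * (norm (?J x))\<^sup>2)"
    by (rule bounded_times_integrable[OF L2_fun_integrable[OF JB], of _ 1]) (auto simp: bump_nonneg bump_le_1)
  note j2 = L2_fun_integrable[OF GB] and j3 = L2_norms_integrable[OF RB GB]
  have j23: "integrable lborel (\<lambda>x. (norm (?G x))\<^sup>2 + C * real DIM('a) * (norm (?RB x) * norm (?G x)))"
    by (intro Bochner_Integration.integrable_add integrable_mult_right j2 j3)
  have Uint: "integrable lborel ?U"
    by (intro Bochner_Integration.integrable_add integrable_mult_right j1 j23)
  have "2 * m * (LINT x|lborel. ?\<phi> x * trunc e (?R x) * E x) \<le> (LINT x|lborel. ?U x)"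
    unfolding Ssum
  proof (rule integral_mono_AE)
    show "integrable lborel (\<lambda>x. \<Sum>b\<in>Basis. h\<^sup>2 / 2 * (?\<phi> x * trunc e (?R x) * (cmod (p b x))\<^sup>2 + I b x))"
      by (rule Bochner_Integration.integrable_sum, rule i6)
    show "AE x in lborel. (\<Sum>b\<in>Basis. h\<^sup>2 / 2 * (?\<phi> x * trunc e (?R x) * (cmod (p b x))\<^sup>2 + I b x)) \<le> ?U x"
      using Jeq Geq
    proof eventually_elim
      case (elim x)
      show ?case
      proof (cases "x \<in> B")
        case False
        then have "?\<phi> x = 0" "dir_deriv b ?\<phi> x = 0" for b
          using B bump_eq_0[of x a c k] bump_deriv_eq_0[of x a c b k] by auto
        then show ?thesis using False by (simp add: I_def)
      next
        case True
        have "(\<Sum>b\<in>Basis. h\<^sup>2 / 2 * (?\<phi> x * trunc e (?R x) * (cmod (p b x))\<^sup>2 + I b x)) \<le>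
          (\<Sum>b\<in>Basis. ?\<phi> x * (m\<^sup>2 * (J x \<bullet> b)\<^sup>2) + h\<^sup>2 / 2 * (?\<phi> x * (G x \<bullet> b)\<^sup>2) + h\<^sup>2 / 4 * (C * (?R x * \<bar>G x \<bullet> b\<bar>)))"
        proof (rule sum_mono)
          fix b :: 'a assume b: "b \<in> Basis"
          show "h\<^sup>2 / 2 * (?\<phi> x * trunc e (?R x) * (cmod (p b x))\<^sup>2 + I b x) \<le>
             ?\<phi> x * (m\<^sup>2 * (J x \<bullet> b)\<^sup>2) + h\<^sup>2 / 2 * (?\<phi> x * (G x \<bullet> b)\<^sup>2) + h\<^sup>2 / 4 * (C * (?R x * \<bar>G x \<bullet> b\<bar>))"
            unfolding I_def R
            by (rule energy_integrand_bound[OF e bump_nonneg C[OF b] h m]) (use elim b in auto)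
        qed
        also have "\<dots> \<le> (\<Sum>b\<in>Basis. ?\<phi> x * (m\<^sup>2 * (J x \<bullet> b)\<^sup>2) + h\<^sup>2 * (G x \<bullet> b)\<^sup>2 + h\<^sup>2 * (C * (?R x * norm (G x))))"
        proof (intro sum_mono add_mono order_refl)
          fix b :: 'a assume b: "b \<in> Basis"
          have "h\<^sup>2 / 2 * (?\<phi> x * (G x \<bullet> b)\<^sup>2) \<le> h\<^sup>2 * (1 * (G x \<bullet> b)\<^sup>2)"
            by (intro mult_mono) (auto simp: bump_le_1 bump_nonneg)
          then show "h\<^sup>2 / 2 * (?\<phi> x * (G x \<bullet> b)\<^sup>2) \<le> h\<^sup>2 * (G x \<bullet> b)\<^sup>2" by simp
          show "h\<^sup>2 / 4 * (C * (?R x * \<bar>G x \<bullet> b\<bar>)) \<le> h\<^sup>2 * (C * (?R x * norm (G x)))"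
            using C0 Basis_le_norm[OF b, of "G x"] by (intro mult_mono) (auto simp: R)
        qed
        also have "\<dots> = ?\<phi> x * (m\<^sup>2 * (\<Sum>b\<in>Basis. (J x \<bullet> b)\<^sup>2)) + h\<^sup>2 * (\<Sum>b\<in>Basis. (G x \<bullet> b)\<^sup>2) + real DIM('a) * (h\<^sup>2 * (C * (?R x * norm (G x))))"
          by (simp add: sum.distrib sum_distrib_left)
        also have "\<dots> = ?U x"
        proof -
          have "(\<Sum>b\<in>Basis. (y \<bullet> b)\<^sup>2) = (norm y)\<^sup>2" for y :: 'a
            unfolding power2_norm_eq_inner by (subst euclidean_inner) (simp add: power2_eq_square)
          then show ?thesis using True by (simp add: R algebra_simps)
        qed
        finally show ?thesis .
      qed
    qed
  qed (rule Uint)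
  also have "(LINT x|lborel. ?U x) = m\<^sup>2 * (LINT x|lborel. ?\<phi> x * (norm (?J x))\<^sup>2) +
     h\<^sup>2 * ((L2n ?G)\<^sup>2 + C * real DIM('a) * (LINT x|lborel. norm (?RB x) * norm (?G x)))"
  proof -
    have "(LINT x|lborel. ?U x) = (LINT x|lborel. m\<^sup>2 * (?\<phi> x * (norm (?J x))\<^sup>2)) + (LINT x|lborel. h\<^sup>2 * ((norm (?G x))\<^sup>2 + C * real DIM('a) * (norm (?RB x) * norm (?G x))))"
      by (intro Bochner_Integration.integral_add integrable_mult_right j1 j23)
    also have "(LINT x|lborel. h\<^sup>2 * ((norm (?G x))\<^sup>2 + C * real DIM('a) * (norm (?RB x) * norm (?G x)))) =
       h\<^sup>2 * ((LINT x|lborel. (norm (?G x))\<^sup>2) + (LINT x|lborel. C * real DIM('a) * (norm (?RB x) * norm (?G x))))"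
      unfolding integral_mult_right_zero[of _ "h\<^sup>2"]
      by (intro arg_cong2[where f="(*)"] refl Bochner_Integration.integral_add integrable_mult_right j2 j3)
    finally show ?thesis unfolding L2n_power2 integral_mult_right_zero .
  qed
  also have "\<dots> \<le> m\<^sup>2 * (LINT x|lborel. ?\<phi> x * (norm (?J x))\<^sup>2) +
     h\<^sup>2 * ((L2n ?G)\<^sup>2 + C * real DIM('a) * (L2n ?RB * L2n ?G))"
    by (intro add_left_mono mult_left_mono L2_Cauchy_Schwarz RB GB mult_nonneg_nonneg C0) auto
  also have "(\<lambda>x. ?\<phi> x * (norm (?J x))\<^sup>2) = (\<lambda>x. ?\<phi> x * (norm (J x))\<^sup>2)"
  proof
    fix x show "?\<phi> x * (norm (?J x))\<^sup>2 = ?\<phi> x * (norm (J x))\<^sup>2"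
      using B bump_eq_0[of x a c k] by (cases "x \<in> B") auto
  qed
  finally show "2 * m * (LINT x|lborel. ?\<phi> x * trunc e (?R x) * E x) \<le>
      m\<^sup>2 * (LINT x|lborel. ?\<phi> x * (norm (J x))\<^sup>2) +
      h\<^sup>2 * ((L2n ?G)\<^sup>2 + C * real DIM('a) * (L2n ?RB * L2n ?G))" .
qed

section \<open>Products of weakly and strongly convergent sequences\<close>

text \<open>
  Completeness of \<open>L\<^sup>2\<close>, for sequences whose steps are bounded by a geometric series.
\<close>

lemma L2_complete_geometric:
  fixes X :: "nat \<Rightarrow> 'a::euclidean_space \<Rightarrow> real"
  assumes X: "\<And>k. L2_fun (X k)" and step: "\<And>k. L2n (\<lambda>x. X (Suc k) x - X k x) \<le> (1 / 3) ^ k"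
  obtains Y where "L2_fun Y" "\<And>k. L2n (\<lambda>x. Y x - X k x) \<le> 3 / 2 * (1 / 3) ^ k"
proof -
  define d where "d k x = X (Suc k) x - X k x" for k x
  have dL: "L2_fun (d k)" for k unfolding d_def by (intro L2_fun_diff X)
  have Xm[measurable]: "X k \<in> borel_measurable borel" for k using X by (rule L2_fun_measurable)
  have dm[measurable]: "d k \<in> borel_measurable borel" for k using dL by (rule L2_fun_measurable)
  \<comment> \<open>The weights \<open>2 ^ k\<close> make the steps summable at every point where the weighted sum of squares is finite.\<close>
  have dn: "(\<integral>\<^sup>+x. ennreal (2 ^ k * (d k x)\<^sup>2) \<partial>lborel) \<le> ennreal ((2 / 9) ^ k)" for k
  proof -
    have i: "integrable lborel (\<lambda>x. (norm (d k x))\<^sup>2)" by (rule L2_fun_integrable[OF dL])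
    have "(\<integral>\<^sup>+x. ennreal (2 ^ k * (d k x)\<^sup>2) \<partial>lborel) = ennreal (LINT x|lborel. 2 ^ k * (d k x)\<^sup>2)"
      using i by (intro nn_integral_eq_integral) auto
    also have "(LINT x|lborel. 2 ^ k * (d k x)\<^sup>2) = 2 ^ k * (L2n (d k))\<^sup>2"
      by (simp add: L2n_power2)
    also have "\<dots> \<le> 2 ^ k * ((1 / 3) ^ k)\<^sup>2"
      using step[of k] by (intro mult_left_mono power_mono L2n_nonneg) (simp_all add: d_def[abs_def])
    also have "\<dots> = (2 / 9) ^ k"
    proof -
      have "2 ^ k * ((1 / 3 :: real) ^ k)\<^sup>2 = (2 * ((1 / 3)\<^sup>2)) ^ k"
        by (simp only: power_mult_distrib power_mult[symmetric] mult.commute[of k 2])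
      then show ?thesis by (simp add: power2_eq_square)
    qed
    finally show ?thesis by (simp add: ennreal_leI)
  qed
  have "(\<integral>\<^sup>+x. (\<Sum>k. ennreal (2 ^ k * (d k x)\<^sup>2)) \<partial>lborel) = (\<Sum>k. \<integral>\<^sup>+x. ennreal (2 ^ k * (d k x)\<^sup>2) \<partial>lborel)"
    by (rule nn_integral_suminf) measurable
  also have "\<dots> \<le> (\<Sum>k. ennreal ((2 / 9) ^ k))"
    by (rule suminf_le[OF dn]) auto
  also have "\<dots> = ennreal (\<Sum>k. (2 / 9) ^ k)"
    by (rule suminf_ennreal2) auto
  also have "\<dots> < \<infinity>" by simp
  finally have "AE x in lborel. (\<Sum>k. ennreal (2 ^ k * (d k x)\<^sup>2)) \<noteq> \<infinity>"
    by (intro nn_integral_PInf_AE) auto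
  then have summ: "AE x in lborel. summable (\<lambda>k. d k x)"
  proof eventually_elim
    case (elim x)
    define S where "S = enn2real (\<Sum>k. ennreal (2 ^ k * (d k x)\<^sup>2))"
    have S: "(\<Sum>k. ennreal (2 ^ k * (d k x)\<^sup>2)) = ennreal S" "S \<ge> 0"
      using elim unfolding S_def by (subst ennreal_enn2real) (simp_all add: less_top)
    have b: "\<bar>d k x\<bar> \<le> sqrt S * (sqrt (1 / 2)) ^ k" for k
    proof -
      have "(\<Sum>k\<in>{k}. ennreal (2 ^ k * (d k x)\<^sup>2)) \<le> (\<Sum>k. ennreal (2 ^ k * (d k x)\<^sup>2))"
        by (rule sum_le_suminf) auto
      then have "ennreal (2 ^ k * (d k x)\<^sup>2) \<le> ennreal S"
        unfolding S(1) by (simp only: sum.empty add_0_right sum.insert finite.emptyI empty_iff not_False_eq_True)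
      then have "2 ^ k * (d k x)\<^sup>2 \<le> S" using S(2) by (simp add: ennreal_le_iff)
      then have "(d k x)\<^sup>2 \<le> S * (1 / 2) ^ k" by (simp add: power_divide field_simps)
      then have "sqrt ((d k x)\<^sup>2) \<le> sqrt (S * (1 / 2) ^ k)" by (rule real_sqrt_le_mono)
      then show ?thesis unfolding real_sqrt_abs by (simp only: real_sqrt_mult real_sqrt_power)
    qed
    have "sqrt (1 / 2) < sqrt 1" by (rule real_sqrt_less_mono) simp
    then have "summable (\<lambda>k. sqrt S * (sqrt (1 / 2)) ^ k)"
      by (intro summable_mult summable_geometric) simp
    then show ?case by (rule summable_comparison_test'[of _ 0]) (use b in simp)
  qed
  define Y where "Y x = X 0 x + (\<Sum>k. d k x)" for x
  have Ym[measurable]: "Y \<in> borel_measurable borel" unfolding Y_def by measurable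
  have lim: "AE x in lborel. (\<lambda>j. X j x) \<longlonglongrightarrow> Y x"
    using summ
  proof eventually_elim
    case (elim x)
    have "(\<Sum>k<j. d k x) = X j x - X 0 x" for j
      unfolding d_def by (rule sum_lessThan_telescope)
    then have "(\<lambda>j. X 0 x + (X j x - X 0 x)) \<longlonglongrightarrow> X 0 x + (\<Sum>k. d k x)"
      using summable_LIMSEQ[OF elim] by (intro tendsto_add tendsto_const) simp
    then show ?case by (simp add: Y_def)
  qed
  have tail: "L2n (\<lambda>x. X (k + i) x - X k x) \<le> 3 / 2 * (1 / 3) ^ k - 3 / 2 * (1 / 3) ^ (k + i)" for k i
  proof (induction i)
    case 0
    show ?case by (simp add: L2n_def)
  next
    case (Suc i)
    have "L2n (\<lambda>x. (X (Suc (k + i)) x - X (k + i) x) + (X (k + i) x - X k x)) \<le>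
      L2n (\<lambda>x. X (Suc (k + i)) x - X (k + i) x) + L2n (\<lambda>x. X (k + i) x - X k x)"
      by (intro L2n_triangle L2_fun_diff X)
    then have "L2n (\<lambda>x. X (k + Suc i) x - X k x) \<le> (1 / 3) ^ (k + i) + L2n (\<lambda>x. X (k + i) x - X k x)"
      using step[of "k + i"] by simp
    then show ?case using Suc by simp
  qed
  have fat: "(\<integral>\<^sup>+x. ennreal ((norm (Y x - X k x))\<^sup>2) \<partial>lborel) \<le> ennreal ((3 / 2 * (1 / 3) ^ k)\<^sup>2)" for k
  proof -
    have "(\<integral>\<^sup>+x. ennreal ((norm (Y x - X k x))\<^sup>2) \<partial>lborel) = (\<integral>\<^sup>+x. liminf (\<lambda>i. ennreal ((norm (X (k + i) x - X k x))\<^sup>2)) \<partial>lborel)"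
    proof (rule nn_integral_cong_AE)
      show "AE x in lborel. ennreal ((norm (Y x - X k x))\<^sup>2) = liminf (\<lambda>i. ennreal ((norm (X (k + i) x - X k x))\<^sup>2))"
        using lim
      proof eventually_elim
        case (elim x)
        have "(\<lambda>i. X (i + k) x) \<longlonglongrightarrow> Y x" using elim by (rule LIMSEQ_ignore_initial_segment)
        then have "(\<lambda>i. ennreal ((norm (X (k + i) x - X k x))\<^sup>2)) \<longlonglongrightarrow> ennreal ((norm (Y x - X k x))\<^sup>2)"
          by (intro tendsto_ennrealI tendsto_power tendsto_norm tendsto_diff tendsto_const) (simp add: add.commute)
        from lim_imp_Liminf[OF _ this] show ?case by simp
      qed
    qed
    also have "\<dots> \<le> liminf (\<lambda>i. \<integral>\<^sup>+x. ennreal ((norm (X (k + i) x - X k x))\<^sup>2) \<partial>lborel)"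
      by (rule nn_integral_liminf) measurable
    also have "\<dots> \<le> liminf (\<lambda>i. ennreal ((3 / 2 * (1 / 3) ^ k)\<^sup>2))"
    proof (intro Liminf_mono always_eventually allI)
      fix i
      have "(\<integral>\<^sup>+x. ennreal ((norm (X (k + i) x - X k x))\<^sup>2) \<partial>lborel) = ennreal ((L2n (\<lambda>x. X (k + i) x - X k x))\<^sup>2)"
        unfolding L2n_power2 by (intro nn_integral_eq_integral L2_fun_integrable L2_fun_diff X) auto
      also have "\<dots> \<le> ennreal ((3 / 2 * (1 / 3) ^ k)\<^sup>2)"
      proof (intro ennreal_leI power_mono L2n_nonneg)
        have "(0::real) \<le> 3 / 2 * (1 / 3) ^ (k + i)" by simp
        then show "L2n (\<lambda>x. X (k + i) x - X k x) \<le> 3 / 2 * (1 / 3) ^ k" using tail[of k i] by linarith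
      qed
      finally show "(\<integral>\<^sup>+x. ennreal ((norm (X (k + i) x - X k x))\<^sup>2) \<partial>lborel) \<le> ennreal ((3 / 2 * (1 / 3) ^ k)\<^sup>2)" .
    qed
    finally show ?thesis by (simp add: Liminf_const)
  qed
  have Z: "L2_fun (\<lambda>x. Y x - X k x)" for k
  proof -
    have "(\<integral>\<^sup>+x. ennreal (norm ((norm (Y x - X k x))\<^sup>2)) \<partial>lborel) < \<infinity>"
      using fat[of k] by (simp add: order_le_less_trans)
    then show ?thesis by (simp add: L2_fun_iff integrable_iff_bounded)
  qed
  have "L2_fun (\<lambda>x. (Y x - X 0 x) + X 0 x)" by (intro L2_fun_add Z X)
  then have "L2_fun Y" by simp
  moreover have "L2n (\<lambda>x. Y x - X k x) \<le> 3 / 2 * (1 / 3) ^ k" for k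
  proof (rule power2_le_imp_le)
    have "ennreal ((L2n (\<lambda>x. Y x - X k x))\<^sup>2) = (\<integral>\<^sup>+x. ennreal ((norm (Y x - X k x))\<^sup>2) \<partial>lborel)"
      unfolding L2n_power2 by (intro nn_integral_eq_integral[symmetric] L2_fun_integrable Z) auto
    with fat[of k] show "(L2n (\<lambda>x. Y x - X k x))\<^sup>2 \<le> (3 / 2 * (1 / 3) ^ k)\<^sup>2"
      by (subst ennreal_le_iff[symmetric]) auto
  qed simp
  ultimately show ?thesis by (rule that)
qed

lemma L2_inner_le:
  fixes f g :: "'a::euclidean_space \<Rightarrow> real"
  assumes "L2_fun f" "L2_fun g"
  shows "\<bar>LINT x|lborel. f x * g x\<bar> \<le> L2n f * L2n g"
proof -
  have "\<bar>LINT x|lborel. f x * g x\<bar> \<le> (LINT x|lborel. \<bar>f x * g x\<bar>)"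
    by (rule integral_abs_bound)
  also have "\<dots> = (LINT x|lborel. norm (f x) * norm (g x))" by (simp add: abs_mult)
  also have "\<dots> \<le> L2n f * L2n g" by (rule L2_Cauchy_Schwarz[OF assms])
  finally show ?thesis .
qed

text \<open>
  The uniform boundedness principle, by the elementary argument of Sokal.  If the norms were unbounded, one
  could choose successively \<open>F n\<close> with norm at least \<open>4 ^ k\<close> and add \<open>\<plusminus> (1 / 3) ^ k\<close> times the normalised
  \<open>F n\<close> to \<open>X k\<close>, with the sign that does not decrease the modulus of the pairing with \<open>F n\<close>.  At the
  limit of the \<open>X k\<close> the pairings are unbounded, since the remaining steps have norm at most half of
  \<open>(1 / 3) ^ k\<close> in total.
\<close>

lemma L2_uniform_boundedness:
  fixes F :: "nat \<Rightarrow> 'a::euclidean_space \<Rightarrow> real"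
  assumes F: "\<And>n. L2_fun (F n)" and bdd: "\<And>v. L2_fun v \<Longrightarrow> Bseq (\<lambda>n. LINT x|lborel. F n x * v x)"
  obtains K where "\<And>n. L2n (F n) \<le> K"
proof (rule ccontr)
  assume "\<not> thesis"
  then have unb: "\<exists>n. L2n (F n) > K" for K using that by (meson not_less)
  let ?ip = "\<lambda>n v. LINT x|lborel. F n x * v x"
  have int: "integrable lborel (\<lambda>x. F n x * v x)" if "L2_fun v" for n v
    by (rule bilinear_L2_integrable[OF bounded_bilinear_mult F that])
  define P where "P = (\<lambda>(k::nat) (X :: 'a \<Rightarrow> real). L2_fun X)"
  define Q where "Q = (\<lambda>(k::nat) (X :: 'a \<Rightarrow> real) X'. L2n (\<lambda>x. X' x - X x) \<le> (1 / 3) ^ k \<and>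
      (\<exists>n. L2n (F n) \<ge> 4 ^ k \<and> \<bar>?ip n X'\<bar> \<ge> (1 / 3) ^ k * L2n (F n)))"
  have "\<exists>X. \<forall>k. P k (X k) \<and> Q k (X k) (X (Suc k))"
  proof (rule dependent_nat_choice)
    show "\<exists>X. P 0 X" using L2_fun_zero by (auto simp: P_def)
    fix X k assume "P k X"
    then have X: "L2_fun X" by (simp add: P_def)
    obtain n where n: "L2n (F n) > 4 ^ k" using unb by blast
    have N: "L2n (F n) > 0" by (rule less_trans[OF _ n]) simp
    define s :: real where "s = (if ?ip n X \<ge> 0 then 1 else -1)"
    define r where "r = s * (1 / 3) ^ k / L2n (F n)"
    define X' where "X' x = X x + r *\<^sub>R F n x" for x
    have X': "L2_fun X'" unfolding X'_def by (intro L2_fun_add L2_fun_scaleR X F)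
    have "L2n (\<lambda>x. X' x - X x) = \<bar>r\<bar> * L2n (F n)" using L2n_scaleR[of r "F n"] by (simp add: X'_def)
    also have "\<dots> = (1 / 3) ^ k" using N by (simp add: r_def s_def abs_mult)
    finally have 1: "L2n (\<lambda>x. X' x - X x) = (1 / 3) ^ k" .
    have "?ip n X' = (LINT x|lborel. F n x * X x + r * (F n x * F n x))"
      by (intro Bochner_Integration.integral_cong) (auto simp: X'_def algebra_simps)
    also have "\<dots> = ?ip n X + r * (L2n (F n))\<^sup>2"
    proof -
      have "(LINT x|lborel. F n x * F n x) = (L2n (F n))\<^sup>2"
        unfolding L2n_power2 by (simp add: power2_eq_square)
      then show ?thesis using int[OF X] int[OF F] by simp
    qed
    also have "\<dots> = ?ip n X + s * ((1 / 3) ^ k * L2n (F n))"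
      using N by (simp add: r_def power2_eq_square)
    finally have "\<bar>?ip n X'\<bar> \<ge> (1 / 3) ^ k * L2n (F n)"
      using N by (auto simp: s_def)
    with 1 n X' show "\<exists>X'. P (Suc k) X' \<and> Q k X X'"
      unfolding P_def Q_def by (intro exI[of _ X'] conjI exI[of _ n]) auto
  qed
  then obtain X where X: "\<And>k. L2_fun (X k)" and Q: "\<And>k. Q k (X k) (X (Suc k))" by (auto simp: P_def)
  have "L2n (\<lambda>x. X (Suc k) x - X k x) \<le> (1 / 3) ^ k" for k using Q[of k] by (simp add: Q_def)
  from L2_complete_geometric[OF X this]
  obtain Y where Y: "L2_fun Y" "\<And>k. L2n (\<lambda>x. Y x - X k x) \<le> 3 / 2 * (1 / 3) ^ k" by blast
  from bdd[OF Y(1)] obtain M where M: "\<And>n. \<bar>?ip n Y\<bar> \<le> M" by (auto simp: Bseq_def)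
  have "(4 / 3) ^ k \<le> 2 * M" for k
  proof -
    obtain n where n: "L2n (F n) \<ge> 4 ^ k" "\<bar>?ip n (X (Suc k))\<bar> \<ge> (1 / 3) ^ k * L2n (F n)"
      using Q[of k] by (auto simp: Q_def)
    have D: "L2_fun (\<lambda>x. Y x - X (Suc k) x)" by (intro L2_fun_diff Y X)
    have "\<bar>?ip n (\<lambda>x. Y x - X (Suc k) x)\<bar> \<le> L2n (F n) * (3 / 2 * (1 / 3) ^ Suc k)"
      by (rule order_trans[OF L2_inner_le[OF F D]]) (intro mult_left_mono Y L2n_nonneg)
    moreover have "?ip n Y = ?ip n (X (Suc k)) + ?ip n (\<lambda>x. Y x - X (Suc k) x)"
      unfolding right_diff_distrib Bochner_Integration.integral_diff[OF int[OF Y(1)] int[OF X]] by simp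
    ultimately have "(1 / 3) ^ k * L2n (F n) - L2n (F n) * (3 / 2 * (1 / 3) ^ Suc k) \<le> \<bar>?ip n Y\<bar>"
      using n(2) by linarith
    moreover have "(1 / 3) ^ k * L2n (F n) - L2n (F n) * (3 / 2 * (1 / 3) ^ Suc k) = ((1 / 3) ^ k * L2n (F n)) / 2"
      by simp
    ultimately have "(1 / 3) ^ k * L2n (F n) \<le> 2 * M" using M[of n] by linarith
    moreover have "(1 / 3) ^ k * 4 ^ k \<le> (1 / 3) ^ k * L2n (F n)"
      by (intro mult_left_mono n) auto
    moreover have "(1 / 3) ^ k * 4 ^ k = (4 / 3 :: real) ^ k" by (simp add: power_mult_distrib[symmetric])
    ultimately show ?thesis by linarith
  qed
  moreover obtain k where "2 * M < (4 / 3 :: real) ^ k"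
    using real_arch_pow[of "4 / 3" "2 * M"] by auto
  ultimately show False by (meson not_less)
qed

lemma L2_weak_conv_times_L2_lim:
  assumes E: "L2_weak_conv E\<^sub>n E" and V: "L2_lim V\<^sub>n V"
  shows "(\<lambda>n. LINT x|lborel. E\<^sub>n n x * V\<^sub>n n x) \<longlonglongrightarrow> (LINT x|lborel. E x * V x)"
proof -
  have L: "L2_fun (E\<^sub>n n)" "L2_fun E" "L2_fun (V\<^sub>n n)" "L2_fun V" for n
    using E V by (auto simp: L2_weak_conv_def L2_lim_def)
  have conv: "(\<lambda>n. LINT x|lborel. E\<^sub>n n x * v x) \<longlonglongrightarrow> (LINT x|lborel. E x * v x)" if "L2_fun v" for v
    using E that by (simp add: L2_weak_conv_def)
  have "Bseq (\<lambda>n. LINT x|lborel. E\<^sub>n n x * v x)" if "L2_fun v" for v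
    by (rule convergent_imp_Bseq[OF convergentI[OF conv[OF that]]])
  from L2_uniform_boundedness[OF L(1) this]
  obtain K where K: "\<And>n. L2n (E\<^sub>n n) \<le> K" by blast
  have int: "integrable lborel (\<lambda>x. E\<^sub>n n x * v x)" if "L2_fun v" for n v
    by (rule bilinear_L2_integrable[OF bounded_bilinear_mult L(1) that])
  have "(\<lambda>n. LINT x|lborel. E\<^sub>n n x * (V\<^sub>n n x - V x)) \<longlonglongrightarrow> 0"
  proof (rule Lim_null_comparison)
    show "(\<lambda>n. K * L2n (\<lambda>x. V\<^sub>n n x - V x)) \<longlonglongrightarrow> 0"
      using V by (intro tendsto_mult_right_zero) (simp add: L2_lim_def)
    have "norm (LINT x|lborel. E\<^sub>n n x * (V\<^sub>n n x - V x)) \<le> K * L2n (\<lambda>x. V\<^sub>n n x - V x)" for n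
      using L2_inner_le[OF L(1) L2_fun_diff[OF L(3) L(4)], of n n] mult_right_mono[OF K L2n_nonneg, of n "\<lambda>x. V\<^sub>n n x - V x"]
      by simp
    then show "\<forall>\<^sub>F n in sequentially. norm (LINT x|lborel. E\<^sub>n n x * (V\<^sub>n n x - V x)) \<le> K * L2n (\<lambda>x. V\<^sub>n n x - V x)"
      by simp
  qed
  from tendsto_add[OF this conv[OF L(4)]] show ?thesis
    using int[OF L(3)] int[OF L(4)] by (simp add: right_diff_distrib)
qed

section \<open>The limit of the energy inequality\<close>

lemma L2_norm_on_restrict: "L2_norm_on S f = L2_norm_on UNIV (\<lambda>x. indicator S x *\<^sub>R f x)"
proof -
  have "(\<integral>\<^sup>+x\<in>S. ennreal ((norm (f x))\<^sup>2) \<partial>lborel) = (\<integral>\<^sup>+x. ennreal ((norm (indicator S x *\<^sub>R f x))\<^sup>2) \<partial>lborel)"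
    by (intro nn_integral_cong) (auto split: split_indicator)
  then show ?thesis by (simp add: L2_norm_on_def)
qed

lemma L2_fun_restrict:
  assumes f[measurable]: "f \<in> borel_measurable borel" and S[measurable]: "S \<in> sets borel" and "L2_norm_on S f < \<infinity>"
  shows "L2_fun (\<lambda>x. indicator S x *\<^sub>R f x)" "L2_norm_on S f = ennreal (L2n (\<lambda>x. indicator S x *\<^sub>R f x))"
proof -
  have m: "(\<lambda>x. indicator S x *\<^sub>R f x) \<in> borel_measurable borel" by measurable
  show L: "L2_fun (\<lambda>x. indicator S x *\<^sub>R f x)"
    using assms(3) m unfolding L2_fun_def L2_norm_on_restrict[of S f] by blast
  show "L2_norm_on S f = ennreal (L2n (\<lambda>x. indicator S x *\<^sub>R f x))"
    unfolding L2_norm_on_restrict[of S f] by (rule L2_norm_on_UNIV[OF L])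
qed

lemma L2loc_conv_L2_lim:
  assumes c: "L2loc_conv F f" and r: "r > 0"
  shows "L2_lim (\<lambda>n x. indicator (ball 0 r) x *\<^sub>R F n x) (\<lambda>x. indicator (ball 0 r) x *\<^sub>R f x)"
proof -
  have F: "F n \<in> borel_measurable borel" "L2_norm_on (ball 0 r) (F n) < \<infinity>" for n
    using c r by (auto simp: L2loc_conv_def L2loc_fun_def)
  have f: "f \<in> borel_measurable borel" "L2_norm_on (ball 0 r) f < \<infinity>"
    using c r by (auto simp: L2loc_conv_def L2loc_fun_def)
  have LF: "L2_fun (\<lambda>x. indicator (ball 0 r) x *\<^sub>R F n x)" for n by (intro L2_fun_restrict F) simp
  have Lf: "L2_fun (\<lambda>x. indicator (ball 0 r) x *\<^sub>R f x)" by (intro L2_fun_restrict f) simp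
  have eq: "L2_norm_on (ball 0 r) (\<lambda>x. F n x - f x) =
      ennreal (L2n (\<lambda>x. indicator (ball 0 r) x *\<^sub>R F n x - indicator (ball 0 r) x *\<^sub>R f x))" for n
    using L2_norm_on_UNIV[OF L2_fun_diff[OF LF Lf]]
    by (simp add: L2_norm_on_restrict[of _ "\<lambda>x. F n x - f x"] scaleR_diff_right)
  have "(\<lambda>n. L2_norm_on (ball 0 r) (\<lambda>x. F n x - f x)) \<longlonglongrightarrow> ennreal 0"
    using c r by (simp add: L2loc_conv_def)
  then have "(\<lambda>n. L2n (\<lambda>x. indicator (ball 0 r) x *\<^sub>R F n x - indicator (ball 0 r) x *\<^sub>R f x)) \<longlonglongrightarrow> 0"
    unfolding eq by (subst (asm) tendsto_ennreal_iff) (auto simp: L2n_nonneg)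
  then show ?thesis using LF Lf by (simp add: L2_lim_def)
qed

lemma trunc_Lipschitz:
  assumes "e > 0" "s \<ge> 0" "s' \<ge> 0"
  shows "\<bar>trunc e s' - trunc e s\<bar> \<le> \<bar>s' - s\<bar>"
proof -
  have 1: "1 * 1 \<le> (1 + e * s') * (1 + e * s)" using assms by (intro mult_mono) auto
  have "\<bar>trunc e s' - trunc e s\<bar> = \<bar>s' - s\<bar> / ((1 + e * s') * (1 + e * s))"
    unfolding trunc_diff[OF assms] abs_divide using 1 by simp
  also have "\<dots> \<le> \<bar>s' - s\<bar> / 1" using 1 by (intro divide_left_mono) auto
  finally show ?thesis by simp
qed

lemma bump_times_trunc_le:
  assumes "e > 0" "s \<ge> 0" and "x \<notin> B \<Longrightarrow> bump k a c x = 0"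
  shows "norm (bump k a c x * trunc e s) \<le> 1 * norm (indicator B x * s)"
proof -
  have "bump k a c x * trunc e s \<le> 1 * s"
    using assms by (intro mult_mono bump_le_1 trunc_le trunc_nonneg) auto
  then show ?thesis
    using assms bump_nonneg[of k a c x] trunc_nonneg[OF assms(1,2)]
    by (cases "x \<in> B") (auto simp: abs_mult)
qed

lemma weak_gradient_measurable:
  assumes "weak_gradient f G"
  shows "G \<in> borel_measurable borel"
proof -
  have "(\<lambda>x. \<Sum>b\<in>Basis. (G x \<bullet> b) *\<^sub>R b) \<in> borel_measurable borel"
    using assms unfolding weak_gradient_def weak_partial_def
    by (intro borel_measurable_sum borel_measurable_scaleR borel_measurable_const L1loc_fun_measurable) auto
  then show ?thesis by (simp add: euclidean_representation)
qed

text \<open>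
  Truncation is Lipschitz, so \<open>trunc e\<close> of the densities times a bump converges strongly in \<open>L\<^sup>2\<close> and may be
  paired with the weakly convergent energies.
\<close>

lemma truncated_limit_inequality:
  fixes \<Psi> :: "nat \<Rightarrow> 'a::euclidean_space \<Rightarrow> complex" and G\<^sub>n J\<^sub>n :: "nat \<Rightarrow> 'a \<Rightarrow> 'a"
  assumes m: "m > 0" and h: "\<And>n. h n > 0" and h0: "h \<longlonglongrightarrow> 0"
    and \<Psi>: "\<And>n. sobolev_H 2 (\<Psi> n)"
    and grad: "\<And>n. weak_gradient (wigner_density (h n) (\<Psi> n)) (G\<^sub>n n)"
    and grad0: "\<And>r. r > 0 \<Longrightarrow> (\<lambda>n. ennreal (h n) * L2_norm_on (ball 0 r) (G\<^sub>n n)) \<longlonglongrightarrow> 0"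
    and E\<^sub>n: "\<And>n. wigner_energy m (h n) (\<Psi> n) (E\<^sub>n n)" and E: "L2_weak_conv E\<^sub>n E"
    and \<rho>: "L2loc_conv (\<lambda>n. wigner_density (h n) (\<Psi> n)) \<rho>" and \<rho>0: "AE x in lborel. 0 \<le> \<rho> x"
    and J\<^sub>n: "\<And>n. wigner_current m (h n) (\<Psi> n) (J\<^sub>n n)" and J: "L2loc_conv J\<^sub>n J"
    and e: "e > 0"
  shows "AE x in lborel. 2 * m * E x * trunc e (\<rho> x) \<le> m\<^sup>2 * (norm (J x))\<^sup>2"
proof -
  let ?R = "\<lambda>n. wigner_density (h n) (\<Psi> n)"
  have EL: "L2_fun (E\<^sub>n n)" "L2_fun E" for n using E by (auto simp: L2_weak_conv_def)
  have [measurable]: "E \<in> borel_measurable borel" "\<rho> \<in> borel_measurable borel" "J \<in> borel_measurable borel"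
      "?R n \<in> borel_measurable borel" for n
    using EL \<rho> J by (auto simp: L2loc_conv_def L2loc_fun_def dest: L2_fun_measurable)
  have Em: "E\<^sub>n n \<in> borel_measurable borel" for n using EL by (auto dest: L2_fun_measurable)
  have R0: "0 \<le> ?R n x" for n x by (simp add: wigner_density_eq)
  have Et: "L2_fun (\<lambda>x. trunc e (\<rho> x) * E x)"
  proof (rule L2_fun_bound[OF EL(2)])
    show "AE x in lborel. norm (trunc e (\<rho> x) * E x) \<le> 1 / e * norm (E x)"
      using \<rho>0
    proof eventually_elim
      case (elim x)
      have "\<bar>trunc e (\<rho> x)\<bar> \<le> 1 / e" using trunc_nonneg[OF e elim] trunc_le_inverse[OF e elim] by simp
      from mult_right_mono[OF this, of "\<bar>E x\<bar>"] show ?case by (simp only: real_norm_def abs_mult abs_ge_zero)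
    qed
  qed measurable
  have l1: "L1loc_fun (\<lambda>x. trunc e (\<rho> x) * E x)" by (rule L2_fun_L1loc_fun[OF Et])
  have l2: "L1loc_fun (\<lambda>x. (norm (J x))\<^sup>2)"
    unfolding L1loc_fun_def set_integrable_def
  proof (intro allI impI)
    fix r :: real assume "r > 0"
    then have "L2_fun (\<lambda>x. indicator (ball 0 r) x *\<^sub>R J x)"
      using L2loc_conv_L2_lim[OF J] by (simp add: L2_lim_def)
    from L2_fun_integrable[OF this] show "integrable lborel (\<lambda>x. indicator (ball 0 r) x *\<^sub>R (norm (J x))\<^sup>2)"
    proof (rule Bochner_Integration.integrable_bound)
      have [measurable]: "ball (0::'a) r \<in> sets borel" by simp
      show "(\<lambda>x. indicator (ball 0 r) x *\<^sub>R (norm (J x))\<^sup>2) \<in> borel_measurable lborel" by measurable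
    qed (auto split: split_indicator)
  qed
  have "AE x in lborel. 2 * m * (trunc e (\<rho> x) * E x) - m\<^sup>2 * (norm (J x))\<^sup>2 \<le> 0"
  proof (rule AE_nonpos_if_bump_integrals_nonpos)
    show "L1loc_fun (\<lambda>x. 2 * m * (trunc e (\<rho> x) * E x) - m\<^sup>2 * (norm (J x))\<^sup>2)"
      using l1 l2 unfolding L1loc_fun_def
      by (intro allI impI set_integral_diff(1) set_integrable_mult_right) auto
    fix k :: nat and a c :: 'a
    let ?\<phi> = "bump k a c"
    obtain r where r: "r > 0" "cbox a c \<subseteq> ball 0 r" using bounded_subset_ball0[OF bounded_cbox] .
    let ?B = "ball (0::'a) r"
    have B: "?B \<in> sets borel" "box a c \<subseteq> ?B" "cbox a c \<subseteq> ?B" using r box_subset_cbox by auto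
    have \<phi>0: "?\<phi> x = 0" if "x \<notin> ?B" for x
      using bump_eq_0[of x a c k] B(2) that by blast
    have "\<forall>b\<in>Basis. \<exists>C. C \<ge> 0 \<and> (\<forall>x. \<bar>dir_deriv b ?\<phi> x\<bar> \<le> C)"
      using bump_deriv_bounded[of _ k a c] by metis
    from bchoice[OF this] obtain Cb where Cb: "\<And>b. b \<in> Basis \<Longrightarrow> Cb b \<ge> 0" "\<And>b x. b \<in> Basis \<Longrightarrow> \<bar>dir_deriv b ?\<phi> x\<bar> \<le> Cb b"
      by blast
    define C where "C = (\<Sum>b\<in>Basis. Cb b)"
    have C: "\<bar>dir_deriv b ?\<phi> x\<bar> \<le> C" if "b \<in> Basis" for b x
      using Cb(2)[OF that, of x] member_le_sum[of b Basis Cb] Cb(1) that unfolding C_def by fastforce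
    have RL: "L2_lim (\<lambda>n x. indicator ?B x * ?R n x) (\<lambda>x. indicator ?B x * \<rho> x)"
      using L2loc_conv_L2_lim[OF \<rho> r(1)] by simp
    have JL: "L2_lim (\<lambda>n x. indicator ?B x *\<^sub>R J\<^sub>n n x) (\<lambda>x. indicator ?B x *\<^sub>R J x)"
      by (rule L2loc_conv_L2_lim[OF J r(1)])
    let ?G = "\<lambda>n x. indicator ?B x *\<^sub>R G\<^sub>n n x"
    \<comment> \<open>The gradients need to be square integrable on the ball only for large \<open>n\<close>.\<close>
    have "eventually (\<lambda>n. ennreal (h n) * L2_norm_on ?B (G\<^sub>n n) < 1) sequentially"
      using order_tendstoD(2)[OF grad0[OF r(1)], of 1] by simp
    then have ev: "eventually (\<lambda>n. L2_fun (?G n) \<and> ennreal (h n) * L2_norm_on ?B (G\<^sub>n n) = ennreal (h n * L2n (?G n))) sequentially"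
    proof eventually_elim
      case (elim n)
      have "L2_norm_on ?B (G\<^sub>n n) \<noteq> \<infinity>"
      proof
        assume "L2_norm_on ?B (G\<^sub>n n) = \<infinity>"
        then show False using elim h[of n] by (simp add: ennreal_mult_top)
      qed
      then have f: "L2_norm_on ?B (G\<^sub>n n) < \<infinity>" by (simp add: less_top)
      note L = L2_fun_restrict[OF weak_gradient_measurable[OF grad] B(1) f]
      show ?case using L(1) h[of n] unfolding L(2) by (simp add: ennreal_mult L2n_nonneg)
    qed
    have hG: "(\<lambda>n. h n * L2n (?G n)) \<longlonglongrightarrow> 0"
    proof -
      have "(\<lambda>n. ennreal (h n * L2n (?G n))) \<longlonglongrightarrow> ennreal 0"
        unfolding ennreal_0 by (rule Lim_transform_eventually[OF grad0[OF r(1)]]) (use ev in \<open>auto elim: eventually_mono\<close>)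
      then show ?thesis
        using h by (subst (asm) tendsto_ennreal_iff) (auto simp: L2n_nonneg less_imp_le)
    qed
    have main: "eventually (\<lambda>n. 2 * m * (LINT x|lborel. E\<^sub>n n x * (?\<phi> x * trunc e (?R n x))) \<le>
      m\<^sup>2 * (LINT x|lborel. ?\<phi> x *\<^sub>R ((indicator ?B x *\<^sub>R J\<^sub>n n x) \<bullet> (indicator ?B x *\<^sub>R J\<^sub>n n x))) +
      ((h n * L2n (?G n))\<^sup>2 + C * real DIM('a) * (h n * (L2n (\<lambda>x. indicator ?B x * ?R n x) * (h n * L2n (?G n)))))) sequentially"
      using ev
    proof eventually_elim
      case (elim n)
      have "2 * m * (LINT x|lborel. ?\<phi> x * trunc e (?R n x) * E\<^sub>n n x) \<le>
        m\<^sup>2 * (LINT x|lborel. ?\<phi> x * (norm (J\<^sub>n n x))\<^sup>2) +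
        (h n)\<^sup>2 * ((L2n (?G n))\<^sup>2 + C * real DIM('a) * (L2n (\<lambda>x. indicator ?B x * ?R n x) * L2n (?G n)))"
        by (rule truncated_energy_inequality(2)[OF m h e \<Psi> grad J\<^sub>n E\<^sub>n Em B _ _ _ C])
           (use elim JL RL in \<open>auto simp: L2_lim_def\<close>)
      moreover have "(\<lambda>x. ?\<phi> x * (norm (J\<^sub>n n x))\<^sup>2) = (\<lambda>x. ?\<phi> x *\<^sub>R ((indicator ?B x *\<^sub>R J\<^sub>n n x) \<bullet> (indicator ?B x *\<^sub>R J\<^sub>n n x)))"
      proof
        fix x show "?\<phi> x * (norm (J\<^sub>n n x))\<^sup>2 = ?\<phi> x *\<^sub>R ((indicator ?B x *\<^sub>R J\<^sub>n n x) \<bullet> (indicator ?B x *\<^sub>R J\<^sub>n n x))"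
          using \<phi>0[of x] by (cases "x \<in> ?B") (simp_all add: power2_norm_eq_inner)
      qed
      moreover have "(h n)\<^sup>2 * ((L2n (?G n))\<^sup>2 + C * real DIM('a) * (L2n (\<lambda>x. indicator ?B x * ?R n x) * L2n (?G n))) =
        (h n * L2n (?G n))\<^sup>2 + C * real DIM('a) * (h n * (L2n (\<lambda>x. indicator ?B x * ?R n x) * (h n * L2n (?G n))))"
        by (simp add: power2_eq_square distrib_left mult_ac)
      moreover have "(\<lambda>x. ?\<phi> x * trunc e (?R n x) * E\<^sub>n n x) = (\<lambda>x. E\<^sub>n n x * (?\<phi> x * trunc e (?R n x)))"
        by (simp add: mult.commute)
      ultimately show ?case by (simp only:)
    qed
    have limL: "(\<lambda>n. 2 * m * (LINT x|lborel. E\<^sub>n n x * (?\<phi> x * trunc e (?R n x)))) \<longlonglongrightarrow>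
       2 * m * (LINT x|lborel. E x * (?\<phi> x * trunc e (\<rho> x)))"
    proof (intro tendsto_mult tendsto_const L2_weak_conv_times_L2_lim[OF E])
      have 1: "L2_fun (\<lambda>x. ?\<phi> x * trunc e (?R n x))" for n
      proof (rule L2_fun_bound[where f="\<lambda>x. indicator ?B x * ?R n x" and C=1])
        show "L2_fun (\<lambda>x. indicator ?B x * ?R n x)" using RL by (simp add: L2_lim_def)
        show "AE x in lborel. norm (?\<phi> x * trunc e (?R n x)) \<le> 1 * norm (indicator ?B x * ?R n x)"
          using \<phi>0 by (intro AE_I2 bump_times_trunc_le e R0) blast
      qed measurable
      have 2: "L2_fun (\<lambda>x. ?\<phi> x * trunc e (\<rho> x))"
      proof (rule L2_fun_bound[where f="\<lambda>x. indicator ?B x * \<rho> x" and C=1])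
        show "L2_fun (\<lambda>x. indicator ?B x * \<rho> x)" using RL by (simp add: L2_lim_def)
        show "AE x in lborel. norm (?\<phi> x * trunc e (\<rho> x)) \<le> 1 * norm (indicator ?B x * \<rho> x)"
          using \<rho>0 by eventually_elim (rule bump_times_trunc_le[OF e _ \<phi>0])
      qed measurable
      have RD: "L2_fun (\<lambda>x. indicator ?B x * ?R n x - indicator ?B x * \<rho> x)" for n
        using RL by (intro L2_fun_diff) (auto simp: L2_lim_def)
      have le: "L2n (\<lambda>x. ?\<phi> x * trunc e (?R n x) - ?\<phi> x * trunc e (\<rho> x)) \<le> L2n (\<lambda>x. indicator ?B x * ?R n x - indicator ?B x * \<rho> x)" for n
      proof (rule L2n_mono_AE[OF _ L2_fun_diff[OF 1 2] RD])
        show "AE x in lborel. norm (?\<phi> x * trunc e (?R n x) - ?\<phi> x * trunc e (\<rho> x)) \<le> norm (indicator ?B x * ?R n x - indicator ?B x * \<rho> x)"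
          using \<rho>0
        proof eventually_elim
          case (elim x)
          have "norm (?\<phi> x * trunc e (?R n x) - ?\<phi> x * trunc e (\<rho> x)) = ?\<phi> x * \<bar>trunc e (?R n x) - trunc e (\<rho> x)\<bar>"
            using bump_nonneg[of k a c x] by (simp add: right_diff_distrib[symmetric] abs_mult)
          also have "\<dots> \<le> indicator ?B x * \<bar>?R n x - \<rho> x\<bar>"
            using bump_nonneg[of k a c x] bump_le_1[of k a c x] \<phi>0[of x]
            by (intro mult_mono trunc_Lipschitz e elim R0) (auto split: split_indicator)
          also have "\<dots> = norm (indicator ?B x * ?R n x - indicator ?B x * \<rho> x)"
            by (simp add: right_diff_distrib[symmetric] abs_mult)
          finally show ?case .
        qed
      qed
      show "L2_lim (\<lambda>n x. ?\<phi> x * trunc e (?R n x)) (\<lambda>x. ?\<phi> x * trunc e (\<rho> x))"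
        unfolding L2_lim_def
      proof (intro conjI allI 1 2)
        show "(\<lambda>n. L2n (\<lambda>x. ?\<phi> x * trunc e (?R n x) - ?\<phi> x * trunc e (\<rho> x))) \<longlonglongrightarrow> 0"
          by (rule tendsto_sandwich[OF _ _ tendsto_const RL[unfolded L2_lim_def, THEN conjunct2, THEN conjunct2]])
             (intro always_eventually allI L2n_nonneg le)+
      qed
    qed
    have limJ: "(\<lambda>n. LINT x|lborel. ?\<phi> x *\<^sub>R ((indicator ?B x *\<^sub>R J\<^sub>n n x) \<bullet> (indicator ?B x *\<^sub>R J\<^sub>n n x))) \<longlonglongrightarrow>
       (LINT x|lborel. ?\<phi> x *\<^sub>R ((indicator ?B x *\<^sub>R J x) \<bullet> (indicator ?B x *\<^sub>R J x)))"
      by (rule L1_lim_integral_bounded_times(1)[OF L2_lim_bilinear[OF bounded_bilinear_inner JL JL], of _ 1])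
         (auto simp: bump_nonneg bump_le_1)
    have limR: "(\<lambda>n. m\<^sup>2 * (LINT x|lborel. ?\<phi> x *\<^sub>R ((indicator ?B x *\<^sub>R J\<^sub>n n x) \<bullet> (indicator ?B x *\<^sub>R J\<^sub>n n x))) +
      ((h n * L2n (?G n))\<^sup>2 + C * real DIM('a) * (h n * (L2n (\<lambda>x. indicator ?B x * ?R n x) * (h n * L2n (?G n)))))) \<longlonglongrightarrow>
      m\<^sup>2 * (LINT x|lborel. ?\<phi> x *\<^sub>R ((indicator ?B x *\<^sub>R J x) \<bullet> (indicator ?B x *\<^sub>R J x))) +
      (0\<^sup>2 + C * real DIM('a) * (0 * (L2n (\<lambda>x. indicator ?B x * \<rho> x) * 0)))"
      by (intro tendsto_intros limJ hG h0 L2_lim_bounded_norm RL)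
    have "2 * m * (LINT x|lborel. E x * (?\<phi> x * trunc e (\<rho> x))) \<le>
      m\<^sup>2 * (LINT x|lborel. ?\<phi> x *\<^sub>R ((indicator ?B x *\<^sub>R J x) \<bullet> (indicator ?B x *\<^sub>R J x))) +
      (0\<^sup>2 + C * real DIM('a) * (0 * (L2n (\<lambda>x. indicator ?B x * \<rho> x) * 0)))"
      by (rule tendsto_le[OF _ limR limL main]) simp
    moreover have "(\<lambda>x. ?\<phi> x *\<^sub>R ((indicator ?B x *\<^sub>R J x) \<bullet> (indicator ?B x *\<^sub>R J x))) = (\<lambda>x. ?\<phi> x * (norm (J x))\<^sup>2)"
    proof
      fix x show "?\<phi> x *\<^sub>R ((indicator ?B x *\<^sub>R J x) \<bullet> (indicator ?B x *\<^sub>R J x)) = ?\<phi> x * (norm (J x))\<^sup>2"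
        using \<phi>0[of x] by (cases "x \<in> ?B") (simp_all add: power2_norm_eq_inner)
    qed
    moreover have "(\<lambda>x. E x * (?\<phi> x * trunc e (\<rho> x))) = (\<lambda>x. ?\<phi> x * (trunc e (\<rho> x) * E x))"
      by (simp add: fun_eq_iff mult_ac)
    ultimately have fin: "2 * m * (LINT x|lborel. ?\<phi> x * (trunc e (\<rho> x) * E x)) - m\<^sup>2 * (LINT x|lborel. ?\<phi> x * (norm (J x))\<^sup>2) \<le> 0"
      by simp
    have i: "integrable lborel (\<lambda>x. ?\<phi> x * (trunc e (\<rho> x) * E x))" "integrable lborel (\<lambda>x. ?\<phi> x * (norm (J x))\<^sup>2)"
      using integrable_bump_times_L1loc[OF l1, of k a c] integrable_bump_times_L1loc[OF l2, of k a c] by simp_all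
    have "(LINT x|lborel. ?\<phi> x * (2 * m * (trunc e (\<rho> x) * E x) - m\<^sup>2 * (norm (J x))\<^sup>2)) =
      (LINT x|lborel. 2 * m * (?\<phi> x * (trunc e (\<rho> x) * E x)) - m\<^sup>2 * (?\<phi> x * (norm (J x))\<^sup>2))"
      by (intro Bochner_Integration.integral_cong refl) (simp add: algebra_simps)
    also have "\<dots> = 2 * m * (LINT x|lborel. ?\<phi> x * (trunc e (\<rho> x) * E x)) - m\<^sup>2 * (LINT x|lborel. ?\<phi> x * (norm (J x))\<^sup>2)"
      unfolding Bochner_Integration.integral_diff[OF integrable_mult_right[OF i(1), of "2 * m"] integrable_mult_right[OF i(2), of "m\<^sup>2"]]
        integral_mult_right_zero ..
    finally show "(LINT x|lborel. ?\<phi> x * (2 * m * (trunc e (\<rho> x) * E x) - m\<^sup>2 * (norm (J x))\<^sup>2)) \<le> 0"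
      using fin by (simp only:)
  qed
  then show ?thesis by eventually_elim (simp add: mult_ac)
qed

lemma le_if_truncations_le:
  assumes "\<And>j::nat. M * trunc (inverse (real (Suc j))) s \<le> K"
  shows "M * s \<le> K"
proof -
  have "(\<lambda>j. M * (s / (1 + inverse (real (Suc j)) * s))) \<longlonglongrightarrow> M * (s / (1 + 0 * s))"
    by (intro tendsto_intros null_sequence(1)) simp
  from LIMSEQ_le_const2[OF this] show ?thesis using assms by (simp add: trunc_def)
qed

section \<open>Concentration of the measure on a graph\<close>

text \<open>
  An identity between integrals of \<open>F\<close> over cylinders and integrals of \<open>g\<close> extends from indicator functions
  of \<open>x\<close> to bounded measurable functions of \<open>x\<close>.
\<close>

lemma marginal_bounded_times:
  fixes w :: "('a::euclidean_space \<times> 'a) measure" and F :: "'a \<times> 'a \<Rightarrow> real" and g :: "'a \<Rightarrow> real"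
  assumes F: "integrable w F" and g: "integrable lborel g" and w: "sets w = sets borel"
    and eq: "\<And>S. S \<in> sets borel \<Longrightarrow> (LINT z|w. indicator S (fst z) * F z) = (LINT x|lborel. indicator S x * g x)"
    and v: "v \<in> borel_measurable borel" "\<And>x. \<bar>v x\<bar> \<le> (K::real)"
  shows "integrable w (\<lambda>z. v (fst z) * F z)" "integrable lborel (\<lambda>x. v x * g x)"
    "(LINT z|w. v (fst z) * F z) = (LINT x|lborel. v x * g x)"
proof -
  have fst_m[measurable]: "fst \<in> borel_measurable w"
    unfolding measurable_cong_sets[OF w refl] by (intro borel_measurable_continuous_onI continuous_intros)
  have Fm[measurable]: "F \<in> borel_measurable w" using F by (rule borel_measurable_integrable)
  have gm[measurable]: "g \<in> borel_measurable borel" using borel_measurable_integrable[OF g] by simp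
  have intw: "integrable w (\<lambda>z. v (fst z) * F z)" if [measurable]: "v \<in> borel_measurable borel" and b: "\<And>x. \<bar>v x\<bar> \<le> K" for v K
  proof (rule Bochner_Integration.integrable_bound)
    show "integrable w (\<lambda>z. K * F z)" using F by simp
    show "AE z in w. norm (v (fst z) * F z) \<le> norm (K * F z)"
    proof (rule AE_I2)
      fix z :: "'a \<times> 'a"
      have "\<bar>v (fst z)\<bar> \<le> \<bar>K\<bar>" using b[of "fst z"] by linarith
      then show "norm (v (fst z) * F z) \<le> norm (K * F z)" by (simp add: abs_mult mult_right_mono)
    qed
  qed measurable
  have intl: "integrable lborel (\<lambda>x. v x * g x)" if "v \<in> borel_measurable borel" "\<And>x. \<bar>v x\<bar> \<le> K" for v K
    by (rule bounded_times_integrable[OF g that])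
  show "integrable w (\<lambda>z. v (fst z) * F z)" "integrable lborel (\<lambda>x. v x * g x)" by (rule intw[OF v], rule intl[OF v])
  define P where "P u \<longleftrightarrow> (\<forall>K. (\<forall>x. u x \<le> K) \<longrightarrow> (LINT z|w. u (fst z) * F z) = (LINT x|lborel. u x * g x))" for u :: "'a \<Rightarrow> real"
  have nonneg: "P u" if u: "u \<in> borel_measurable (borel :: 'a measure)" "\<And>x. 0 \<le> u x" for u
    using u
  proof (induction u rule: borel_measurable_induct_real)
    case (set A)
    then show ?case by (simp add: P_def eq)
  next
    case (mult u c)
    show ?case unfolding P_def
    proof (intro allI impI)
      fix K assume K: "\<forall>x. c * u x \<le> K"
      show "(LINT z|w. (c * u (fst z)) * F z) = (LINT x|lborel. (c * u x) * g x)"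
      proof (cases "c = 0")
        case False
        then have "\<forall>x. u x \<le> K / c" using K mult(1) by (simp add: field_simps)
        then have "(LINT z|w. u (fst z) * F z) = (LINT x|lborel. u x * g x)" using mult.IH by (auto simp: P_def)
        then show ?thesis by (simp add: mult.assoc)
      qed simp
    qed
  next
    case (add u v)
    show ?case unfolding P_def
    proof (intro allI impI)
      fix K assume K: "\<forall>x. v x + u x \<le> K"
      have b: "u x \<le> K" "v x \<le> K" "\<bar>u x\<bar> \<le> K" "\<bar>v x\<bar> \<le> K" for x
        using K[rule_format, of x] add(2)[of x] add(4)[of x] by auto
      have "(LINT z|w. u (fst z) * F z) = (LINT x|lborel. u x * g x)" "(LINT z|w. v (fst z) * F z) = (LINT x|lborel. v x * g x)"
        using add.IH b(1,2) unfolding P_def by blast+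
      then show "(LINT z|w. (v (fst z) + u (fst z)) * F z) = (LINT x|lborel. (v x + u x) * g x)"
        using intw[OF add(1) b(3)] intw[OF add(3) b(4)] intl[OF add(1) b(3)] intl[OF add(3) b(4)]
        by (simp add: distrib_right)
    qed
  next
    case (seq U)
    show ?case unfolding P_def
    proof (intro allI impI)
      fix K assume K: "\<forall>x. u x \<le> K"
      have Ule: "U i x \<le> u x" for i x
        using seq(3,4) by (intro incseq_le[of "\<lambda>i. U i x"]) (auto simp: incseq_def le_fun_def)
      then have UK: "U i x \<le> K" "\<bar>U i x\<bar> \<le> K" for i x
        using order_trans[OF Ule[of i x] K[rule_format, of x]] seq(2)[of i x] by auto
      have um: "u \<in> borel_measurable borel"
        by (rule borel_measurable_LIMSEQ_metric[OF seq(1)]) (use seq(4) in auto)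
      note [measurable] = seq(1) um
      have "(\<lambda>i. LINT z|w. U i (fst z) * F z) \<longlonglongrightarrow> (LINT z|w. u (fst z) * F z)"
      proof (rule integral_dominated_convergence[where w="\<lambda>z. K * \<bar>F z\<bar>"])
        show "integrable w (\<lambda>z. K * \<bar>F z\<bar>)" using F by simp
        show "AE z in w. (\<lambda>i. U i (fst z) * F z) \<longlonglongrightarrow> u (fst z) * F z"
          using seq(4) by (intro AE_I2 tendsto_mult tendsto_const) auto
        show "AE z in w. norm (U i (fst z) * F z) \<le> K * \<bar>F z\<bar>" for i
          using UK by (auto simp: abs_mult intro!: mult_right_mono)
      qed measurable
      moreover have "(\<lambda>i. LINT x|lborel. U i x * g x) \<longlonglongrightarrow> (LINT x|lborel. u x * g x)"
      proof (rule integral_dominated_convergence[where w="\<lambda>x. K * \<bar>g x\<bar>"])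
        show "integrable lborel (\<lambda>x. K * \<bar>g x\<bar>)" using g by simp
        show "AE x in lborel. (\<lambda>i. U i x * g x) \<longlonglongrightarrow> u x * g x"
          using seq(4) by (intro AE_I2 tendsto_mult tendsto_const) auto
        show "AE x in lborel. norm (U i x * g x) \<le> K * \<bar>g x\<bar>" for i
          using UK by (auto simp: abs_mult intro!: mult_right_mono)
      qed measurable
      moreover have "(LINT z|w. U i (fst z) * F z) = (LINT x|lborel. U i x * g x)" for i
        using seq(5)[of i] UK(1) unfolding P_def by blast
      ultimately show "(LINT z|w. u (fst z) * F z) = (LINT x|lborel. u x * g x)"
        by (simp add: LIMSEQ_unique)
    qed
  qed
  have pm: "(\<lambda>x. max (v x) 0) \<in> borel_measurable borel" "(\<lambda>x. max (- v x) 0) \<in> borel_measurable borel"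
    using v(1) by measurable
  have pb: "\<bar>max (v x) 0\<bar> \<le> K" "\<bar>max (- v x) 0\<bar> \<le> K" for x using v(2)[of x] by auto
  have "(LINT z|w. max (v (fst z)) 0 * F z) = (LINT x|lborel. max (v x) 0 * g x)"
    "(LINT z|w. max (- v (fst z)) 0 * F z) = (LINT x|lborel. max (- v x) 0 * g x)"
    using nonneg[OF pm(1)] nonneg[OF pm(2)] pb unfolding P_def by (auto simp: abs_le_iff)
  moreover have "v x * y = max (v x) 0 * y - max (- v x) 0 * y" for x y by (simp add: max_def)
  ultimately show "(LINT z|w. v (fst z) * F z) = (LINT x|lborel. v x * g x)"
    using intw[OF pm(1) pb(1)] intw[OF pm(2) pb(2)] intl[OF pm(1) pb(1)] intl[OF pm(2) pb(2)] by simp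
qed

lemma x_marginal_density_bounded_times:
  fixes w :: "('a::euclidean_space \<times> 'a) measure" and F :: "'a \<times> 'a \<Rightarrow> real" and g :: "'a \<Rightarrow> real"
  assumes F: "x_marginal_density w F g" and w: "sets w = sets borel"
    and A: "A \<in> sets borel" "bounded A"
    and v: "v \<in> borel_measurable borel" "\<And>x. x \<in> A \<Longrightarrow> \<bar>v x\<bar> \<le> (K::real)"
  shows "integrable w (\<lambda>z. indicator A (fst z) * v (fst z) * F z)"
    "integrable lborel (\<lambda>x. indicator A x * v x * g x)"
    "(LINT z|w. indicator A (fst z) * v (fst z) * F z) = (LINT x|lborel. indicator A x * v x * g x)"
proof -
  have ind: "indicator (S \<times> UNIV) z = (indicator S (fst z) :: real)" for S :: "'a set" and z :: "'a \<times> 'a"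
    by (auto split: split_indicator simp: mem_Times_iff)
  have mz: "set_integrable w (S \<times> UNIV) F \<and> set_integrable lborel S g \<and> (LINT z:S \<times> UNIV|w. F z) = (LINT x:S|lborel. g x)"
    if "S \<in> sets borel" "bounded S" for S
    using F that unfolding x_marginal_density_def by blast
  have 1: "integrable w (\<lambda>z. indicator A (fst z) * F z)" "integrable lborel (\<lambda>x. indicator A x * g x)"
    using mz[OF A] unfolding set_integrable_def by (simp_all add: ind)
  have 2: "(LINT z|w. indicator S (fst z) * (indicator A (fst z) * F z)) = (LINT x|lborel. indicator S x * (indicator A x * g x))"
    if S: "S \<in> sets borel" for S
  proof -
    have "S \<inter> A \<in> sets borel" "bounded (S \<inter> A)" using S A by (auto intro: bounded_subset)
    from mz[OF this] show ?thesis
      unfolding set_lebesgue_integral_def by (simp add: ind indicator_inter_arith mult.assoc)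
  qed
  have vm: "(\<lambda>x. indicator A x * v x) \<in> borel_measurable borel" using A(1) v(1) by measurable
  have vb: "\<bar>indicator A x * v x\<bar> \<le> \<bar>K\<bar>" for x
    using v(2)[of x] by (auto split: split_indicator)
  note M = marginal_bounded_times[OF 1 w 2 vm vb]
  have i2: "indicator A y * v y * (indicator A y * t) = indicator A y * v y * t" for y and t :: real
    by (simp split: split_indicator)
  show "integrable w (\<lambda>z. indicator A (fst z) * v (fst z) * F z)"
    "integrable lborel (\<lambda>x. indicator A x * v x * g x)"
    "(LINT z|w. indicator A (fst z) * v (fst z) * F z) = (LINT x|lborel. indicator A x * v x * g x)"
    using M unfolding i2 by blast+
qed

lemma AE_nonneg_marginal_density:
  fixes w :: "('a::euclidean_space \<times> 'a) measure"
  assumes \<rho>: "x_marginal_density w (\<lambda>(x, \<xi>). 1) \<rho>"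
  shows "AE x in lborel. 0 \<le> (\<rho> x :: real)"
proof -
  have "AE x in lborel. \<forall>n::nat. 0 \<le> indicator (ball 0 (real n)) x *\<^sub>R \<rho> x"
  proof (subst AE_all_countable, intro allI sigma_finite_measure.density_nonneg[OF sigma_finite_lborel])
    fix n :: nat
    show "integrable lborel (\<lambda>x. indicator (ball 0 (real n)) x *\<^sub>R \<rho> x)"
      using \<rho> unfolding x_marginal_density_def set_integrable_def[symmetric] by (auto simp: case_prod_unfold)
    fix A :: "'a set" assume "A \<in> sets lborel"
    then have A: "A \<inter> ball 0 (real n) \<in> sets borel" "bounded (A \<inter> ball 0 (real n))" by (auto intro: bounded_subset[of "ball 0 (real n)"])
    have "0 \<le> (LINT z:(A \<inter> ball 0 (real n)) \<times> UNIV|w. (1::real))"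
      unfolding set_lebesgue_integral_def by (intro integral_nonneg_AE) auto
    also have "\<dots> = (LINT x:A \<inter> ball 0 (real n)|lborel. \<rho> x)"
      using \<rho> A unfolding x_marginal_density_def by (auto simp: case_prod_unfold)
    also have "\<dots> = (LINT x:A|lborel. indicator (ball 0 (real n)) x *\<^sub>R \<rho> x)"
      unfolding set_lebesgue_integral_def by (simp add: indicator_inter_arith mult.assoc)
    finally show "0 \<le> (LINT x:A|lborel. indicator (ball 0 (real n)) x *\<^sub>R \<rho> x)" .
  qed
  then show ?thesis
  proof eventually_elim
    case (elim x)
    obtain n :: nat where "norm x < real n" using reals_Archimedean2 by blast
    then show ?case using elim[rule_format, of n] by simp
  qed
qed

lemma emeasure_cylinder:
  fixes w :: "('a::euclidean_space \<times> 'a) measure"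
  assumes w: "sets w = sets borel" "finite_measure w" and \<rho>: "x_marginal_density w (\<lambda>(x, \<xi>). 1) \<rho>"
    and \<rho>m[measurable]: "\<rho> \<in> borel_measurable borel"
    and A: "A \<in> sets borel"
  shows "emeasure w (A \<times> UNIV) = (\<integral>\<^sup>+x. ennreal (\<rho> x) * indicator A x \<partial>lborel)"
proof -
  interpret finite_measure w by fact
  have AEn: "AE x in lborel. 0 \<le> \<rho> x" by (rule AE_nonneg_marginal_density[OF \<rho>])
  let ?A = "\<lambda>n::nat. A \<inter> ball 0 (real n)"
  have As[measurable]: "?A n \<in> sets borel" for n using A by auto
  have Ws: "?A n \<times> UNIV \<in> sets w" for n unfolding w(1) using As[of n] by (auto simp: borel_prod[symmetric])
  have fin: "emeasure w (?A n \<times> UNIV) = (\<integral>\<^sup>+x. ennreal (\<rho> x) * indicator (?A n) x \<partial>lborel)" for n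
  proof -
    have b: "bounded (?A n)" by (auto intro: bounded_subset[of "ball 0 (real n)"])
    have m: "set_integrable lborel (?A n) \<rho>" "(LINT z:?A n \<times> UNIV|w. (1::real)) = (LINT x:?A n|lborel. \<rho> x)"
      using \<rho> As[of n] b unfolding x_marginal_density_def by (auto simp: case_prod_unfold)
    have "emeasure w (?A n \<times> UNIV) = ennreal (LINT z:?A n \<times> UNIV|w. (1::real))"
      unfolding set_lebesgue_integral_def using sets_eq_imp_space_eq[OF w(1)] by (simp add: emeasure_eq_measure)
    also have "\<dots> = ennreal (LINT x|lborel. indicator (?A n) x * \<rho> x)"
      unfolding m(2) by (simp add: set_lebesgue_integral_def)
    also have "\<dots> = (\<integral>\<^sup>+x. ennreal (indicator (?A n) x * \<rho> x) \<partial>lborel)"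
    proof (rule nn_integral_eq_integral[symmetric])
      show "integrable lborel (\<lambda>x. indicator (?A n) x * \<rho> x)" using m(1) by (simp add: set_integrable_def)
      show "AE x in lborel. 0 \<le> indicator (?A n) x * \<rho> x" using AEn by eventually_elim simp
    qed
    also have "\<dots> = (\<integral>\<^sup>+x. ennreal (\<rho> x) * indicator (?A n) x \<partial>lborel)"
      by (intro nn_integral_cong) (auto split: split_indicator)
    finally show ?thesis .
  qed
  have un: "(\<Union>n. ?A n) = A"
    using reals_Archimedean2 by (auto simp: dist_norm)
  have inc: "incseq ?A" by (auto simp: incseq_def)
  have "emeasure w (A \<times> UNIV) = emeasure w (\<Union>n. ?A n \<times> UNIV)"
    by (rule arg_cong[where f="emeasure w"]) (use un in auto)
  also have "\<dots> = (SUP n. emeasure w (?A n \<times> UNIV))"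
    using Ws inc by (intro SUP_emeasure_incseq[symmetric]) (auto simp: incseq_def)
  also have "\<dots> = (SUP n. emeasure (density lborel (\<lambda>x. ennreal (\<rho> x))) (?A n))"
    unfolding fin by (intro SUP_cong refl) (simp add: emeasure_density)
  also have "\<dots> = emeasure (density lborel (\<lambda>x. ennreal (\<rho> x))) (\<Union>n. ?A n)"
    using inc by (intro SUP_emeasure_incseq) auto
  also have "\<dots> = (\<integral>\<^sup>+x. ennreal (\<rho> x) * indicator A x \<partial>lborel)"
    unfolding un using A by (simp add: emeasure_density)
  finally show ?thesis .
qed

text \<open>
  On a bounded set where \<open>\<rho> > 0\<close> and the velocity \<open>u\<close> is bounded, the integral of \<open>|\<xi> - u(x)|\<^sup>2\<close> against
  \<open>w\<close> is expanded with the three marginals.  Countably many such sets cover \<open>\<rho> > 0\<close>, and \<open>w\<close> does not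
  charge the cylinder over \<open>\<rho> \<le> 0\<close>.
\<close>

lemma monokinetic_if_energy_le:
  fixes w :: "('a::euclidean_space \<times> 'a) measure" and \<rho> E :: "'a \<Rightarrow> real" and J :: "'a \<Rightarrow> 'a"
  assumes w: "sets w = sets borel" "finite_measure w" and m: "m > 0"
    and \<rho>: "x_marginal_density w (\<lambda>(x, \<xi>). 1) \<rho>"
    and J: "x_marginal_density w (\<lambda>(x, \<xi>). (1 / m) *\<^sub>R \<xi>) J"
    and E: "x_marginal_density w (\<lambda>(x, \<xi>). 1 / (2 * m) * (norm \<xi>)\<^sup>2) E"
    and meas[measurable]: "\<rho> \<in> borel_measurable borel" "J \<in> borel_measurable borel"
    and le: "AE x in lborel. 2 * m * E x * \<rho> x \<le> m\<^sup>2 * (norm (J x))\<^sup>2"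
  shows "w = monokinetic \<rho> (velocity m \<rho> J)"
proof -
  interpret finite_measure w by fact
  let ?u = "velocity m \<rho> J"
  have um[measurable]: "?u \<in> borel_measurable borel"
    unfolding velocity_def[abs_def] by measurable
  have fst_m[measurable]: "fst \<in> borel_measurable w" and snd_m[measurable]: "snd \<in> borel_measurable w"
    unfolding measurable_cong_sets[OF w(1) refl] by (intro borel_measurable_continuous_onI continuous_intros)+
  have Jb: "x_marginal_density w (\<lambda>z. (1 / m) * (snd z \<bullet> b)) (\<lambda>x. J x \<bullet> b)" for b
    unfolding x_marginal_density_def
  proof (intro ballI impI conjI)
    fix A :: "'a set" assume A: "A \<in> sets borel" "bounded A"
    have j: "set_integrable w (A \<times> UNIV) (\<lambda>z. (1 / m) *\<^sub>R snd z)" "set_integrable lborel A J"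
      "(LINT z:A \<times> UNIV|w. (1 / m) *\<^sub>R snd z) = (LINT x:A|lborel. J x)"
      using J A unfolding x_marginal_density_def by (auto simp: case_prod_unfold)
    have j1: "integrable w (\<lambda>z. indicator (A \<times> UNIV) z *\<^sub>R ((1 / m) *\<^sub>R snd z))" using j(1) by (simp only: set_integrable_def)
    have j2: "integrable lborel (\<lambda>x. indicator A x *\<^sub>R J x)" using j(2) by (simp only: set_integrable_def)
    have e1: "indicator (A \<times> UNIV) z *\<^sub>R ((1 / m) * (snd z \<bullet> b)) = (indicator (A \<times> UNIV) z *\<^sub>R ((1 / m) *\<^sub>R snd z)) \<bullet> b" for z
      by simp
    have e2: "indicator A x *\<^sub>R (J x \<bullet> b) = (indicator A x *\<^sub>R J x) \<bullet> b" for x by simp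
    show "set_integrable w (A \<times> UNIV) (\<lambda>z. (1 / m) * (snd z \<bullet> b))"
      unfolding set_integrable_def e1 by (rule integrable_inner_left[OF j1])
    show "set_integrable lborel A (\<lambda>x. J x \<bullet> b)"
      unfolding set_integrable_def e2 by (rule integrable_inner_left[OF j2])
    have "(LINT z:A \<times> UNIV|w. (1 / m) * (snd z \<bullet> b)) = (LINT z:A \<times> UNIV|w. (1 / m) *\<^sub>R snd z) \<bullet> b"
      unfolding set_lebesgue_integral_def e1 by (rule integral_inner_left[OF j1])
    also have "\<dots> = (LINT x:A|lborel. J x \<bullet> b)"
      unfolding j(3) unfolding set_lebesgue_integral_def e2 by (rule integral_inner_left[OF j2, symmetric])
    finally show "(LINT z:A \<times> UNIV|w. (1 / m) * (snd z \<bullet> b)) = (LINT x:A|lborel. J x \<bullet> b)" .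
  qed
  have E': "x_marginal_density w (\<lambda>z. 1 / (2 * m) * (norm (snd z))\<^sup>2) E" and \<rho>': "x_marginal_density w (\<lambda>z. 1) \<rho>"
    using E \<rho> by (simp_all add: case_prod_unfold)
  have conc: "AE z in w. fst z \<in> A \<longrightarrow> snd z = ?u (fst z)"
    if A[measurable]: "A \<in> sets borel" and bA: "bounded A" and pos: "\<And>x. x \<in> A \<Longrightarrow> \<rho> x > 0" and uK: "\<And>x. x \<in> A \<Longrightarrow> norm (?u x) \<le> K" for A K
  proof -
    have ub: "\<bar>?u x \<bullet> b\<bar> \<le> K" if "x \<in> A" "b \<in> Basis" for x b
      using uK[OF that(1)] Basis_le_norm[OF that(2), of "?u x"] by linarith
    have u2: "\<bar>(norm (?u x))\<^sup>2\<bar> \<le> K\<^sup>2" if "x \<in> A" for x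
      using power_mono[OF uK[OF that] norm_ge_zero, of 2] by simp
    have one: "\<bar>1::real\<bar> \<le> 1" by simp
    have mc: "(\<lambda>x::'a. 1::real) \<in> borel_measurable borel" "(\<lambda>x. ?u x \<bullet> b) \<in> borel_measurable borel"
       "(\<lambda>x. (norm (?u x))\<^sup>2) \<in> borel_measurable borel" for b by measurable
    note T1 = x_marginal_density_bounded_times[OF E' w(1) A bA mc(1) one]
    note T2 = x_marginal_density_bounded_times[OF Jb w(1) A bA mc(2) ub]
    note T3 = x_marginal_density_bounded_times[OF \<rho>' w(1) A bA mc(3) u2]
    let ?I = "\<lambda>z. indicator A (fst z) * (norm (snd z - ?u (fst z)))\<^sup>2"
    \<comment> \<open>The constant factors \<open>1\<close> match the form of \<open>x_marginal_density_bounded_times\<close>.\<close>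
    have pw: "?I z = 2 * m * (indicator A (fst z) * 1 * (1 / (2 * m) * (norm (snd z))\<^sup>2))
      - 2 * m * (\<Sum>b\<in>Basis. indicator A (fst z) * (?u (fst z) \<bullet> b) * ((1 / m) * (snd z \<bullet> b)))
      + indicator A (fst z) * (norm (?u (fst z)))\<^sup>2 * 1" for z
    proof -
      have 1: "(norm (snd z - ?u (fst z)))\<^sup>2 = (norm (snd z))\<^sup>2 - 2 * (?u (fst z) \<bullet> snd z) + (norm (?u (fst z)))\<^sup>2"
        by (simp add: power2_norm_eq_inner inner_diff_left inner_diff_right inner_commute)
      have 2: "(\<Sum>b\<in>Basis. indicator A (fst z) * (?u (fst z) \<bullet> b) * ((1 / m) * (snd z \<bullet> b))) =
        (indicator A (fst z) / m) * (?u (fst z) \<bullet> snd z)"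
        unfolding euclidean_inner[of "?u (fst z)" "snd z"] sum_distrib_left by (intro sum.cong) auto
      show ?thesis unfolding 1 2 using m by (simp add: algebra_simps)
    qed
    have Ts: "integrable w (\<lambda>z. \<Sum>b\<in>Basis. indicator A (fst z) * (?u (fst z) \<bullet> b) * ((1 / m) * (snd z \<bullet> b)))"
      by (rule Bochner_Integration.integrable_sum, rule T2(1))
    have Tl: "integrable lborel (\<lambda>x. \<Sum>b\<in>Basis. indicator A x * (?u x \<bullet> b) * (J x \<bullet> b))"
      by (rule Bochner_Integration.integrable_sum, rule T2(2))
    define g1 where "g1 x = indicator A x * 1 * E x" for x
    define g2 where "g2 x = (\<Sum>b\<in>Basis. indicator A x * (?u x \<bullet> b) * (J x \<bullet> b))" for x
    define g3 where "g3 x = indicator A x * (norm (?u x))\<^sup>2 * \<rho> x" for x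
    have g: "integrable lborel g1" "integrable lborel g2" "integrable lborel g3"
      unfolding g1_def[abs_def] g2_def[abs_def] g3_def[abs_def] by (rule T1(2), rule Tl, rule T3(2))
    define f1 where "f1 z = indicator A (fst z) * 1 * (1 / (2 * m) * (norm (snd z))\<^sup>2)" for z :: "'a \<times> 'a"
    define f2 where "f2 z = (\<Sum>b\<in>Basis. indicator A (fst z) * (?u (fst z) \<bullet> b) * ((1 / m) * (snd z \<bullet> b)))" for z :: "'a \<times> 'a"
    define f3 where "f3 z = indicator A (fst z) * (norm (?u (fst z)))\<^sup>2 * 1" for z :: "'a \<times> 'a"
    have f: "integrable w f1" "integrable w f2" "integrable w f3"
      unfolding f1_def[abs_def] f2_def[abs_def] f3_def[abs_def] by (rule T1(1), rule Ts, rule T3(1))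
    have pw': "?I z = 2 * m * f1 z - 2 * m * f2 z + f3 z" for z unfolding f1_def f2_def f3_def by (rule pw)
    have Ii: "integrable w ?I" unfolding pw' using f by simp
    have "(LINT z|w. ?I z) = 2 * m * (LINT z|w. f1 z) - 2 * m * (LINT z|w. f2 z) + (LINT z|w. f3 z)"
      unfolding pw' using f by simp
    also have "(LINT z|w. f1 z) = (LINT x|lborel. g1 x)"
      unfolding f1_def g1_def by (rule T1(3))
    also have "(LINT z|w. f2 z) = (LINT x|lborel. g2 x)"
    proof -
      have "(LINT z|w. f2 z) = (\<Sum>b\<in>Basis. (LINT z|w. indicator A (fst z) * (?u (fst z) \<bullet> b) * ((1 / m) * (snd z \<bullet> b))))"
        unfolding f2_def by (rule Bochner_Integration.integral_sum, rule T2(1))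
      also have "\<dots> = (\<Sum>b\<in>Basis. (LINT x|lborel. indicator A x * (?u x \<bullet> b) * (J x \<bullet> b)))"
        by (rule sum.cong[OF refl], rule T2(3))
      also have "\<dots> = (LINT x|lborel. g2 x)"
        unfolding g2_def by (rule Bochner_Integration.integral_sum[symmetric], rule T2(2))
      finally show ?thesis .
    qed
    also have "(LINT z|w. f3 z) = (LINT x|lborel. g3 x)"
      unfolding f3_def g3_def by (rule T3(3))
    also have "2 * m * (LINT x|lborel. g1 x) - 2 * m * (LINT x|lborel. g2 x) + (LINT x|lborel. g3 x) =
      (LINT x|lborel. 2 * m * g1 x - 2 * m * g2 x + g3 x)"
      using g by simp
    also have "\<dots> \<le> 0"
    proof -
      have ae:  "AE x in lborel. 2 * m * g1 x - 2 * m * g2 x + g3 x \<le> 0"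
        unfolding g1_def g2_def g3_def
        using le
      proof eventually_elim
        case (elim x)
        show ?case
        proof (cases "x \<in> A")
          case True
          have p: "\<rho> x > 0" using pos[OF True] .
          have u: "?u x = (m / \<rho> x) *\<^sub>R J x" using p by (simp add: velocity_def)
          have s: "(\<Sum>b\<in>Basis. indicator A x * (?u x \<bullet> b) * (J x \<bullet> b)) = m / \<rho> x * (norm (J x))\<^sup>2"
            using True unfolding power2_norm_eq_inner euclidean_inner[of "J x" "J x"] u sum_distrib_left
            by (intro sum.cong) auto
          have n: "(norm (?u x))\<^sup>2 * \<rho> x = m\<^sup>2 * (norm (J x))\<^sup>2 / \<rho> x"
            unfolding u using p m by (simp add: power_mult_distrib power_divide power2_eq_square)
          have l: "2 * m * E x \<le> m\<^sup>2 * (norm (J x))\<^sup>2 / \<rho> x" using elim p by (simp add: pos_le_divide_eq)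
          have q: "2 * m * (m / \<rho> x * (norm (J x))\<^sup>2) = 2 * (m\<^sup>2 * (norm (J x))\<^sup>2 / \<rho> x)"
            by (simp add: power2_eq_square)
          have i: "indicator A x * (norm (?u x))\<^sup>2 * \<rho> x = (norm (?u x))\<^sup>2 * \<rho> x"
            "indicator A x * 1 * E x = E x" using True by simp_all
          show ?thesis unfolding s i n q using l by linarith
        qed simp
      qed
      have "0 \<le> (LINT x|lborel. - (2 * m * g1 x - 2 * m * g2 x + g3 x))"
        by (rule integral_nonneg_AE) (use ae in \<open>auto elim: eventually_mono\<close>)
      then show ?thesis unfolding Bochner_Integration.integral_minus by linarith
    qed
    finally have "(LINT z|w. ?I z) \<le> 0" .
    moreover have "(LINT z|w. ?I z) \<ge> 0" by (intro integral_nonneg_AE) auto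
    ultimately have "(LINT z|w. ?I z) = 0" by linarith
    then have "AE z in w. ?I z = 0" using Ii by (subst (asm) integral_nonneg_eq_0_iff_AE) auto
    then show ?thesis by eventually_elim (auto split: split_indicator_asm)
  qed
  define A where "A k = {x \<in> ball 0 (real k). \<rho> x > 0 \<and> norm (?u x) \<le> real k}" for k :: nat
  have Am: "A k \<in> sets borel" for k
  proof -
    have "{x \<in> space borel. \<rho> x > 0 \<and> norm (?u x) \<le> real k} \<in> sets borel" by measurable
    moreover have "A k = ball 0 (real k) \<inter> {x \<in> space borel. \<rho> x > 0 \<and> norm (?u x) \<le> real k}" by (auto simp: A_def)
    ultimately show ?thesis by auto
  qed
  have "bounded (A k)" for k by (rule bounded_subset[of "ball 0 (real k)"]) (auto simp: A_def)
  then have "AE z in w. \<forall>k. fst z \<in> A k \<longrightarrow> snd z = ?u (fst z)"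
    by (subst AE_all_countable, intro allI conc[OF Am, of _ "real _"]) (auto simp: A_def)
  moreover have "AE z in w. \<rho> (fst z) > 0"
  proof -
    let ?N = "{x \<in> space borel. \<rho> x \<le> 0}"
    have N: "?N \<in> sets borel" by measurable
    have "emeasure w (?N \<times> UNIV) = (\<integral>\<^sup>+x. ennreal (\<rho> x) * indicator ?N x \<partial>lborel)"
      by (rule emeasure_cylinder[OF w \<rho> meas(1) N])
    also have "\<dots> = (\<integral>\<^sup>+x. 0 \<partial>(lborel :: 'a measure))"
      by (intro nn_integral_cong) (auto split: split_indicator simp: ennreal_neg)
    finally have "?N \<times> UNIV \<in> null_sets w"
      using N by (auto simp: null_sets_def w(1) borel_prod[symmetric])
    then show ?thesis by (rule AE_I') (auto simp: mem_Times_iff)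
  qed
  ultimately have graph: "AE z in w. snd z = ?u (fst z)"
  proof eventually_elim
    case (elim z)
    obtain k :: nat where "max (norm (fst z)) (norm (?u (fst z))) < real k" using reals_Archimedean2 by blast
    then have "fst z \<in> A k" using elim(2) by (auto simp: A_def)
    then show ?case using elim(1) by blast
  qed
  have marg: "distr w borel fst = density lborel (\<lambda>x. ennreal (\<rho> x))"
  proof (rule measure_eqI)
    fix S assume "S \<in> sets (distr w borel fst)"
    then have S: "S \<in> sets borel" by simp
    have sp: "space w = UNIV" using sets_eq_imp_space_eq[OF w(1)] by simp
    have "fst -` S \<inter> space w = S \<times> UNIV" unfolding sp by auto
    then have "emeasure (distr w borel fst) S = emeasure w (S \<times> UNIV)"
      using S by (simp add: emeasure_distr)
    then show "emeasure (distr w borel fst) S = emeasure (density lborel (\<lambda>x. ennreal (\<rho> x))) S"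
      using emeasure_cylinder[OF w \<rho> meas(1) S] S by (simp add: emeasure_density)
  qed simp
  have gm: "(\<lambda>x. (x, ?u x)) \<in> borel \<rightarrow>\<^sub>M borel" unfolding borel_prod[symmetric] by measurable
  have "w = distr w borel (\<lambda>z. z)"
    using w(1) by (intro measure_eqI) (auto simp: emeasure_distr measurable_cong_sets[OF w(1) refl] sets_eq_imp_space_eq[OF w(1)])
  also have "\<dots> = distr w borel (\<lambda>z. (fst z, ?u (fst z)))"
  proof (rule distr_cong_AE)
    show "AE z in w. z = (fst z, ?u (fst z))" using graph by eventually_elim (simp add: prod_eq_iff)
    show "(\<lambda>z. z) \<in> w \<rightarrow>\<^sub>M borel" by (simp add: measurable_cong_sets[OF w(1) refl])
    show "(\<lambda>z. (fst z, ?u (fst z))) \<in> w \<rightarrow>\<^sub>M borel" by (rule measurable_compose[OF fst_m gm])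
  qed auto
  also have "\<dots> = distr (distr w borel fst) borel (\<lambda>x. (x, ?u x))"
    by (subst distr_distr[OF gm fst_m]) (simp add: o_def)
  also have "\<dots> = monokinetic \<rho> ?u" unfolding marg monokinetic_def ..
  finally show ?thesis .
qed

section \<open>Wigner measures of pure states are monokinetic\<close>

theorem proposition2:
  fixes m :: real
    and \<psi> :: "real \<Rightarrow> real ^ 'd \<Rightarrow> complex"
    and h :: "nat \<Rightarrow> real"
    and w :: "((real ^ 'd) \<times> (real ^ 'd)) measure"
    and \<rho> E :: "real ^ 'd \<Rightarrow> real"
    and J :: "real ^ 'd \<Rightarrow> real ^ 'd"
    and E\<^sub>h :: "nat \<Rightarrow> real ^ 'd \<Rightarrow> real"
    and J\<^sub>h grad\<rho>\<^sub>h :: "nat \<Rightarrow> real ^ 'd \<Rightarrow> real ^ 'd"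
  assumes m_pos: "m > 0"
    and \<psi>_H2: "\<And>\<epsilon>. 0 < \<epsilon> \<Longrightarrow> \<epsilon> \<le> 1 \<Longrightarrow> sobolev_H 2 (\<psi> \<epsilon>)"
    and \<psi>_norm: "\<And>\<epsilon>. 0 < \<epsilon> \<Longrightarrow> \<epsilon> \<le> 1 \<Longrightarrow> L2_norm_on UNIV (\<psi> \<epsilon>) = 1"
    and h_range: "\<And>n. 0 < h n \<and> h n \<le> 1"
    and h_lim: "h \<longlonglongrightarrow> 0"
    and w_borel: "sets w = sets borel"
    and w_finite: "finite_measure w"
    and wigner_conv: "tempered_conv (\<lambda>n. wigner (h n) (\<psi> (h n))) w"
    and grad: "\<And>n. weak_gradient (wigner_density (h n) (\<psi> (h n))) (grad\<rho>\<^sub>h n)"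
    and grad_conv: "\<And>r. r > 0 \<Longrightarrow>
          (\<lambda>n. ennreal (h n) * L2_norm_on (ball 0 r) (grad\<rho>\<^sub>h n)) \<longlonglongrightarrow> 0"
    and E\<^sub>h: "\<And>n. wigner_energy m (h n) (\<psi> (h n)) (E\<^sub>h n)"
    and E: "x_marginal_density w (\<lambda>(x, \<xi>). 1 / (2 * m) * (norm \<xi>)\<^sup>2) E"
    and E_conv: "L2_weak_conv E\<^sub>h E"
    and \<rho>: "x_marginal_density w (\<lambda>(x, \<xi>). 1) \<rho>"
    and \<rho>_conv: "L2loc_conv (\<lambda>n. wigner_density (h n) (\<psi> (h n))) \<rho>"
    and J\<^sub>h: "\<And>n. wigner_current m (h n) (\<psi> (h n)) (J\<^sub>h n)"
    and J: "x_marginal_density w (\<lambda>(x, \<xi>). (1 / m) *\<^sub>R \<xi>) J"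
    and J_conv: "L2loc_conv J\<^sub>h J"
  shows "w = monokinetic \<rho> (velocity m \<rho> J)"
proof -
  have \<Psi>: "sobolev_H 2 (\<psi> (h n))" and hn: "h n > 0" for n
    using \<psi>_H2 h_range by auto
  have \<rho>0: "AE x in lborel. 0 \<le> \<rho> x" by (rule AE_nonneg_marginal_density[OF \<rho>])
  have "AE x in lborel. \<forall>j::nat. 2 * m * E x * trunc (inverse (real (Suc j))) (\<rho> x) \<le> m\<^sup>2 * (norm (J x))\<^sup>2"
    unfolding AE_all_countable
    by (intro allI truncated_limit_inequality[OF m_pos hn h_lim \<Psi> grad grad_conv E\<^sub>h E_conv \<rho>_conv \<rho>0 J\<^sub>h J_conv])
      (simp_all del: of_nat_Suc)
  then have "AE x in lborel. 2 * m * E x * \<rho> x \<le> m\<^sup>2 * (norm (J x))\<^sup>2"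
    by eventually_elim (rule le_if_truncations_le, blast)
  moreover have "\<rho> \<in> borel_measurable borel" "J \<in> borel_measurable borel"
    using \<rho>_conv J_conv by (simp_all add: L2loc_conv_def L2loc_fun_def)
  ultimately show ?thesis
    by (intro monokinetic_if_energy_le[OF w_borel w_finite m_pos \<rho> J E])
qed

end
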